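(* Let $G$ be an outer-1-planar graph. If $\Delta(G)=4$ and $\vartheta(G)\geq 3$, then $\chi'_l(G)=\chi'(G)=4$.
   Context: All graphs are finite, simple and undirected; $\Delta(G)$ is the maximum degree. A graph is outer-1-planar if it can be drawn in the plane so that all vertices lie on the outer face and each edge is crossed at most once; such a drawing is an outer-1-plane graph, and it is called good if its number of crossings is as small as possible among all such drawings. Each crossing $c$ in such a drawing is formed by two mutually crossing edges; let $M(c)$ be the set of the four end-vertices of these two edges. For distinct crossings $c_1,c_2$ of a drawing $G'$, define $d_{G'}(c_1,c_2)=\min\{d_{G}(v_1,v_2): v_1\in M(c_1), v_2\in M(c_2)\}$, where $d_G$ is the graph distance. The crossing distance $\vartheta(G)$ is the minimum of $d_{G'}(c_1,c_2)$ over all good drawings $G'$ of $G$ and all pairs of distinct crossings $c_1,c_2$ of $G'$; set $\vartheta(G)=\infty$ if $G$ has a good drawing with at most one crossing. $\chi'(G)$ is the edge chromatic number; $\chi'_l(G)$ is the list edge chromatic number, i.e. the least $k$ such that for every assignment of lists $L(e)$ with $|L(e)|=k$ to the edges there is a proper edge coloring $c$ with $c(e)\in L(e)$ for all $e$. *)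

theory Defs
  imports "HOL-Analysis.Analysis"
begin

definition finite_simple_graph :: "'a set \<Rightarrow> 'a set set \<Rightarrow> bool" where
  "finite_simple_graph V E \<longleftrightarrow> finite V \<and> (\<forall>e\<in>E. e \<subseteq> V \<and> card e = 2)"

definition vertex_degree :: "'a set set \<Rightarrow> 'a \<Rightarrow> nat" where
  "vertex_degree E v = card {e \<in> E. v \<in> e}"

text \<open>The inserted \<open>0\<close> only matters for the graph without vertices.\<close>

definition max_degree :: "'a set \<Rightarrow> 'a set set \<Rightarrow> nat" where
  "max_degree V E = Max (insert 0 (vertex_degree E ` V))"

definition is_walk :: "'a set \<Rightarrow> 'a set set \<Rightarrow> 'a list \<Rightarrow> bool" where
  "is_walk V E xs \<longleftrightarrow>
     xs \<noteq> [] \<and> set xs \<subseteq> V \<and> (\<forall>i. Suc i < length xs \<longrightarrow> {xs ! i, xs ! Suc i} \<in> E)"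

text \<open>The distance between vertices of different components is \<open>\<infinity>\<close>, the infimum of the empty set.\<close>

definition graph_dist :: "'a set \<Rightarrow> 'a set set \<Rightarrow> 'a \<Rightarrow> 'a \<Rightarrow> enat" where
  "graph_dist V E u v =
     Inf {enat (length xs - 1) | xs. is_walk V E xs \<and> hd xs = u \<and> last xs = v}"

text \<open>
  A drawing places the vertices at points of the plane (\<open>p\<close>) and represents every edge by a
  simple arc (\<open>g\<close>) that joins its end-vertices and contains no other vertex.
\<close>

definition is_drawing ::
    "'a set \<Rightarrow> 'a set set \<Rightarrow> ('a \<Rightarrow> complex) \<Rightarrow> ('a set \<Rightarrow> real \<Rightarrow> complex) \<Rightarrow> bool" where
  "is_drawing V E p g \<longleftrightarrow>
     inj_on p V \<and>
     (\<forall>e\<in>E. arc (g e) \<and> {pathstart (g e), pathfinish (g e)} = p ` e \<and>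
            path_image (g e) \<inter> p ` V = p ` e)"

definition drawing_image ::
    "'a set \<Rightarrow> 'a set set \<Rightarrow> ('a \<Rightarrow> complex) \<Rightarrow> ('a set \<Rightarrow> real \<Rightarrow> complex) \<Rightarrow> complex set" where
  "drawing_image V E p g = p ` V \<union> (\<Union>e\<in>E. path_image (g e))"

text \<open>
  A crossing is recorded as a point together with the unordered pair of edges meeting there.
  Every common point of two edges other than a vertex counts, whether the edges cross
  transversally or merely touch and whether or not they are adjacent; touching points and crossings
  of adjacent edges can be removed from a drawing in which every edge is crossed at most once,
  so they never occur in a drawing with the fewest crossings. Three edges through one point
  give three crossings.
\<close>

definition crossings ::
    "'a set \<Rightarrow> 'a set set \<Rightarrow> ('a \<Rightarrow> complex) \<Rightarrow> ('a set \<Rightarrow> real \<Rightarrow> complex)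
      \<Rightarrow> (complex \<times> 'a set set) set" where
  "crossings V E p g =
     {(x, {e, f}) | x e f. e \<in> E \<and> f \<in> E \<and> e \<noteq> f \<and>
        x \<in> path_image (g e) \<inter> path_image (g f) - p ` V}"

definition crossing_ends :: "complex \<times> 'a set set \<Rightarrow> 'a set" where
  "crossing_ends c = \<Union> (snd c)"

text \<open>
  The outer face is the unbounded component of the complement of the drawing. As the drawing is a
  bounded subset of the plane, this is its \<^const>\<open>outside\<close>.
\<close>

definition outer_1_plane ::
    "'a set \<Rightarrow> 'a set set \<Rightarrow> ('a \<Rightarrow> complex) \<Rightarrow> ('a set \<Rightarrow> real \<Rightarrow> complex) \<Rightarrow> bool" where
  "outer_1_plane V E p g \<longleftrightarrow>
     is_drawing V E p g \<and>
     (\<forall>v\<in>V. p v \<in> frontier (outside (drawing_image V E p g))) \<and>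
     (\<forall>e\<in>E. \<forall>c\<in>crossings V E p g. \<forall>c'\<in>crossings V E p g.
        e \<in> snd c \<and> e \<in> snd c' \<longrightarrow> c = c')"

definition outer_1_planar :: "'a set \<Rightarrow> 'a set set \<Rightarrow> bool" where
  "outer_1_planar V E \<longleftrightarrow> (\<exists>p g. outer_1_plane V E p g)"

text \<open>The crossing sets compared here are finite, since every edge belongs to at most one crossing.\<close>

definition good_drawing ::
    "'a set \<Rightarrow> 'a set set \<Rightarrow> ('a \<Rightarrow> complex) \<Rightarrow> ('a set \<Rightarrow> real \<Rightarrow> complex) \<Rightarrow> bool" where
  "good_drawing V E p g \<longleftrightarrow>
     outer_1_plane V E p g \<and>
     (\<forall>p' g'. outer_1_plane V E p' g' \<longrightarrow> card (crossings V E p g) \<le> card (crossings V E p' g'))"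

definition dist_of_crossings ::
    "'a set \<Rightarrow> 'a set set \<Rightarrow> complex \<times> 'a set set \<Rightarrow> complex \<times> 'a set set \<Rightarrow> enat" where
  "dist_of_crossings V E c1 c2 =
     Inf {graph_dist V E v1 v2 | v1 v2. v1 \<in> crossing_ends c1 \<and> v2 \<in> crossing_ends c2}"

text \<open>
  If good drawings have at most one crossing, this is the infimum of the empty set, which is \<open>\<infinity>\<close>.
\<close>

definition crossing_distance :: "'a set \<Rightarrow> 'a set set \<Rightarrow> enat" where
  "crossing_distance V E =
     Inf {dist_of_crossings V E c1 c2 | p g c1 c2.
            good_drawing V E p g \<and> c1 \<in> crossings V E p g \<and> c2 \<in> crossings V E p g \<and> c1 \<noteq> c2}"

definition proper_edge_coloring :: "'a set set \<Rightarrow> ('a set \<Rightarrow> nat) \<Rightarrow> bool" where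
  "proper_edge_coloring E c \<longleftrightarrow>
     (\<forall>e\<in>E. \<forall>f\<in>E. e \<noteq> f \<and> e \<inter> f \<noteq> {} \<longrightarrow> c e \<noteq> c f)"

definition edge_chromatic_number :: "'a set set \<Rightarrow> nat" where
  "edge_chromatic_number E =
     (LEAST k. \<exists>c. proper_edge_coloring E c \<and> c ` E \<subseteq> {..<k})"

definition list_edge_chromatic_number :: "'a set set \<Rightarrow> nat" where
  "list_edge_chromatic_number E =
     (LEAST k. \<forall>L :: 'a set \<Rightarrow> nat set. (\<forall>e\<in>E. finite (L e) \<and> card (L e) = k) \<longrightarrow>
        (\<exists>c. proper_edge_coloring E c \<and> (\<forall>e\<in>E. c e \<in> L e)))"

end

theory Submission
  imports Defs "HOL-Computational_Algebra.Polynomial"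
begin

text \<open>
  Cut the drawing at its crossings to obtain a plane graph. In a plane graph any two disjoint chords of
  a circle with all vertices on the outer face do not cross, by the theta curve theorem; gluing blocks
  along cut vertices gives a linear order of the vertices of \<open>G\<close> such that two edges whose ends
  interleave in this order cross in the drawing. So only the combinatorics of interleaving pairs matters: an
  edge interleaves with at most one other edge, and different interleaving pairs are far apart.

  Now take a smallest subgraph that cannot be coloured from the given lists of four colours. It contains no
  subgraph that is colourable from the lists left over after colouring the rest; the small subgraphs needed
  are handled by the Alon-Tarsi method (a nonvanishing coefficient of the graph polynomial) or by hand.
  By induction, every interval of the order that is attached to the rest only at its two ends has one
  of a few shapes (\<open>typed\<close> below), because combining two such intervals, or four vertices with
  interleaving edges, either gives one of these shapes again or a reducible subgraph. The whole vertex set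
  is such an interval, but it has none of these shapes.
\<close>

section \<open>List colouring of small configurations\<close>

text \<open>Distance 3 enters in one way: every nonempty shape except an ear has a crossing within
  distance 1 of each of its two ends. Two such pieces meeting in a vertex would bring two crossings
  within distance 2, so one of them is empty or an ear, which keeps the list of shapes finite. The
  configurations treated by hand are out of reach of Alon-Tarsi. Their list sizes minus one add up
  to exactly the number of conflicting pairs of edges, so there is a single candidate monomial.
  Exchanging the vertices \<open>b\<close> and \<open>c\<close> fixes this monomial but reverses the
  three factors for \<open>ab, ac\<close>, for \<open>db, dc\<close> and for \<open>bv, cv\<close>;
  it negates the polynomial, and the coefficient is 0. Instead, the lists that block a colouring are
  classified. The topological obstacle is that cutting at crossings creates vertices that need not
  lie on the outer face. What remains true is that no two of them are adjacent, so a path with two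
  consecutive inner vertices always meets an outer vertex.\<close>

lemma lagrange_power_sum:
  fixes A :: "real set"
  assumes "finite A" "card A = Suc m" "k \<le> m"
  shows "(\<Sum>x\<in>A. x ^ k / (\<Prod>y\<in>A - {x}. x - y)) = (if k = m then 1 else 0)"
proof -
  define b where "b x = (\<Prod>y\<in>A - {x}. [:- y, 1:])" for x :: real
  have degb: "degree (b x) = m" "lead_coeff (b x) = 1" if "x \<in> A" for x
  proof -
    have "degree (b x) = (\<Sum>y\<in>A - {x}. degree [:- y, 1:])"
      unfolding b_def by (subst degree_prod_eq_sum_degree) auto
    then show "degree (b x) = m" using assms that by simp
    show "lead_coeff (b x) = 1" unfolding b_def by (simp only: lead_coeff_prod) simp
  qed
  \<comment> \<open>\<open>p\<close> interpolates X^k on \<open>A\<close>. As every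
    \<open>b x\<close> is monic of degree \<open>m\<close>, the coefficient of \<open>p\<close> at
    X^m is the sum in question, while \<open>p\<close> is X^k itself because \<open>k\<close> is at
    most \<open>m\<close>.\<close>
  define p where "p = (\<Sum>x\<in>A. smult (x ^ k / (\<Prod>y\<in>A - {x}. x - y)) (b x))"
  have polyb: "poly (b x) z = (\<Prod>y\<in>A - {x}. z - y)" for x z
    unfolding b_def by (simp add: poly_prod)
  have "poly p z = poly (monom 1 k) z" if "z \<in> A" for z
  proof -
    have 0: "poly (b x) z = 0" if "x \<in> A" "x \<noteq> z" for x
      using that \<open>z \<in> A\<close> assms by (auto simp: polyb)
    have "poly p z = (\<Sum>x\<in>A. if x = z then z ^ k else 0)"
      unfolding p_def poly_sum
    proof (intro sum.cong refl)
      fix x assume "x \<in> A"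
      show "poly (smult (x ^ k / (\<Prod>y\<in>A - {x}. x - y)) (b x)) z = (if x = z then z ^ k else 0)"
      proof (cases "x = z")
        case True
        have "(\<Prod>y\<in>A - {z}. z - y) \<noteq> 0" using assms by auto
        then show ?thesis using True by (simp add: polyb)
      qed (use 0 \<open>x \<in> A\<close> in simp)
    qed
    then show ?thesis using that assms by (simp add: poly_monom)
  qed
  moreover have "degree p \<le> m"
    unfolding p_def using assms degb by (intro degree_sum_le) (auto intro: order_trans[OF degree_smult_le])
  moreover have "degree (monom 1 k :: real poly) \<le> m"
    using assms by (simp add: degree_monom_eq)
  ultimately have "p = monom 1 k"
    using assms by (intro poly_eqI_degree[of A]) auto
  then have "coeff p m = coeff (monom 1 k) m" by simp
  moreover have "coeff p m = (\<Sum>x\<in>A. x ^ k / (\<Prod>y\<in>A - {x}. x - y))"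
    unfolding p_def coeff_sum using degb by (intro sum.cong) auto
  ultimately show ?thesis by simp
qed

text \<open>
  The coefficient of the monomial with exponent vector \<open>r\<close> in the product of all \<open>X\<^sub>i - X\<^sub>j\<close>,
  \<open>(i, j)\<close> ranging over the list.
\<close>

fun diff_coeff :: "(nat \<times> nat) list \<Rightarrow> nat list \<Rightarrow> int" where
  "diff_coeff [] r = (if \<forall>k\<in>set r. k = 0 then 1 else 0)"
| "diff_coeff ((i, j) # ps) r =
     (if r ! i = 0 then 0 else diff_coeff ps (r[i := r ! i - 1])) -
     (if r ! j = 0 then 0 else diff_coeff ps (r[j := r ! j - 1]))"

text \<open>
  The functional that sums a polynomial over the grid with Lagrange weights annihilates every
  monomial of the critical total degree except the critical one.
\<close>

lemma alon_tarsi: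
  fixes A :: "nat \<Rightarrow> real set"
  assumes fin: "\<And>i. i < n \<Longrightarrow> finite (A i)" and card: "\<And>i. i < n \<Longrightarrow> card (A i) = Suc (r ! i)"
    and len: "length r = n" and ps: "\<And>i j. (i, j) \<in> set ps \<Longrightarrow> i < n \<and> j < n"
    and deg: "sum_list r = length ps" and nz: "diff_coeff ps r \<noteq> 0"
  obtains x where "\<And>i. i < n \<Longrightarrow> x i \<in> A i" "\<And>i j. (i, j) \<in> set ps \<Longrightarrow> x i \<noteq> x j"
proof -
  define w where "w i x = 1 / (\<Prod>y\<in>A i - {x}. x - y)" for i x
  define \<Lambda> where "\<Lambda> F = (\<Sum>x\<in>Pi\<^sub>E {..<n} A. (\<Prod>i<n. w i (x i)) * F x)" for F :: "(nat \<Rightarrow> real) \<Rightarrow> real"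
  have mono: "\<Lambda> (\<lambda>x. \<Prod>i<n. x i ^ s i) = (\<Prod>i<n. \<Sum>x\<in>A i. w i x * x ^ s i)" for s
    unfolding \<Lambda>_def using fin
    by (subst prod_sum_PiE) (auto simp: prod.distrib)
  have mono0: "\<Lambda> (\<lambda>x. \<Prod>i<n. x i ^ s i) = 0" if "i < n" "s i < r ! i" for s i
  proof -
    have "(\<Sum>x\<in>A i. w i x * x ^ s i) = 0"
      using lagrange_power_sum[of "A i" "r ! i" "s i"] that fin card unfolding w_def by simp
    then show ?thesis unfolding mono using that by (intro prod_zero) auto
  qed
  have mono1: "\<Lambda> (\<lambda>x. \<Prod>i<n. x i ^ (r ! i)) = 1"
  proof -
    have "(\<Sum>x\<in>A i. w i x * x ^ (r ! i)) = 1" if "i < n" for i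
      using lagrange_power_sum[of "A i" "r ! i" "r ! i"] that fin card unfolding w_def by simp
    then show ?thesis unfolding mono by simp
  qed
  \<comment> \<open>\<open>M qs s\<close> applies the functional to the factors in \<open>qs\<close>
    that are not yet expanded, times the monomial with exponents \<open>s\<close>. Expanding one
    factor is the recursion of \<open>diff_coeff\<close>.\<close>
  define M where "M qs s = \<Lambda> (\<lambda>x. (\<Prod>(i, j)\<leftarrow>qs. x i - x j) * (\<Prod>i<n. x i ^ s i))" for qs s
  have step: "M ((i, j) # qs) s = M qs (s(i := Suc (s i))) - M qs (s(j := Suc (s j)))"
    if "i < n" "j < n" for i j qs s
  proof -
    have *: "(\<Prod>k<n. x k ^ (s(i := Suc (s i))) k) = x i * (\<Prod>k<n. x k ^ s k)" if "i < n" for x :: "nat \<Rightarrow> real" and i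
    proof -
      have "(\<Prod>k\<in>{..<n} - {i}. x k ^ (s(i := Suc (s i))) k) = (\<Prod>k\<in>{..<n} - {i}. x k ^ s k)"
        by (intro prod.cong) auto
      then show ?thesis using that by (simp add: prod.remove[of "{..<n}" i] del: fun_upd_apply) simp
    qed
    show ?thesis
      unfolding M_def \<Lambda>_def sum_subtractf[symmetric] *[OF that(1)] *[OF that(2)]
      by (intro sum.cong refl) (simp add: algebra_simps)
  qed
  have s1: "(\<Sum>k<n. if k = a then Suc (s a) else s k) = Suc (\<Sum>k<n. s k)" if "a < n" for a and s :: "nat \<Rightarrow> nat"
  proof -
    have "(\<Sum>k\<in>{..<n} - {a}. (s(a := Suc (s a))) k) = (\<Sum>k\<in>{..<n} - {a}. s k)"
      by (intro sum.cong) auto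
    then have "(\<Sum>k<n. (s(a := Suc (s a))) k) = Suc (\<Sum>k<n. s k)"
      using that by (simp add: sum.remove[of "{..<n}" a] del: fun_upd_apply) simp
    then show ?thesis by (simp cong: sum.cong)
  qed
  \<comment> \<open>Exponents never decrease during the expansion and the final total degree is
    fixed, so an exponent above \<open>r ! i\<close> leaves another one below its target, where the
    functional vanishes.\<close>
  have over: "M qs s = 0"
    if "set qs \<subseteq> {..<n} \<times> {..<n}" "i < n" "r ! i < s i" "(\<Sum>k<n. s k) + length qs = sum_list r" for qs s i
    using that
  proof (induction qs arbitrary: s)
    case Nil
    have "\<exists>k<n. s k < r ! k"
    proof (rule ccontr)
      assume "\<not> ?thesis"
      then have "\<forall>k\<in>{..<n}. r ! k \<le> s k" by (meson lessThan_iff not_less)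
      moreover have "\<exists>k\<in>{..<n}. r ! k < s k" using Nil by auto
      ultimately have "(\<Sum>k<n. r ! k) < (\<Sum>k<n. s k)" by (intro sum_strict_mono_ex1) auto
      then show False using Nil len by (simp add: sum_list_sum_nth atLeast0LessThan)
    qed
    then show ?case unfolding M_def using mono0 by auto
  next
    case (Cons q qs)
    obtain a b where q: "q = (a, b)" by force
    have "M qs (s(a := Suc (s a))) = 0" "M qs (s(b := Suc (s b))) = 0"
      using Cons.prems q by (intro Cons.IH; auto simp: s1)+
    then show ?case using step[of a b qs s] Cons.prems q by simp
  qed
  \<comment> \<open>\<open>t\<close> holds the exponents still to be collected. A branch with
    \<open>t ! a = 0\<close> overshoots, and \<open>over\<close> justifies the value 0 that
    \<open>diff_coeff\<close> gives it.\<close>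
  have main: "M qs s = of_int (diff_coeff qs t)"
    if "set qs \<subseteq> {..<n} \<times> {..<n}" "length t = n" "\<And>i. i < n \<Longrightarrow> s i + t ! i = r ! i"
      "(\<Sum>k<n. s k) + length qs = sum_list r" for qs s t
    using that
  proof (induction qs arbitrary: s t)
    case Nil
    have "(\<Sum>k<n. s k) = (\<Sum>k<n. r ! k)" using Nil len by (simp add: sum_list_sum_nth atLeast0LessThan)
    moreover have "(\<Sum>k<n. s k) + (\<Sum>k<n. t ! k) = (\<Sum>k<n. r ! k)"
      unfolding sum.distrib[symmetric] using Nil by (intro sum.cong) auto
    ultimately have "(\<Sum>k<n. t ! k) = 0" by linarith
    then have t0: "\<forall>k<n. t ! k = 0" by simp
    then have "\<And>k. k < n \<Longrightarrow> s k = r ! k" using Nil by auto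
    then have "\<Lambda> (\<lambda>x. \<Prod>i<n. x i ^ s i) = \<Lambda> (\<lambda>x. \<Prod>i<n. x i ^ (r ! i))"
      by (intro arg_cong[of _ _ \<Lambda>] ext prod.cong) auto
    then have "M [] s = 1" unfolding M_def using mono1 by simp
    moreover have "\<forall>k\<in>set t. k = 0" using t0 Nil by (auto simp: in_set_conv_nth)
    ultimately show ?case by simp
  next
    case (Cons q qs)
    obtain a b where q: "q = (a, b)" "a < n" "b < n" using Cons.prems(1) by force
    have "M qs (s(a := Suc (s a))) = of_int (if t ! a = 0 then 0 else diff_coeff qs (t[a := t ! a - 1]))"
      if "a < n" for a
    proof (cases "t ! a = 0")
      case True
      have "(\<Sum>k<n. (s(a := Suc (s a))) k) + length qs = sum_list r"
        using s1[OF that, of s] Cons.prems(4) by simp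
      moreover have "r ! a < (s(a := Suc (s a))) a" using Cons.prems(3)[OF that] True by simp
      ultimately have "M qs (s(a := Suc (s a))) = 0"
        using Cons.prems(1) that by (intro over[of qs a]) simp_all
      then show ?thesis using True by simp
    next
      case False
      have "M qs (s(a := Suc (s a))) = of_int (diff_coeff qs (t[a := t ! a - 1]))"
      proof (rule Cons.IH)
        show "(s(a := Suc (s a))) i + t[a := t ! a - 1] ! i = r ! i" if "i < n" for i
          using Cons.prems(2) Cons.prems(3)[OF that] False \<open>a < n\<close> by (cases "i = a") auto
        show "(\<Sum>k<n. (s(a := Suc (s a))) k) + length qs = sum_list r"
          using s1[OF that, of s] Cons.prems(4) by simp
      qed (use Cons.prems in auto)
      then show ?thesis using False by simp
    qed
    then show ?case using step[of a b qs s] q by simp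
  qed
  have "M ps (\<lambda>_. 0) = of_int (diff_coeff ps r)"
    using len deg ps by (intro main) auto
  then have "\<Lambda> (\<lambda>x. \<Prod>(i, j)\<leftarrow>ps. x i - x j) \<noteq> 0" using nz unfolding M_def by simp
  then obtain x where x: "x \<in> Pi\<^sub>E {..<n} A" "(\<Prod>(i, j)\<leftarrow>ps. x i - x j) \<noteq> 0"
    unfolding \<Lambda>_def by (metis (no_types, lifting) mult_zero_right sum.neutral)
  show ?thesis
  proof (rule that[of x])
    show "\<And>i. i < n \<Longrightarrow> x i \<in> A i" using x by (auto simp: PiE_def)
    show "\<And>i j. (i, j) \<in> set ps \<Longrightarrow> x i \<noteq> x j" using x(2) by (force simp: prod_list_zero_iff)
  qed
qed


text \<open>
  A configuration is a graph on initial natural numbers, given by the list of its edges; \<open>ks\<close> lists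
  the number of colours that are available for the edges.
\<close>

definition share :: "nat \<times> nat \<Rightarrow> nat \<times> nat \<Rightarrow> bool" where
  "share e f \<longleftrightarrow> fst e = fst f \<or> fst e = snd f \<or> snd e = fst f \<or> snd e = snd f"

definition choosable :: "(nat \<times> nat) list \<Rightarrow> nat list \<Rightarrow> bool" where
  "choosable ces ks \<longleftrightarrow>
     (\<forall>Ls :: nat \<Rightarrow> nat set. (\<forall>i<length ces. finite (Ls i) \<and> ks ! i \<le> card (Ls i)) \<longrightarrow>
        (\<exists>x. (\<forall>i<length ces. x i \<in> Ls i) \<and>
             (\<forall>i<length ces. \<forall>j<i. share (ces ! i) (ces ! j) \<longrightarrow> x i \<noteq> x j)))"

text \<open>The edges of the line graph of the configuration, oriented towards the smaller index;
  the product of the corresponding differences is its graph polynomial.\<close>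

definition conflicts :: "(nat \<times> nat) list \<Rightarrow> (nat \<times> nat) list" where
  "conflicts ces =
     concat (map (\<lambda>i. map (Pair i) (filter (\<lambda>j. share (ces ! i) (ces ! j)) [0..<i])) [0..<length ces])"

text \<open>The graph polynomial is homogeneous, so only a monomial whose degree is the number of
  conflicts can occur in it. The lists are cut down to the exact sizes and embedded in the reals for
  \<open>alon_tarsi\<close>.\<close>

lemma choosable_alon_tarsi:
  assumes "length r = length ces" "sum_list r = length (conflicts ces)"
    and "diff_coeff (conflicts ces) r \<noteq> 0"
  shows "choosable ces (map Suc r)"
  unfolding choosable_def
proof (intro allI impI)
  fix Ls :: "nat \<Rightarrow> nat set"
  assume L: "\<forall>i<length ces. finite (Ls i) \<and> map Suc r ! i \<le> card (Ls i)"
  have "\<exists>B. B \<subseteq> Ls i \<and> card B = Suc (r ! i)" if "i < length ces" for i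
    using L that assms(1) obtain_subset_with_card_n[of "Suc (r ! i)" "Ls i"] by (metis nth_map)
  then obtain B where B: "\<And>i. i < length ces \<Longrightarrow> B i \<subseteq> Ls i \<and> card (B i) = Suc (r ! i)" by metis
  have in_conf: "(i, j) \<in> set (conflicts ces) \<longleftrightarrow> i < length ces \<and> j < i \<and> share (ces ! i) (ces ! j)" for i j
    unfolding conflicts_def by auto
  obtain x where x: "\<And>i. i < length ces \<Longrightarrow> x i \<in> real ` B i"
      "\<And>i j. (i, j) \<in> set (conflicts ces) \<Longrightarrow> x i \<noteq> x j"
  proof (rule alon_tarsi[of "length ces" "\<lambda>i. real ` B i" r "conflicts ces"])
    show "finite (real ` B i)" if "i < length ces" for i
      using B[OF that] by (metis card.infinite finite_imageI nat.distinct(1))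
    show "card (real ` B i) = Suc (r ! i)" if "i < length ces" for i
      using B[OF that] by (simp add: card_image inj_on_def)
  qed (use assms in_conf in auto)
  have "\<forall>i. \<exists>c. i < length ces \<longrightarrow> c \<in> Ls i \<and> x i = real c" using x(1) B by blast
  then obtain y where y: "\<And>i. i < length ces \<Longrightarrow> y i \<in> Ls i \<and> x i = real (y i)" by metis
  show "\<exists>x. (\<forall>i<length ces. x i \<in> Ls i) \<and>
             (\<forall>i<length ces. \<forall>j<i. share (ces ! i) (ces ! j) \<longrightarrow> x i \<noteq> x j)"
  proof (intro exI[of _ y] conjI allI impI)
    show "y i \<in> Ls i" if "i < length ces" for i using y that by blast
    show "y i \<noteq> y j" if "i < length ces" "j < i" "share (ces ! i) (ces ! j)" for i j
      using x(2)[of i j] y[of i] y[of j] that in_conf by auto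
  qed
qed

definition list_colorable :: "'a set set \<Rightarrow> ('a set \<Rightarrow> nat set) \<Rightarrow> bool" where
  "list_colorable E L \<longleftrightarrow> (\<exists>c. proper_edge_coloring E c \<and> (\<forall>e\<in>E. c e \<in> L e))"

text \<open>
  \<open>xs ! k\<close> bounds the number of edges at the vertex \<open>k\<close> that lie outside the configuration.
\<close>

definition config :: "(nat \<times> nat) list \<Rightarrow> nat list \<Rightarrow> nat list \<Rightarrow> bool" where
  "config ces xs ks \<longleftrightarrow>
     ces \<noteq> [] \<and> length ks = length ces \<and> distinct ces \<and>
     (\<forall>(a, b)\<in>set ces. a < b \<and> b < length xs) \<and>
     (\<forall>((a, b), k)\<in>set (zip ces ks). k + xs ! a + xs ! b \<le> 4)"

text \<open>Colour the edges outside the configuration first, by minimality. An edge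
  \<open>(a, b)\<close> of the configuration then loses at most \<open>xs ! a + xs ! b\<close> of
  its four colours, and \<open>choosable\<close> completes the colouring.\<close>

lemma config_reducible:
  fixes E :: "'a set set"
  assumes ch: "choosable ces ks" and conf: "config ces xs ks"
    and fin: "finite E"
    and vs: "distinct vs" "length vs = length xs"
    and sub: "\<And>a b. (a, b) \<in> set ces \<Longrightarrow> {vs ! a, vs ! b} \<in> E"
    and deg: "\<And>k. k < length vs \<Longrightarrow>
      vertex_degree E (vs ! k) \<le> xs ! k + length (filter (\<lambda>(a, b). a = k \<or> b = k) ces)"
    and L: "\<And>e. e \<in> E \<Longrightarrow> finite (L e) \<and> 4 \<le> card (L e)"
    and min: "\<And>E'. E' \<subset> E \<Longrightarrow> list_colorable E' L"
  shows "list_colorable E L"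
proof -
  define m where "m = length ces"
  define ee where "ee i = (case ces ! i of (a, b) \<Rightarrow> {vs ! a, vs ! b})" for i
  define S where "S = ee ` {..<m}"
  have ab: "a < b" "b < length vs" if "(a, b) \<in> set ces" for a b
    using conf that vs unfolding config_def by auto
  have vinj: "vs ! a = vs ! b \<longleftrightarrow> a = b" if "a < length vs" "b < length vs" for a b
    using vs that by (simp add: nth_eq_iff_index_eq)
  have ces_i: "ces ! i \<in> set ces" if "i < m" for i using that unfolding m_def by simp
  have eeE: "ee i \<in> E" if "i < m" for i
    using sub ces_i[OF that] unfolding ee_def by (auto split: prod.split)
  have ee_inj: "i = j" if "i < m" "j < m" "ee i = ee j" for i j
  proof -
    obtain a b a' b' where c: "ces ! i = (a, b)" "ces ! j = (a', b')" by fastforce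
    have m: "(a, b) \<in> set ces" "(a', b') \<in> set ces" using ces_i that c by metis+
    have "{vs ! a, vs ! b} = {vs ! a', vs ! b'}" using that c unfolding ee_def by simp
    then have "(a, b) = (a', b')"
      using ab[OF m(1)] ab[OF m(2)] by (auto simp: doubleton_eq_iff vinj)
    then show ?thesis using conf c that unfolding config_def m_def by (metis nth_eq_iff_index_eq)
  qed
  have SE: "S \<subseteq> E" "S \<noteq> {}" using eeE conf unfolding S_def m_def config_def by auto
  then obtain c where c: "proper_edge_coloring (E - S) c" "\<And>e. e \<in> E - S \<Longrightarrow> c e \<in> L e"
    using min[of "E - S"] unfolding list_colorable_def by blast
  define adj where "adj e = {f \<in> E - S. e \<inter> f \<noteq> {}}" for e
  define Ls where "Ls i = L (ee i) - c ` adj (ee i)" for i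
  \<comment> \<open>The hypothesis bounds the whole degree; the configuration edges at the vertex
    are distinct edges of \<open>S\<close>, and removing them from the count leaves at most
    \<open>xs ! k\<close>.\<close>
  have ext: "card {f \<in> E - S. vs ! k \<in> f} \<le> xs ! k" if k: "k < length vs" for k
  proof -
    define P where "P i \<longleftrightarrow> (case ces ! i of (a, b) \<Rightarrow> a = k \<or> b = k)" for i
    have "length (filter (\<lambda>(a, b). a = k \<or> b = k) ces) = card {i. i < m \<and> P i}"
      unfolding m_def P_def length_filter_conv_card ..
    also have "\<dots> = card (ee ` {i. i < m \<and> P i})"
      by (rule card_image[symmetric]) (auto simp: inj_on_def intro: ee_inj)
    also have "\<dots> \<le> card {f \<in> S. vs ! k \<in> f}"
    proof (rule card_mono)
      show "finite {f \<in> S. vs ! k \<in> f}" unfolding S_def by simp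
      have "vs ! k \<in> ee i" if "P i" for i
        using that unfolding ee_def P_def by (auto split: prod.splits)
      then show "ee ` {i. i < m \<and> P i} \<subseteq> {f \<in> S. vs ! k \<in> f}"
        unfolding S_def by blast
    qed
    finally have 1: "length (filter (\<lambda>(a, b). a = k \<or> b = k) ces) \<le> card {f \<in> S. vs ! k \<in> f}" .
    have "{f \<in> E. vs ! k \<in> f} = {f \<in> E - S. vs ! k \<in> f} \<union> {f \<in> S. vs ! k \<in> f}" using SE by auto
    then have "vertex_degree E (vs ! k) = card {f \<in> E - S. vs ! k \<in> f} + card {f \<in> S. vs ! k \<in> f}"
      unfolding vertex_degree_def using fin SE by (subst card_Un_disjoint[symmetric]) (auto simp: finite_subset S_def)
    then show ?thesis using 1 deg[OF k] by linarith
  qed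
  have Ls: "finite (Ls i) \<and> ks ! i \<le> card (Ls i)" if i: "i < m" for i
  proof -
    obtain a b where c': "ces ! i = (a, b)" by fastforce
    have mem: "(a, b) \<in> set ces" using ces_i[OF i] c' by simp
    have "((a, b), ks ! i) \<in> set (zip ces ks)"
      using i conf c' nth_mem[of i "zip ces ks"] unfolding config_def m_def by simp
    moreover have "\<forall>p\<in>set (zip ces ks). case p of ((a, b), k) \<Rightarrow> k + xs ! a + xs ! b \<le> 4"
      using conf unfolding config_def by blast
    ultimately have k: "ks ! i + xs ! a + xs ! b \<le> 4" by blast
    have "adj (ee i) = {f \<in> E - S. vs ! a \<in> f} \<union> {f \<in> E - S. vs ! b \<in> f}"
      unfolding adj_def ee_def c' by auto
    then have "card (adj (ee i)) \<le> xs ! a + xs ! b"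
      using ext[of a] ext[of b] ab[OF mem] card_Un_le[of "{f \<in> E - S. vs ! a \<in> f}" "{f \<in> E - S. vs ! b \<in> f}"] by simp
    moreover have "finite (adj (ee i))" using fin unfolding adj_def by simp
    ultimately have "card (c ` adj (ee i)) \<le> xs ! a + xs ! b"
      using card_image_le le_trans by blast
    moreover have "finite (L (ee i))" "4 \<le> card (L (ee i))" using L eeE[OF i] by auto
    moreover have "card (L (ee i)) - card (c ` adj (ee i)) \<le> card (Ls i)"
      unfolding Ls_def using \<open>finite (adj (ee i))\<close> by (intro diff_card_le_card_Diff) auto
    ultimately show ?thesis using k unfolding Ls_def by auto
  qed
  have "\<exists>x. (\<forall>i<m. x i \<in> Ls i) \<and> (\<forall>i<m. \<forall>j<i. share (ces ! i) (ces ! j) \<longrightarrow> x i \<noteq> x j)"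
    by (rule ch[unfolded choosable_def, rule_format, of Ls, folded m_def]) (use Ls in blast)
  then obtain x where x: "\<And>i. i < m \<Longrightarrow> x i \<in> Ls i"
      "\<And>i j. i < m \<Longrightarrow> j < i \<Longrightarrow> share (ces ! i) (ces ! j) \<Longrightarrow> x i \<noteq> x j"
    by blast
  define d where "d e = (if e \<in> S then x (the_inv_into {..<m} ee e) else c e)" for e
  have inj: "inj_on ee {..<m}" using ee_inj by (auto simp: inj_on_def)
  have d_ee: "d (ee i) = x i" if "i < m" for i
    using that inj unfolding d_def S_def by (simp add: the_inv_into_f_f)
  have sh: "share (ces ! i) (ces ! j)" if "i < m" "j < m" "ee i \<inter> ee j \<noteq> {}" for i j
  proof -
    obtain a b a' b' where c: "ces ! i = (a, b)" "ces ! j = (a', b')" by fastforce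
    have m: "(a, b) \<in> set ces" "(a', b') \<in> set ces" using ces_i that c by metis+
    show ?thesis using that c ab[OF m(1)] ab[OF m(2)] unfolding ee_def share_def by (auto simp: vinj)
  qed
  have SS: "d (ee i) \<noteq> d (ee j)" if "i < m" "j < m" "i \<noteq> j" "ee i \<inter> ee j \<noteq> {}" for i j
    using that x(2)[of i j] x(2)[of j i] sh[of i j] sh[of j i] d_ee by (metis inf_commute nat_neq_iff)
  have SN: "d (ee i) \<noteq> d f" if "i < m" "f \<in> E - S" "ee i \<inter> f \<noteq> {}" for i f
    using that x(1)[of i] d_ee[of i] unfolding Ls_def adj_def d_def by auto
  have "proper_edge_coloring E d"
    unfolding proper_edge_coloring_def
  proof (intro ballI impI)
    fix e f assume ef: "e \<in> E" "f \<in> E" "e \<noteq> f \<and> e \<inter> f \<noteq> {}"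
    consider i j where "i < m" "j < m" "e = ee i" "f = ee j" | i where "i < m" "e = ee i" "f \<notin> S"
      | j where "j < m" "f = ee j" "e \<notin> S" | "e \<notin> S" "f \<notin> S" unfolding S_def by blast
    then show "d e \<noteq> d f"
    proof cases
      case 1 then show ?thesis using SS[of i j] ef by auto
    next
      case 2 then show ?thesis using SN[of i f] ef by auto
    next
      case 3 then show ?thesis using SN[of j e] ef by (metis DiffI inf_commute)
    next
      case 4 then show ?thesis using c(1) ef unfolding proper_edge_coloring_def d_def by auto
    qed
  qed
  moreover have "d e \<in> L e" if "e \<in> E" for e
  proof (cases "e \<in> S")
    case True
    then obtain i where "i < m" "e = ee i" unfolding S_def by blast
    then show ?thesis using x(1)[of i] d_ee[of i] unfolding Ls_def by auto
  qed (use c that in \<open>auto simp: d_def\<close>)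
  ultimately show ?thesis unfolding list_colorable_def by blast
qed


section \<open>Configurations settled by a nonvanishing coefficient\<close>

text \<open>The vector under \<open>map Suc\<close> is a witness: any exponents below the available
  list sizes serve if they have the right sum and a nonzero coefficient, which is evaluated.\<close>

lemma choosable_C4: "choosable [(0,2),(0,3),(1,2),(1,3)] (map Suc [1,1,1,1])"
  by (rule choosable_alon_tarsi; code_simp)

lemma choosable_bowtie: "choosable [(0,2),(2,4),(0,1),(0,3),(1,3),(0,4)] (map Suc [1,1,1,3,1,3])"
  by (rule choosable_alon_tarsi; code_simp)

lemma choosable_K4: "choosable [(0,1),(1,2),(0,3),(0,2),(1,3),(2,3)] (map Suc [1,2,2,2,2,3])"
  by (rule choosable_alon_tarsi; code_simp)

lemma choosable_K4_minus: "choosable [(0,3),(0,2),(1,2),(2,3),(1,3)] (map Suc [1,1,1,3,2])"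
  by (rule choosable_alon_tarsi; code_simp)

lemma choosable_K4_minus_triangle: "choosable [(0,2),(1,4),(0,3),(1,5),(4,5),(1,2),(1,3),(2,3)] (map Suc [1,0,1,3,1,3,3,3])"
  by (rule choosable_alon_tarsi; code_simp)

text \<open>In the kites 0, 1, 2, 3 are \<open>a, b, c, d\<close> with crossing edges
  \<open>ac\<close> and \<open>bd\<close>. The three digits of the name tell which of the gaps
  \<open>ab\<close>, \<open>bc\<close>, \<open>cd\<close> carries a vertex of degree 2.\<close>

lemma choosable_kite100: "choosable [(1,3),(0,1),(0,2),(2,3),(1,2),(1,4),(0,4)] (map Suc [1,2,2,1,3,3,2])"
  by (rule choosable_alon_tarsi; code_simp)

lemma choosable_kite110: "choosable [(0,2),(0,4),(2,3),(1,3),(2,5),(1,2),(1,4),(1,5)] (map Suc [1,1,1,1,3,3,3,3])"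
  by (rule choosable_alon_tarsi; code_simp)

lemma choosable_kite101: "choosable [(0,4),(0,1),(1,3),(0,2),(1,4),(1,2),(2,3),(3,5),(2,5)] (map Suc [2,1,2,2,3,3,2,2,3])"
  by (rule choosable_alon_tarsi; code_simp)

lemma choosable_kite111a: "choosable [(1,3),(0,2),(1,2),(0,4),(1,4),(2,6),(3,6),(1,5),(2,5)] (map Suc [1,1,2,0,3,3,1,3,3])"
  by (rule choosable_alon_tarsi; code_simp)

lemma choosable_kite111b: "choosable [(1,3),(1,5),(0,4),(0,1),(0,2),(1,4),(2,3),(2,6),(3,6),(2,5)] (map Suc [0,3,2,1,2,3,2,3,2,3])"
  by (rule choosable_alon_tarsi; code_simp)

lemma choosable_lump0: "choosable [(0,3),(0,1),(0,2),(1,3),(2,3),(1,2),(1,4),(2,4)] (map Suc [1,1,2,3,3,3,3,3])"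
  by (rule choosable_alon_tarsi; code_simp)

section \<open>Capped crossings: classification of the lists that block a colouring\<close>

lemma choosableI_exact:
  assumes "length ks = length ces"
    and "\<And>Ls :: nat \<Rightarrow> nat set. (\<And>i. i < length ces \<Longrightarrow> finite (Ls i) \<and> card (Ls i) = ks ! i) \<Longrightarrow>
        \<exists>x. (\<forall>i<length ces. x i \<in> Ls i) \<and>
            (\<forall>i<length ces. \<forall>j<i. share (ces ! i) (ces ! j) \<longrightarrow> x i \<noteq> x j)"
  shows "choosable ces ks"
  unfolding choosable_def
proof (intro allI impI)
  fix Ls :: "nat \<Rightarrow> nat set"
  assume L: "\<forall>i<length ces. finite (Ls i) \<and> ks ! i \<le> card (Ls i)"
  have "\<exists>B. i < length ces \<longrightarrow> B \<subseteq> Ls i \<and> card B = ks ! i \<and> finite B" for i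
    using L obtain_subset_with_card_n[of "ks ! i" "Ls i"] by (metis finite_subset)
  then obtain B where B: "\<And>i. i < length ces \<Longrightarrow> B i \<subseteq> Ls i \<and> card (B i) = ks ! i \<and> finite (B i)" by metis
  have "\<exists>x. (\<forall>i<length ces. x i \<in> B i) \<and>
            (\<forall>i<length ces. \<forall>j<i. share (ces ! i) (ces ! j) \<longrightarrow> x i \<noteq> x j)"
    by (rule assms(2)) (use B in blast)
  then show "\<exists>x. (\<forall>i<length ces. x i \<in> Ls i) \<and>
            (\<forall>i<length ces. \<forall>j<i. share (ces ! i) (ces ! j) \<longrightarrow> x i \<noteq> x j)"
    using B by (meson subsetD)
qed

text \<open>
  Colours for the five vertices \<open>a, b, c, d, v\<close> with edges \<open>ab, ac, db, dc\<close> (a 4-cycle), \<open>bc\<close> and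
  \<open>bv, cv\<close>, from the respective lists.
\<close>

definition qcol :: "nat set \<Rightarrow> nat set \<Rightarrow> nat set \<Rightarrow> nat set \<Rightarrow> nat set \<Rightarrow> nat set \<Rightarrow> nat set \<Rightarrow> bool" where
  "qcol AB AC DB DC BC BV CV \<longleftrightarrow>
     (\<exists>p\<in>AB. \<exists>q\<in>AC. \<exists>r\<in>DB. \<exists>s\<in>DC. \<exists>x\<in>BC. \<exists>y\<in>BV. \<exists>z\<in>CV.
        p \<noteq> q \<and> p \<noteq> r \<and> q \<noteq> s \<and> r \<noteq> s \<and> x \<notin> {p, q, r, s} \<and> y \<notin> {p, r} \<and> z \<notin> {q, s} \<and>
        x \<noteq> y \<and> x \<noteq> z \<and> y \<noteq> z)"

text \<open>The two reflections of the configuration act transitively on the four edges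
  \<open>ab, ac, db, dc\<close>, so a statement about the list of one of them carries over to the
  others.\<close>

lemma qcol_swap_bc: "qcol AC AB DC DB BC CV BV \<longleftrightarrow> qcol AB AC DB DC BC BV CV"
  unfolding qcol_def by (rule iffI; elim bexE conjE; intro bexI conjI; assumption?; blast?)

lemma qcol_swap_ad: "qcol DB DC AB AC BC BV CV \<longleftrightarrow> qcol AB AC DB DC BC BV CV"
  unfolding qcol_def by (rule iffI; elim bexE conjE; intro bexI conjI; assumption?; blast?)

lemma qcol_mono:
  assumes "qcol AB AC DB DC BC BV CV" "AB \<subseteq> AB'" "AC \<subseteq> AC'" "DB \<subseteq> DB'" "DC \<subseteq> DC'"
  shows "qcol AB' AC' DB' DC' BC BV CV"
  using assms unfolding qcol_def by (meson subsetD)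

text \<open>Once the 4-cycle is coloured, the triangle \<open>bcv\<close> remains. If
  \<open>bc\<close> has a free colour \<open>x\<close>, then \<open>bv\<close> and \<open>cv\<close>
  keep at least two colours each, and no completion exists only if both keep the same two, one of
  them \<open>x\<close>. This leaves no slack: \<open>p, r\<close> must have been taken from
  \<open>BV\<close>, and \<open>q, s\<close> from \<open>CV\<close>.\<close>

lemma qcol_blocked:
  assumes "card BC = 4" "card BV = 4" "card CV = 4" "\<not> qcol AB AC DB DC BC BV CV"
    and "p \<in> AB" "q \<in> AC" "r \<in> DB" "s \<in> DC" "p \<noteq> q" "p \<noteq> r" "q \<noteq> s" "r \<noteq> s"
  shows "p \<in> BV \<and> r \<in> BV \<and> q \<in> CV \<and> s \<in> CV \<and> BV - {p, r} = CV - {q, s} \<or>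
    BC \<subseteq> {p, q, r, s}"
proof (rule disjCI)
  assume "\<not> BC \<subseteq> {p, q, r, s}"
  then obtain x where x: "x \<in> BC" "x \<notin> {p, q, r, s}" by blast
  have no: "y = z \<or> y = x \<or> z = x" if "y \<in> BV - {p, r}" "z \<in> CV - {q, s}" for y z
    using assms(4-) x that unfolding qcol_def by blast
  have fin: "finite BV" "finite CV" using assms(2,3) by (auto intro: card_ge_0_finite)
  have Y: "card (BV - {p, r}) \<ge> 2" "card (CV - {q, s}) \<ge> 2"
    using diff_card_le_card_Diff[of "{p, r}" BV] diff_card_le_card_Diff[of "{q, s}" CV] assms by auto
  have ex: "\<exists>y\<in>Y. y \<noteq> x" if "card Y \<ge> 2" for Y :: "nat set"
  proof (rule ccontr)
    assume "\<not> ?thesis"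
    then have "Y \<subseteq> {x}" by blast
    then have "card Y \<le> 1" using card_mono[of "{x}" Y] by simp
    then show False using that by simp
  qed
  obtain y where y: "y \<in> BV - {p, r}" "y \<noteq> x" using ex[OF Y(1)] by blast
  obtain z where z: "z \<in> CV - {q, s}" "z \<noteq> x" using ex[OF Y(2)] by blast
  have yz: "y = z" using no y z by blast
  have "BV - {p, r} \<subseteq> {x, y}" "CV - {q, s} \<subseteq> {x, y}" using no y z yz by blast+
  moreover have "card {x, y} = 2" using y by simp
  ultimately have e: "BV - {p, r} = {x, y}" "CV - {q, s} = {x, y}"
    using Y by (metis card_seteq finite.emptyI finite_insert)+
  have "p \<in> BV \<and> r \<in> BV"
  proof (rule ccontr)
    assume "\<not> ?thesis"
    then have "card (BV - {p, r}) \<ge> 3" using assms fin by (cases "p \<in> BV"; cases "r \<in> BV") (auto simp: card_Diff_insert)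
    then show False using e y by simp
  qed
  moreover have "q \<in> CV \<and> s \<in> CV"
  proof (rule ccontr)
    assume "\<not> ?thesis"
    then have "card (CV - {q, s}) \<ge> 3" using assms fin by (cases "q \<in> CV"; cases "s \<in> CV") (auto simp: card_Diff_insert)
    then show False using e y by simp
  qed
  ultimately show "p \<in> BV \<and> r \<in> BV \<and> q \<in> CV \<and> s \<in> CV \<and> BV - {p, r} = CV - {q, s}" using e by blast
qed


text \<open>A colouring of the 4-cycle that uses \<open>t\<close> cannot exhaust the four colours of
  \<open>BC\<close>. By \<open>qcol_blocked\<close> its pairs \<open>{p, r}\<close> and
  \<open>{q, s}\<close> are then the fixed sets \<open>BV - CV\<close> and \<open>CV - BV\<close>.
  Two colourings that use \<open>t\<close> and differ in one of these pairs contradict each other;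
  they exist unless the lists agree at \<open>b\<close> and at \<open>c\<close>.\<close>

lemma qcol_stuck_disjoint:
  assumes cards: "card AB = 2" "card AC = 2" "card DB = 2" "card DC = 2"
      "card BC = 4" "card BV = 4" "card CV = 4"
    and stuck: "\<not> qcol AB AC DB DC BC BV CV" and disj: "AB \<inter> DC = {}" "AC \<inter> DB = {}"
    and t: "t \<in> AB" "t \<notin> BC"
  shows "AB = DB \<and> AC = DC"
proof -
  have F: "{p, r} = BV - CV \<and> {q, s} = CV - BV"
    if "p \<in> AB" "q \<in> AC" "r \<in> DB" "s \<in> DC" "p \<noteq> q" "p \<noteq> r" "q \<noteq> s" "r \<noteq> s" "t \<in> {p, q, r, s}" for p q r s
  proof -
    have "\<not> BC \<subseteq> {p, q, r, s}"
    proof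
      assume "BC \<subseteq> {p, q, r, s}"
      then have "BC \<subseteq> {p, q, r, s} - {t}" using t by blast
      moreover have "card ({p, q, r, s} - {t}) \<le> 3"
        using that(9) card_insert_le_m1 by (simp add: card_Diff_singleton card_insert_if)
      ultimately show False using cards card_mono[of "{p, q, r, s} - {t}" BC] by simp
    qed
    then have B: "p \<in> BV" "r \<in> BV" "q \<in> CV" "s \<in> CV" "BV - {p, r} = CV - {q, s}"
      using qcol_blocked[OF cards(5-7) stuck that(1-8)] by auto
    \<comment> \<open>Disjoint lists on opposite edges make \<open>{p, r}\<close> and
      \<open>{q, s}\<close> disjoint, so the equation of the remainders determines both
      pairs.\<close>
    have "p \<noteq> s" "q \<noteq> r" using disj that by auto
    then show ?thesis using B that by blast
  qed
  obtain p' where AB: "AB = {t, p'}" "p' \<noteq> t" using cards(1) t by (metis card_2_iff' card_2_iff doubleton_eq_iff insertE singletonD)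
  have DC2: "DC = {x, y}" if "DC \<subseteq> {x, y}" for x y
    using that cards(4) card_seteq[of "{x, y}" DC] by (cases "x = y") auto
  show ?thesis
  proof (cases "t \<in> DB")
    case False
    have one: "\<exists>r\<in>DB. DC = {q, r}" if q: "q \<in> AC" "q \<noteq> t" for q
    proof (rule ccontr)
      assume n: "\<not> ?thesis"
      obtain r1 r2 where DB: "DB = {r1, r2}" "r1 \<noteq> r2" using cards(3) by (meson card_2_iff)
      have "\<exists>s\<in>DC. s \<noteq> q \<and> s \<noteq> r" if "r \<in> DB" for r using n DC2[of q r] that by blast
      then have "{t, r} = BV - CV" if "r \<in> DB" for r
        using F[of t q r] that q t False by (metis insertI1)
      then have "{t, r1} = {t, r2}" using DB by blast
      then show False using DB False by (auto simp: doubleton_eq_iff)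
    qed
    obtain q where q: "q \<in> AC" "q \<noteq> t" using cards(2) by (metis card_2_iff')
    obtain r' where r': "r' \<in> DB" "DC = {q, r'}" using one[OF q] by blast
    have AC: "q2 = t" if q2: "q2 \<in> AC" "q2 \<noteq> q" for q2
    proof (rule ccontr)
      assume "q2 \<noteq> t"
      then obtain r where "r \<in> DB" "DC = {q2, r}" using one[OF q2(1)] by blast
      then show False using r' q2 q disj by (auto simp: doubleton_eq_iff)
    qed
    then have tAC: "t \<in> AC" using cards(2) q by (metis card_2_iff')
    obtain r0 where r0: "r0 \<in> DB" "r0 \<noteq> r'" using cards(3) r'(1) by (metis card_2_iff')
    have ne: "q \<noteq> r'" "q \<noteq> r0" "t \<noteq> r'" "t \<noteq> r0" "p' \<noteq> r'" using r' r0 q disj False AB by auto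
    have "{p', r'} = BV - CV" by (rule conjunct1[OF F[of p' t r' q]]) (use AB tAC r' q ne in auto)
    moreover have "{t, r0} = BV - CV" by (rule conjunct1[OF F[of t q r0 r']]) (use AB q r' r0 ne in auto)
    ultimately show ?thesis using ne r0 by (metis doubleton_eq_iff)
  next
    case True
    then have tAC: "t \<notin> AC" using disj by blast
    obtain r0 where DB: "DB = {t, r0}" "r0 \<noteq> t"
      using cards(3) True by (metis card_2_iff doubleton_eq_iff insertE singletonD)
    obtain q1 q2 where AC: "AC = {q1, q2}" "q1 \<noteq> q2" using cards(2) by (meson card_2_iff)
    have ne: "t \<noteq> q1" "t \<noteq> q2" "r0 \<noteq> q1" "r0 \<noteq> q2" using tAC AC DB disj by auto
    have P: "{t, r0} = BV - CV \<and> {q, s} = CV - BV" if "q \<in> AC" "s \<in> DC" "s \<noteq> q" "s \<noteq> r0" for q s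
      using F[of t q r0 s] that AB DB tAC by auto
    show ?thesis
    proof (cases "\<forall>q\<in>AC. \<exists>s\<in>DC. s \<noteq> q \<and> s \<noteq> r0")
      case True
      then obtain s1 s2 where s: "s1 \<in> DC" "s1 \<noteq> q1" "s1 \<noteq> r0" "s2 \<in> DC" "s2 \<noteq> q2" "s2 \<noteq> r0"
        using AC by auto
      have "{q1, s1} = CV - BV" by (rule conjunct2[OF P]) (use s AC in auto)
      moreover have "{q2, s2} = CV - BV" by (rule conjunct2[OF P]) (use s AC in auto)
      ultimately have "{q1, s1} = {q2, s2}" by simp
      then have s': "s1 = q2" "s2 = q1" using AC s by (auto simp: doubleton_eq_iff)
      then have DC: "DC = {q1, q2}" using s cards(4) AC
        by (metis card_2_iff doubleton_eq_iff insertE singletonD)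
      have "p' \<notin> DC" using AB disj by blast
      then have "{p', t} = BV - CV" by (intro conjunct1[OF F[of p' q1 t q2]]) (use AB AC DB DC ne in auto)
      moreover have "{t, r0} = BV - CV" by (rule conjunct1[OF P[of q1 s1]]) (use s AC in auto)
      ultimately have "{p', t} = {t, r0}" by simp
      then show ?thesis using AB DB DC AC by (simp add: insert_commute)
    next
      case False
      then obtain q where q: "q \<in> AC" "DC \<subseteq> {q, r0}" by blast
      then have DC: "DC = {q, r0}" using DC2 by blast
      obtain q' where q': "q' \<in> AC" "q' \<noteq> q" using cards(2) q(1) by (metis card_2_iff')
      have ne': "q \<noteq> r0" "q' \<noteq> r0" "q \<noteq> t" "q' \<noteq> t" using ne AC q q' by auto
      have Q: "{q', q} = CV - BV" by (rule conjunct2[OF P[of q' q]]) (use q q' DC ne' in auto)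
      show ?thesis
      proof (cases "p' = q'")
        case True
        then have "{q, r0} = CV - BV" by (intro conjunct2[OF F[of p' q t r0]]) (use AB DB DC q q' ne' in auto)
        then show ?thesis using Q ne' q' by (metis doubleton_eq_iff)
      next
        case False
        then have "{q', r0} = CV - BV" by (intro conjunct2[OF F[of p' q' t r0]]) (use AB DB DC q q' ne' in auto)
        then show ?thesis using Q ne' q' by (metis doubleton_eq_iff)
      qed
    qed
  qed
qed

text \<open>A colour repeated on opposite edges leaves at most three colours on the 4-cycle, so
  \<open>BC\<close> is not exhausted. Comparing such colourings first places \<open>t\<close> in all
  four lists and then identifies the second colours.\<close>

lemma qcol_stuck_meeting:
  assumes cards: "card AB = 2" "card AC = 2" "card DB = 2" "card DC = 2"
      "card BC = 4" "card BV = 4" "card CV = 4"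
    and stuck: "\<not> qcol AB AC DB DC BC BV CV" and t: "t \<in> AB" "t \<in> DC"
  shows "AB = DB \<and> AC = DC"
proof -
  have F: "p \<in> BV \<and> r \<in> BV \<and> q \<in> CV \<and> s \<in> CV \<and> BV - {p, r} = CV - {q, s}"
    if "p \<in> AB" "q \<in> AC" "r \<in> DB" "s \<in> DC" "p \<noteq> q" "p \<noteq> r" "q \<noteq> s" "r \<noteq> s" "p = s \<or> q = r" for p q r s
  proof -
    have "card {p, q, r, s} \<le> 3" using that(9) by (auto simp: card_insert_if)
    then have "\<not> BC \<subseteq> {p, q, r, s}" using cards(5) card_mono[of "{p, q, r, s}" BC] by auto
    then show ?thesis using qcol_blocked[OF cards(5-7) stuck that(1-8)] by blast
  qed
  have two: "\<exists>y. y \<in> A \<and> y \<noteq> x" if "card A = 2" for A and x :: nat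
    using that by (metis card_2_iff')
  have in4: "t \<in> DB \<and> t \<in> AC" if "t \<in> AB" "t \<in> DC" for t
  proof (rule conjI; rule ccontr)
    assume n: "t \<notin> DB"
    obtain r1 r2 where DB: "DB = {r1, r2}" "r1 \<noteq> r2" using cards(3) by (meson card_2_iff)
    obtain q where q: "q \<in> AC" "q \<noteq> t" using two[OF cards(2)] by blast
    have "r1 \<in> BV \<and> BV - {t, r1} = CV - {q, t}" using F[of t q r1 t] that q DB n by blast
    moreover have "BV - {t, r2} = CV - {q, t}" using F[of t q r2 t] that q DB n by blast
    ultimately have "r1 \<in> BV" "BV - {t, r1} = BV - {t, r2}" by simp_all
    then show False using DB n by blast
  next
    assume n: "t \<notin> AC"
    obtain q1 q2 where AC: "AC = {q1, q2}" "q1 \<noteq> q2" using cards(2) by (meson card_2_iff)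
    obtain r where r: "r \<in> DB" "r \<noteq> t" using two[OF cards(3)] by blast
    have "q1 \<in> CV \<and> BV - {t, r} = CV - {q1, t}" using F[of t q1 r t] that r AC n by blast
    moreover have "BV - {t, r} = CV - {q2, t}" using F[of t q2 r t] that r AC n by blast
    ultimately have "q1 \<in> CV" "CV - {q1, t} = CV - {q2, t}" by simp_all
    then show False using AC n by blast
  qed
  have pair: "\<exists>y. A = {x, y} \<and> y \<noteq> x" if "card A = 2" "x \<in> A" for A and x :: nat
    using that by (metis card_2_iff doubleton_eq_iff insertE singletonD)
  obtain p where p: "AB = {t, p}" "p \<noteq> t" using pair[OF cards(1) t(1)] by blast
  obtain s where s: "DC = {t, s}" "s \<noteq> t" using pair[OF cards(4) t(2)] by blast
  obtain q where q: "AC = {t, q}" "q \<noteq> t" using pair[OF cards(2)] in4[OF t] by blast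
  obtain r where r: "DB = {t, r}" "r \<noteq> t" using pair[OF cards(3)] in4[OF t] by blast
  have 1: "t \<in> BV \<and> r \<in> BV \<and> q \<in> CV \<and> t \<in> CV \<and> BV - {t, r} = CV - {q, t}" by (rule F) (use p q r s in auto)
  have 2: "p \<in> BV \<and> t \<in> BV \<and> t \<in> CV \<and> s \<in> CV \<and> BV - {p, t} = CV - {t, s}" by (rule F) (use p q r s in auto)
  have "p = s \<Longrightarrow> p = r \<and> q = s" using in4[of p] p q r s by auto
  then have "p = r \<and> q = s" using 1 2 p q r s by blast
  then show ?thesis using p q r s by simp
qed

text \<open>Two obstructions survive: lists that agree at \<open>b\<close> and at \<open>c\<close>,
  or lists of opposite edges that are complementary within \<open>BC\<close>. If the first fails,
  \<open>qcol_stuck_disjoint\<close> and the reflections put all four lists inside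
  \<open>BC\<close>, and the disjoint opposite pairs fill it.\<close>

lemma qcol_stuck:
  assumes cards: "card AB = 2" "card AC = 2" "card DB = 2" "card DC = 2"
      "card BC = 4" "card BV = 4" "card CV = 4"
    and stuck: "\<not> qcol AB AC DB DC BC BV CV"
  shows "AB = DB \<and> AC = DC \<or> DB = BC - AC \<and> DC = BC - AB"
proof (cases "AB \<inter> DC = {} \<and> AC \<inter> DB = {}")
  case False
  then show ?thesis
    using qcol_stuck_meeting[OF cards stuck]
      qcol_stuck_meeting[of AC AB DC DB BC CV BV] cards stuck qcol_swap_bc[of AC AB DC DB BC CV BV] by blast
next
  case True
  show ?thesis
  proof (cases "AB = DB \<and> AC = DC")
    case n: False
    have "AB \<subseteq> BC" using qcol_stuck_disjoint[OF cards stuck] True n by blast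
    moreover have "AC \<subseteq> BC"
      using qcol_stuck_disjoint[of AC AB DC DB BC CV BV] cards stuck qcol_swap_bc True n by blast
    moreover have "DB \<subseteq> BC"
      using qcol_stuck_disjoint[of DB DC AB AC BC BV CV] cards stuck qcol_swap_ad True n by blast
    moreover have "DC \<subseteq> BC"
      using qcol_stuck_disjoint[of DC DB AC AB BC CV BV] cards stuck qcol_swap_ad qcol_swap_bc True n by blast
    moreover have fin: "finite AB" "finite AC" "finite DB" "finite DC" "finite BC"
      using cards by (auto intro: card_ge_0_finite)
    moreover have "card (AB \<union> DC) = 4" "card (AC \<union> DB) = 4"
      using cards True fin by (simp_all add: card_Un_disjoint)
    ultimately have "AB \<union> DC = BC" "AC \<union> DB = BC"
      using cards by (metis Un_subset_iff card_subset_eq)+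
    then show ?thesis using True by blast
  qed blast
qed


text \<open>Every 2-subset of \<open>DB\<close> is blocked as well and hence one of the two sets
  \<open>AB\<close> and \<open>BC - AC\<close>; three colours would have three 2-subsets.\<close>

lemma qcol_stuck_card:
  assumes cards: "card AB = 2" "card AC = 2" "2 \<le> card DB" "2 \<le> card DC"
      "card BC = 4" "card BV = 4" "card CV = 4"
    and stuck: "\<not> qcol AB AC DB DC BC BV CV"
  shows "card DB = 2"
proof (rule ccontr)
  assume "card DB \<noteq> 2"
  then have "3 \<le> card DB" using cards by simp
  then obtain T where "T \<subseteq> DB" "card T = 3" using obtain_subset_with_card_n by metis
  then obtain x y z where T: "{x, y, z} \<subseteq> DB" "x \<noteq> y" "x \<noteq> z" "y \<noteq> z" by (auto simp: card_3_iff)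
  obtain DC' where DC': "DC' \<subseteq> DC" "card DC' = 2" using obtain_subset_with_card_n cards(4) by metis
  have "D = AB \<or> D = BC - AC" if "D \<subseteq> DB" "card D = 2" for D
    using qcol_stuck[OF cards(1,2) that(2) DC'(2) cards(5-7)] qcol_mono[of AB AC D DC'] stuck that DC' by blast
  then have "{x, y} = AB \<or> {x, y} = BC - AC" "{x, z} = AB \<or> {x, z} = BC - AC" "{y, z} = AB \<or> {y, z} = BC - AC"
    using T by auto
  then show False using T by (metis doubleton_eq_iff)
qed

lemma qcol_stuck_ge:
  assumes cards: "2 \<le> card AB" "2 \<le> card AC" "2 \<le> card DB" "2 \<le> card DC"
      "card BC = 4" "card BV = 4" "card CV = 4"
    and stuck: "\<not> qcol AB AC DB DC BC BV CV"
  shows "card AB = 2" "card AC = 2" "card DB = 2" "card DC = 2"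
    "AB = DB \<and> AC = DC \<or> DB = BC - AC \<and> DC = BC - AB"
proof -
  obtain AB' where AB': "AB' \<subseteq> AB" "card AB' = 2" using obtain_subset_with_card_n cards(1) by metis
  obtain AC' where AC': "AC' \<subseteq> AC" "card AC' = 2" using obtain_subset_with_card_n cards(2) by metis
  have "\<not> qcol AB' AC' DB DC BC BV CV" using qcol_mono stuck AB' AC' by blast
  then show D: "card DB = 2" "card DC = 2"
    using qcol_stuck_card[of AB' AC' DB DC] qcol_stuck_card[of AC' AB' DC DB BC CV BV]
      qcol_swap_bc AB' AC' cards by blast+
  show A: "card AB = 2" "card AC = 2"
    using qcol_stuck_card[of DB DC AB AC] qcol_stuck_card[of DC DB AC AB BC CV BV]
      qcol_swap_bc qcol_swap_ad D stuck cards by blast+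
  show "AB = DB \<and> AC = DC \<or> DB = BC - AC \<and> DC = BC - AB"
    using qcol_stuck[OF A D cards(5-7) stuck] .
qed

lemma card_Diff1_ge: "Suc n \<le> card A \<Longrightarrow> n \<le> card (A - {x})"
  by (cases "finite A") (auto simp: card_Diff_singleton_if)

text \<open>\<open>AD\<close> belongs to the additional edge \<open>ad\<close>. If a colour
  \<open>e\<close> of it is blocked in the complementary way, then \<open>e\<close> lies outside
  \<open>BC\<close> while the rest of \<open>AB\<close> lies inside. Two colours cannot both behave
  like this, since each lies in \<open>AB\<close>; so for one of them the lists at \<open>b\<close>
  agree.\<close>

lemma lump_stuck:
  assumes cards: "2 \<le> card AD" "3 \<le> card AB" "3 \<le> card AC" "3 \<le> card DB" "3 \<le> card DC"
      "card BC = 4" "card BV = 4" "card CV = 4"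
    and stuck: "\<And>e. e \<in> AD \<Longrightarrow> \<not> qcol (AB - {e}) (AC - {e}) (DB - {e}) (DC - {e}) BC BV CV"
  shows "card AB = 3 \<and> card DB = 3 \<and> AB = DB"
proof -
  obtain T where "T \<subseteq> AD" "card T = 2" using obtain_subset_with_card_n cards(1) by metis
  then obtain e1 e2 where e: "e1 \<in> AD" "e2 \<in> AD" "e1 \<noteq> e2" by (auto simp: card_2_iff)
  have st: "card (AB - {e}) = 2" "card (DB - {e}) = 2"
      "AB - {e} = DB - {e} \<or> DC - {e} = BC - (AB - {e}) \<and> DB - {e} = BC - (AC - {e}) \<and> card (DC - {e}) = 2"
    if "e \<in> AD" for e
  proof -
    have c: "2 \<le> card (AB - {e})" "2 \<le> card (AC - {e})" "2 \<le> card (DB - {e})" "2 \<le> card (DC - {e})"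
      using cards(2-5) card_Diff1_ge[of 2] by simp_all
    note q = qcol_stuck_ge[OF c cards(6-8) stuck[OF that]]
    show "card (AB - {e}) = 2" "card (DB - {e}) = 2" using q(1,3) .
    show "AB - {e} = DB - {e} \<or> DC - {e} = BC - (AB - {e}) \<and> DB - {e} = BC - (AC - {e}) \<and> card (DC - {e}) = 2"
      using q(4,5) by blast
  qed
  have mem: "e \<in> AB \<and> card AB = 3" "e \<in> DB \<and> card DB = 3" if "e \<in> AD" for e
    using st(1,2)[OF that] cards(2,4) by (auto simp: card_Diff_singleton_if split: if_splits)
  have sub: "AB - {e} \<subseteq> BC \<and> e \<notin> BC" if "e \<in> AD" "AB - {e} \<noteq> DB - {e}" for e
  proof -
    have *: "DC - {e} = BC - (AB - {e})" "card (DC - {e}) = 2" using st(3) that by auto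
    have "card (BC - (AB - {e})) + card (AB - {e}) = card BC" using * st(1)[OF that(1)] cards by simp
    moreover have "finite BC" "finite (AB - {e})" using cards st(1)[OF that(1)] by (auto intro: card_ge_0_finite)
    ultimately have "card (BC \<union> (AB - {e})) = card BC"
      by (metis card_Un_disjoint Diff_disjoint Un_Diff_cancel2 finite_Diff inf_commute)
    then have "AB - {e} \<subseteq> BC" using \<open>finite BC\<close> \<open>finite (AB - {e})\<close>
      by (metis card_subset_eq finite_UnI sup_ge1 sup_ge2)
    moreover have "e \<notin> BC" using *(1) by auto
    ultimately show ?thesis by blast
  qed
  have "AB - {e1} = DB - {e1} \<or> AB - {e2} = DB - {e2}"
    using sub[OF e(1)] sub[OF e(2)] mem(1)[OF e(1)] mem(1)[OF e(2)] e by blast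
  then have "AB = DB" using mem[OF e(1)] mem[OF e(2)] by blast
  then show ?thesis using mem[OF e(1)] by blast
qed

lemma colors_exI:
  assumes "list_all2 (\<in>) cs (map Ls [0..<length ces])"
    and "list_all (\<lambda>(i, j). cs ! i \<noteq> cs ! j) (conflicts ces)"
  shows "\<exists>x. (\<forall>i<length ces. x i \<in> Ls i) \<and>
            (\<forall>i<length ces. \<forall>j<i. share (ces ! i) (ces ! j) \<longrightarrow> x i \<noteq> x j)"
proof (intro exI[of _ "nth cs"] conjI allI impI)
  show "cs ! i \<in> Ls i" if "i < length ces" for i
    using list_all2_nthD2[OF assms(1), of i] that by simp
  show "cs ! i \<noteq> cs ! j" if "i < length ces" "j < i" "share (ces ! i) (ces ! j)" for i j
    using assms(2) that unfolding conflicts_def list_all_iff by force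
qed

text \<open>The numbers 0 to 4 are \<open>a, b, c, d, v\<close>; the edges come in the order of the
  arguments of \<open>qcol\<close>.\<close>

abbreviation "q_edges \<equiv> [(0, 1), (0, 2), (1, 3), (2, 3), (1, 2), (1, 4), (2, 4 :: nat)] :: (nat \<times> nat) list"

text \<open>In every blocked assignment the four lists of the 4-cycle have exactly two colours, so a
  third colour at \<open>a\<close> suffices.\<close>

lemma choosable_q3: "choosable q_edges [3, 3, 2, 2, 4, 4, 4]"
proof (rule choosableI_exact)
  fix Ls :: "nat \<Rightarrow> nat set"
  assume "\<And>i. i < length q_edges \<Longrightarrow> finite (Ls i) \<and> card (Ls i) = [3, 3, 2, 2, 4, 4, 4] ! i"
  then have L: "card (Ls 0) = 3" "card (Ls 1) = 3" "card (Ls 2) = 2" "card (Ls 3) = 2" "card (Ls 4) = 4"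
      "card (Ls 5) = 4" "card (Ls 6) = 4"
    by (auto dest!: spec simp: All_less_Suc numeral_eq_Suc)
  have "qcol (Ls 0) (Ls 1) (Ls 2) (Ls 3) (Ls 4) (Ls 5) (Ls 6)"
    using qcol_stuck_ge(1)[of "Ls 0" "Ls 1" "Ls 2" "Ls 3" "Ls 4" "Ls 5" "Ls 6"] L by fastforce
  then obtain p q r s x y z where c: "p \<in> Ls 0" "q \<in> Ls 1" "r \<in> Ls 2" "s \<in> Ls 3" "x \<in> Ls 4" "y \<in> Ls 5" "z \<in> Ls 6"
      "p \<noteq> q" "p \<noteq> r" "q \<noteq> s" "r \<noteq> s" "x \<notin> {p, q, r, s}" "y \<notin> {p, r}" "z \<notin> {q, s}" "x \<noteq> y" "x \<noteq> z" "y \<noteq> z"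
    unfolding qcol_def by blast
  have cf: "[0..<length q_edges] = [0,1,2,3,4,5,6]" "conflicts q_edges = [(1,0),(2,0),(3,1),(3,2),(4,0),(4,1),(4,2),(4,3),(5,0),(5,2),(5,4),(6,1),(6,3),(6,4),(6,5)]" by code_simp+
  show "\<exists>x. (\<forall>i<length q_edges. x i \<in> Ls i) \<and>
            (\<forall>i<length q_edges. \<forall>j<i. share (q_edges ! i) (q_edges ! j) \<longrightarrow> x i \<noteq> x j)"
    by (rule colors_exI[of "[p, q, r, s, x, y, z]"]; unfold cf; use c in auto)
qed simp


lemma ex_notin_of_card:
  assumes "finite B" "card B < card A"
  shows "\<exists>x\<in>A. x \<notin> B"
  using assms by (metis card_mono not_less subsetI)

lemma choosable_q_triangle:
  "choosable (q_edges @ [(3, 6), (3, 5), (5, 6)]) [2, 2, 4, 4, 4, 4, 4, 2, 4, 2]"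
  (is "choosable ?es ?ks")
proof (rule choosableI_exact)
  fix Ls :: "nat \<Rightarrow> nat set"
  assume "\<And>i. i < length ?es \<Longrightarrow> finite (Ls i) \<and> card (Ls i) = ?ks ! i"
  then have L: "card (Ls 0) = 2" "card (Ls 1) = 2" "card (Ls 2) = 4" "card (Ls 3) = 4" "card (Ls 4) = 4"
      "card (Ls 5) = 4" "card (Ls 6) = 4" "card (Ls 7) = 2" "card (Ls 8) = 4" "card (Ls 9) = 2"
    by (auto dest!: spec simp: All_less_Suc numeral_eq_Suc)
  have "\<exists>x\<in>Ls 7. \<exists>w\<in>Ls 9. \<exists>d\<in>Ls 8. x \<noteq> w \<and> d \<noteq> x \<and> d \<noteq> w \<and>
      qcol (Ls 0) (Ls 1) (Ls 2 - {x, d}) (Ls 3 - {x, d}) (Ls 4) (Ls 5) (Ls 6)"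
  proof (rule ccontr)
    assume n: "\<not> ?thesis"
    \<comment> \<open>If the colours \<open>x, d\<close> of the edges from vertex 3 to 6 and 5 are
      blocked, then what they remove from \<open>Ls 2\<close> is one of these two sets.\<close>
    define U where "U = {Ls 2 - Ls 0, Ls 2 - (Ls 4 - Ls 1)}"
    have st: "{x, d} \<in> U"
      if "x \<in> Ls 7" "w \<in> Ls 9" "d \<in> Ls 8" "x \<noteq> w" "d \<noteq> x" "d \<noteq> w" for x w d
    proof -
      have "2 \<le> card (Ls i - {x, d})" if "card (Ls i) = 4" for i
        using diff_card_le_card_Diff[of "{x, d}" "Ls i"] that \<open>d \<noteq> x\<close> by simp
      then have c: "2 \<le> card (Ls 0)" "2 \<le> card (Ls 1)" "2 \<le> card (Ls 2 - {x, d})" "2 \<le> card (Ls 3 - {x, d})"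
        using L by simp_all
      have "\<not> qcol (Ls 0) (Ls 1) (Ls 2 - {x, d}) (Ls 3 - {x, d}) (Ls 4) (Ls 5) (Ls 6)" using n that by blast
      note q = qcol_stuck_ge[OF c L(5-7) this]
      have "card (Ls 2 - {x, d}) = 2" by (rule q(3))
      moreover have "Ls 0 = Ls 2 - {x, d} \<or> Ls 2 - {x, d} = Ls 4 - Ls 1" using q(5) by blast
      moreover have "{x, d} \<subseteq> Ls 2"
      proof -
        have f: "finite (Ls 2)" using L by (auto intro: card_ge_0_finite)
        have "card (Ls 2 \<inter> {x, d}) = 2"
          using card_Diff_subset_Int[of "Ls 2" "{x, d}"] f q(3) L
            card_mono[of "Ls 2" "Ls 2 \<inter> {x, d}"] by simp
        then show ?thesis using card_subset_eq[of "{x, d}" "Ls 2 \<inter> {x, d}"] \<open>d \<noteq> x\<close> by auto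
      qed
      ultimately have "{x, d} = Ls 2 - Ls 0 \<or> {x, d} = Ls 2 - (Ls 4 - Ls 1)" by blast
      then show ?thesis unfolding U_def by blast
    qed
    obtain x1 x2 where x: "x1 \<in> Ls 7" "x2 \<in> Ls 7" "x1 \<noteq> x2" using L(8) by (auto simp: card_2_iff)
    \<comment> \<open>\<open>Ls 8\<close> has four colours and two of them are excluded by
      \<open>x\<close> and \<open>w\<close>, so two choices of \<open>d\<close> remain for each
      \<open>x\<close>.\<close>
    have two: "\<exists>d1 d2. d1 \<noteq> d2 \<and> {x, d1} \<in> U \<and>
        {x, d2} \<in> U \<and> d1 \<noteq> x \<and> d2 \<noteq> x" if "x \<in> Ls 7" for x
    proof -
      obtain w where w: "w \<in> Ls 9" "w \<noteq> x" using ex_notin_of_card[of "{x}" "Ls 9"] L by auto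
      obtain d1 where d1: "d1 \<in> Ls 8" "d1 \<notin> {x, w}" using ex_notin_of_card[of "{x, w}" "Ls 8"] L w by auto
      obtain d2 where d2: "d2 \<in> Ls 8" "d2 \<notin> {x, w, d1}" using ex_notin_of_card[of "{x, w, d1}" "Ls 8"] L w d1 by auto
      show ?thesis using st[of x w d1] st[of x w d2] that w d1 d2 by (intro exI[of _ d1] exI[of _ d2]) blast
    qed
    obtain d1 d2 where d: "d1 \<noteq> d2" "{x1, d1} \<in> U"
        "{x1, d2} \<in> U" "d1 \<noteq> x1" "d2 \<noteq> x1" using two[OF x(1)] by blast
    obtain d3 d4 where d': "d3 \<noteq> d4" "{x2, d3} \<in> U"
        "{x2, d4} \<in> U" "d3 \<noteq> x2" "d4 \<noteq> x2" using two[OF x(2)] by blast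
    have ne: "{x1, d1} \<noteq> {x1, d2}" "{x2, d3} \<noteq> {x2, d4}" using d d' by (auto simp: doubleton_eq_iff)
    \<comment> \<open>As \<open>U\<close> has at most two members, the two pairs through
      \<open>x1\<close> are also the two pairs through \<open>x2\<close>. Both would be
      \<open>{x1, x2}\<close>, against \<open>d1\<close> and \<open>d2\<close> being
      different.\<close>
    have "{S, T} = U" if "S \<in> U" "T \<in> U" "S \<noteq> T" for S T using that unfolding U_def by auto
    then have "U = {{x2, d3}, {x2, d4}}" using ne d'(2,3) by blast
    then have "\<forall>S\<in>U. x2 \<in> S" by simp
    then have "x2 \<in> {x1, d1}" "x2 \<in> {x1, d2}" by (rule bspec[OF _ d(2)], rule bspec[OF _ d(3)])
    then show False using x d by auto
  qed
  then obtain x w d p q r s e y z where c: "x \<in> Ls 7" "w \<in> Ls 9" "d \<in> Ls 8" "x \<noteq> w" "d \<noteq> x" "d \<noteq> w"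
      "p \<in> Ls 0" "q \<in> Ls 1" "r \<in> Ls 2 - {x, d}" "s \<in> Ls 3 - {x, d}" "e \<in> Ls 4" "y \<in> Ls 5" "z \<in> Ls 6"
      "p \<noteq> q" "p \<noteq> r" "q \<noteq> s" "r \<noteq> s" "e \<notin> {p, q, r, s}" "y \<notin> {p, r}" "z \<notin> {q, s}" "e \<noteq> y" "e \<noteq> z" "y \<noteq> z"
    unfolding qcol_def by blast
  have cf: "[0..<length ?es] = [0,1,2,3,4,5,6,7,8,9]" "conflicts ?es = [(1,0),(2,0),(3,1),(3,2),(4,0),(4,1),(4,2),(4,3),(5,0),(5,2),(5,4),(6,1),(6,3),(6,4),(6,5),(7,2),(7,3),(8,2),(8,3),(8,7),(9,7),(9,8)]" by code_simp+
  show "\<exists>x. (\<forall>i<length ?es. x i \<in> Ls i) \<and> (\<forall>i<length ?es. \<forall>j<i. share (?es ! i) (?es ! j) \<longrightarrow> x i \<noteq> x j)"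
    by (rule colors_exI[of "[p, q, r, s, e, y, z, x, d, w]"]; unfold cf; use c in auto)
qed simp


text \<open>The edge \<open>ad\<close> conflicts with just the four edges of the 4-cycle, so its
  colour is taken out of their lists.\<close>

definition lcol :: "nat set \<Rightarrow> nat set \<Rightarrow> nat set \<Rightarrow> nat set \<Rightarrow> nat set \<Rightarrow> nat set \<Rightarrow> nat set \<Rightarrow> nat set \<Rightarrow> bool" where
  "lcol AD AB AC DB DC BC BV CV \<longleftrightarrow>
     (\<exists>e\<in>AD. qcol (AB - {e}) (AC - {e}) (DB - {e}) (DC - {e}) BC BV CV)"

lemma lcolE:
  assumes "lcol AD AB AC DB DC BC BV CV"
  obtains p q r s x y z e where "p \<in> AB" "q \<in> AC" "r \<in> DB" "s \<in> DC" "x \<in> BC" "y \<in> BV" "z \<in> CV" "e \<in> AD"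
      "p \<noteq> q" "p \<noteq> r" "q \<noteq> s" "r \<noteq> s" "x \<notin> {p, q, r, s}" "y \<notin> {p, r}" "z \<notin> {q, s}" "x \<noteq> y" "x \<noteq> z" "y \<noteq> z"
      "e \<notin> {p, q, r, s}"
proof -
  obtain e p q r s x y z where "e \<in> AD" "p \<in> AB - {e}" "q \<in> AC - {e}" "r \<in> DB - {e}" "s \<in> DC - {e}" "x \<in> BC" "y \<in> BV" "z \<in> CV"
      "p \<noteq> q" "p \<noteq> r" "q \<noteq> s" "r \<noteq> s" "x \<notin> {p, q, r, s}" "y \<notin> {p, r}" "z \<notin> {q, s}" "x \<noteq> y" "x \<noteq> z" "y \<noteq> z"
    using assms unfolding lcol_def qcol_def by blast
  then show ?thesis by (intro that[of p q r s x y z e]) auto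
qed

lemma lcol_stuck:
  assumes "2 \<le> card AD" "3 \<le> card AB" "3 \<le> card AC" "3 \<le> card DB" "3 \<le> card DC"
      "card BC = 4" "card BV = 4" "card CV = 4"
    and "\<not> lcol AD AB AC DB DC BC BV CV"
  shows "card AB = 3" "card DB = 3" "AB = DB"
  using lump_stuck[OF assms(1-8)] assms(9) unfolding lcol_def by blast+

abbreviation "lump_edges \<equiv> q_edges @ [(0, 3)]"

text \<open>If both colours \<open>d\<close> of the pendant edge were blocked,
  \<open>lcol_stuck\<close> would make \<open>Ls 0\<close> equal to \<open>Ls 2 - {d}\<close> for
  two different elements \<open>d\<close> of \<open>Ls 2\<close>.\<close>

lemma choosable_lump_pendant:
  "choosable (lump_edges @ [(3, 5)]) [3, 3, 4, 4, 4, 4, 4, 3, 2]" (is "choosable ?es ?ks")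
proof (rule choosableI_exact)
  fix Ls :: "nat \<Rightarrow> nat set"
  assume "\<And>i. i < length ?es \<Longrightarrow> finite (Ls i) \<and> card (Ls i) = ?ks ! i"
  then have L: "card (Ls 0) = 3" "card (Ls 1) = 3" "card (Ls 2) = 4" "card (Ls 3) = 4" "card (Ls 4) = 4"
      "card (Ls 5) = 4" "card (Ls 6) = 4" "card (Ls 7) = 3" "card (Ls 8) = 2"
    by (auto dest!: spec simp: All_less_Suc numeral_eq_Suc)
  have "\<exists>d\<in>Ls 8. lcol (Ls 7 - {d}) (Ls 0) (Ls 1) (Ls 2 - {d}) (Ls 3 - {d}) (Ls 4) (Ls 5) (Ls 6)"
  proof (rule ccontr)
    assume n: "\<not> ?thesis"
    obtain d1 d2 where d: "d1 \<in> Ls 8" "d2 \<in> Ls 8" "d1 \<noteq> d2" using L by (auto simp: card_2_iff)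
    have st: "d \<in> Ls 2 \<and> Ls 0 = Ls 2 - {d}" if "d \<in> Ls 8" for d
    proof -
      have c: "2 \<le> card (Ls 7 - {d})" "3 \<le> card (Ls 0)" "3 \<le> card (Ls 1)" "3 \<le> card (Ls 2 - {d})" "3 \<le> card (Ls 3 - {d})"
        using L card_Diff1_ge[of 2 "Ls 7" d] card_Diff1_ge[of 3 "Ls 2" d] card_Diff1_ge[of 3 "Ls 3" d] by simp_all
      have "\<not> lcol (Ls 7 - {d}) (Ls 0) (Ls 1) (Ls 2 - {d}) (Ls 3 - {d}) (Ls 4) (Ls 5) (Ls 6)" using n that by blast
      note q = lcol_stuck[OF c L(5-7) this]
      show ?thesis using q(2,3) L(3) by (cases "d \<in> Ls 2") auto
    qed
    show False using st[OF d(1)] st[OF d(2)] d(3) by blast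
  qed
  then obtain d where d: "d \<in> Ls 8" "lcol (Ls 7 - {d}) (Ls 0) (Ls 1) (Ls 2 - {d}) (Ls 3 - {d}) (Ls 4) (Ls 5) (Ls 6)" by blast
  from d(2) show "\<exists>x. (\<forall>i<length ?es. x i \<in> Ls i) \<and> (\<forall>i<length ?es. \<forall>j<i. share (?es ! i) (?es ! j) \<longrightarrow> x i \<noteq> x j)"
  proof (rule lcolE)
    fix p q r s x y z e assume c: "p \<in> Ls 0" "q \<in> Ls 1" "r \<in> Ls 2 - {d}" "s \<in> Ls 3 - {d}" "x \<in> Ls 4" "y \<in> Ls 5" "z \<in> Ls 6" "e \<in> Ls 7 - {d}"
      "p \<noteq> q" "p \<noteq> r" "q \<noteq> s" "r \<noteq> s" "x \<notin> {p, q, r, s}" "y \<notin> {p, r}" "z \<notin> {q, s}" "x \<noteq> y" "x \<noteq> z" "y \<noteq> z"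
      "e \<notin> {p, q, r, s}"
    have cf: "[0..<length ?es] = [0,1,2,3,4,5,6,7,8]" "conflicts ?es = [(1,0),(2,0),(3,1),(3,2),(4,0),(4,1),(4,2),(4,3),(5,0),(5,2),(5,4),(6,1),(6,3),(6,4),(6,5),(7,0),(7,1),(7,2),(7,3),(8,2),(8,3),(8,7)]" by code_simp+
    show ?thesis
      by (rule colors_exI[of "[p, q, r, s, x, y, z, e, d]"]; unfold cf; use c d in auto)
  qed
qed simp

text \<open>A blocked choice has \<open>Ls 0 - {a} = Ls 2 - {d}\<close> with different
  \<open>a\<close> and \<open>d\<close>, so \<open>a\<close> is the only colour of
  \<open>Ls 0\<close> outside \<open>Ls 2\<close>, and \<open>d\<close> the only one the other way
  round. The lists of the two cap edges always allow a second choice.\<close>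

lemma choosable_lump_cap:
  "choosable (lump_edges @ [(0, 5), (3, 5)]) [4, 4, 4, 4, 4, 4, 4, 4, 2, 2]" (is "choosable ?es ?ks")
proof (rule choosableI_exact)
  fix Ls :: "nat \<Rightarrow> nat set"
  assume "\<And>i. i < length ?es \<Longrightarrow> finite (Ls i) \<and> card (Ls i) = ?ks ! i"
  then have L: "card (Ls 0) = 4" "card (Ls 1) = 4" "card (Ls 2) = 4" "card (Ls 3) = 4" "card (Ls 4) = 4"
      "card (Ls 5) = 4" "card (Ls 6) = 4" "card (Ls 7) = 4" "card (Ls 8) = 2" "card (Ls 9) = 2"
    by (auto dest!: spec simp: All_less_Suc numeral_eq_Suc)
  have "\<exists>a\<in>Ls 8. \<exists>d\<in>Ls 9. a \<noteq> d \<and>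
      lcol (Ls 7 - {a, d}) (Ls 0 - {a}) (Ls 1 - {a}) (Ls 2 - {d}) (Ls 3 - {d}) (Ls 4) (Ls 5) (Ls 6)"
  proof (rule ccontr)
    assume n: "\<not> ?thesis"
    obtain a1 a2 where a: "a1 \<in> Ls 8" "a2 \<in> Ls 8" "a1 \<noteq> a2" using L by (auto simp: card_2_iff)
    obtain d1 d2 where d: "d1 \<in> Ls 9" "d2 \<in> Ls 9" "d1 \<noteq> d2" using L by (auto simp: card_2_iff)
    have st: "a \<in> Ls 0 \<and> d \<in> Ls 2 \<and> Ls 0 - {a} = Ls 2 - {d}" if "a \<in> Ls 8" "d \<in> Ls 9" "a \<noteq> d" for a d
    proof -
      have c: "2 \<le> card (Ls 7 - {a, d})" "3 \<le> card (Ls 0 - {a})" "3 \<le> card (Ls 1 - {a})" "3 \<le> card (Ls 2 - {d})" "3 \<le> card (Ls 3 - {d})"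
        using L card_Diff1_ge[of 3 "Ls 0" a] card_Diff1_ge[of 3 "Ls 1" a] card_Diff1_ge[of 3 "Ls 2" d]
          card_Diff1_ge[of 3 "Ls 3" d] diff_card_le_card_Diff[of "{a, d}" "Ls 7"] that by simp_all
      have "\<not> lcol (Ls 7 - {a, d}) (Ls 0 - {a}) (Ls 1 - {a}) (Ls 2 - {d}) (Ls 3 - {d}) (Ls 4) (Ls 5) (Ls 6)" using n that by blast
      note q = lcol_stuck[OF c L(5-7) this]
      show ?thesis using q L(1,3) by (cases "d \<in> Ls 2"; cases "a \<in> Ls 0") auto
    qed
    show False using st[of a1 d1] st[of a1 d2] st[of a2 d1] st[of a2 d2] a d by blast
  qed
  then obtain a d where d: "a \<in> Ls 8" "d \<in> Ls 9" "a \<noteq> d"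
    "lcol (Ls 7 - {a, d}) (Ls 0 - {a}) (Ls 1 - {a}) (Ls 2 - {d}) (Ls 3 - {d}) (Ls 4) (Ls 5) (Ls 6)" by blast
  from d(4) show "\<exists>x. (\<forall>i<length ?es. x i \<in> Ls i) \<and> (\<forall>i<length ?es. \<forall>j<i. share (?es ! i) (?es ! j) \<longrightarrow> x i \<noteq> x j)"
  proof (rule lcolE)
    fix p q r s x y z e assume c: "p \<in> Ls 0 - {a}" "q \<in> Ls 1 - {a}" "r \<in> Ls 2 - {d}" "s \<in> Ls 3 - {d}" "x \<in> Ls 4" "y \<in> Ls 5" "z \<in> Ls 6" "e \<in> Ls 7 - {a, d}"
      "p \<noteq> q" "p \<noteq> r" "q \<noteq> s" "r \<noteq> s" "x \<notin> {p, q, r, s}" "y \<notin> {p, r}" "z \<notin> {q, s}" "x \<noteq> y" "x \<noteq> z" "y \<noteq> z"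
      "e \<notin> {p, q, r, s}"
    have cf: "[0..<length ?es] = [0,1,2,3,4,5,6,7,8,9]" "conflicts ?es = [(1,0),(2,0),(3,1),(3,2),(4,0),(4,1),(4,2),(4,3),(5,0),(5,2),(5,4),(6,1),(6,3),(6,4),(6,5),(7,0),(7,1),(7,2),(7,3),(8,0),(8,1),(8,7),(9,2),(9,3),(9,7),(9,8)]" by code_simp+
    show ?thesis
      by (rule colors_exI[of "[p, q, r, s, x, y, z, e, a, d]"]; unfold cf; use c d in auto)
  qed
qed simp

text \<open>This is the next configuration with its lump contracted to a vertex, which is where the
  additional demand that \<open>a\<close> and \<open>d\<close> differ comes from.\<close>

lemma bowtie_colors:
  fixes A B C D F G :: "nat set"
  assumes "card A = 2" "card B = 2" "card C = 2" "card D = 4" "card F = 2" "card G = 4"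
  obtains h i f d a g where "h \<in> A" "i \<in> B" "f \<in> C" "d \<in> D" "a \<in> F" "g \<in> G"
    "a \<noteq> f" "f \<noteq> d" "f \<noteq> g" "f \<noteq> h" "d \<noteq> g" "d \<noteq> h" "g \<noteq> h" "g \<noteq> i" "h \<noteq> i" "a \<noteq> d"
proof -
  let ?es = "[(0,2),(2,4),(0,1),(0,3),(1,3),(0,4)] :: (nat \<times> nat) list"
  have fin: "finite A" "finite B" "finite C" "finite D" "finite F" "finite G"
    using assms by (auto intro: card_ge_0_finite)
  have "\<exists>x. (\<forall>i<length ?es. x i \<in> [A, B, C, D, F, G] ! i) \<and>
      (\<forall>i<length ?es. \<forall>j<i. share (?es ! i) (?es ! j) \<longrightarrow> x i \<noteq> x j)"
    by (rule choosable_bowtie[unfolded choosable_def, rule_format])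
      (use assms fin in \<open>auto simp: numeral_eq_Suc less_Suc_eq\<close>)
  moreover have "length ?es = 6" by simp
  ultimately obtain x where x: "\<And>i. i < 6 \<Longrightarrow> x i \<in> [A, B, C, D, F, G] ! i"
      "\<And>i j. i < 6 \<Longrightarrow> j < i \<Longrightarrow> share (?es ! i) (?es ! j) \<Longrightarrow> x i \<noteq> x j" by metis
  show ?thesis
  proof (rule that[of "x 0" "x 1" "x 2" "x 3" "x 4" "x 5"])
    show "x 0 \<in> A" "x 1 \<in> B" "x 2 \<in> C" "x 3 \<in> D" "x 4 \<in> F" "x 5 \<in> G"
      using x(1)[of 0] x(1)[of 1] x(1)[of 2] x(1)[of 3] x(1)[of 4] x(1)[of 5] by simp_all
    show "x 4 \<noteq> x 2" "x 2 \<noteq> x 3" "x 2 \<noteq> x 5" "x 2 \<noteq> x 0" "x 3 \<noteq> x 5" "x 3 \<noteq> x 0" "x 5 \<noteq> x 0" "x 5 \<noteq> x 1"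
       "x 0 \<noteq> x 1" "x 4 \<noteq> x 3"
      using x(2)[of 4 2] x(2)[of 3 2] x(2)[of 5 2] x(2)[of 2 0] x(2)[of 5 3] x(2)[of 3 0] x(2)[of 5 0] x(2)[of 5 1]
        x(2)[of 1 0] x(2)[of 4 3] by (simp_all add: share_def)
  qed
qed

lemma choosable_lump_bowtie:
  "choosable (lump_edges @ [(3, 5), (0, 6), (5, 6), (5, 8), (5, 7), (7, 8)])
     [4, 4, 4, 4, 4, 4, 4, 4, 4, 2, 2, 4, 2, 2]" (is "choosable ?es ?ks")
proof (rule choosableI_exact)
  fix Ls :: "nat \<Rightarrow> nat set"
  assume "\<And>i. i < length ?es \<Longrightarrow> finite (Ls i) \<and> card (Ls i) = ?ks ! i"
  then have L: "card (Ls 0) = 4" "card (Ls 1) = 4" "card (Ls 2) = 4" "card (Ls 3) = 4" "card (Ls 4) = 4"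
      "card (Ls 5) = 4" "card (Ls 6) = 4" "card (Ls 7) = 4" "card (Ls 8) = 4" "card (Ls 9) = 2"
      "card (Ls 10) = 2" "card (Ls 11) = 4" "card (Ls 12) = 2" "card (Ls 13) = 2"
    by (auto dest!: spec simp: All_less_Suc numeral_eq_Suc)
  have fin: "finite (Ls i)" if "card (Ls i) \<in> {2, 4}" for i using that by (auto intro: card_ge_0_finite)
  have st: "a \<in> Ls 0 \<and> d \<in> Ls 2 \<and> Ls 0 - {a} = Ls 2 - {d}"
    if "\<not> lcol (Ls 7 - {a, d}) (Ls 0 - {a}) (Ls 1 - {a}) (Ls 2 - {d}) (Ls 3 - {d}) (Ls 4) (Ls 5) (Ls 6)" for a d
  proof -
    have "card {a, d} \<le> 2" by (simp add: card_insert_if)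
    then have c: "2 \<le> card (Ls 7 - {a, d})" "3 \<le> card (Ls 0 - {a})" "3 \<le> card (Ls 1 - {a})" "3 \<le> card (Ls 2 - {d})" "3 \<le> card (Ls 3 - {d})"
      using L card_Diff1_ge[of 3 "Ls 0" a] card_Diff1_ge[of 3 "Ls 1" a] card_Diff1_ge[of 3 "Ls 2" d]
        card_Diff1_ge[of 3 "Ls 3" d] diff_card_le_card_Diff[of "{a, d}" "Ls 7"] by simp_all
    note q = lcol_stuck[OF c L(5-7) that]
    show ?thesis using q L(1,3) by (cases "d \<in> Ls 2"; cases "a \<in> Ls 0") auto
  qed
  have "\<exists>d\<in>Ls 8. \<exists>a\<in>Ls 9. \<exists>f\<in>Ls 10. \<exists>g\<in>Ls 11. \<exists>h\<in>Ls 12. \<exists>i\<in>Ls 13.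
      a \<noteq> f \<and> f \<noteq> d \<and> f \<noteq> g \<and> f \<noteq> h \<and> d \<noteq> g \<and> d \<noteq> h \<and> g \<noteq> h \<and> g \<noteq> i \<and> h \<noteq> i \<and>
      lcol (Ls 7 - {a, d}) (Ls 0 - {a}) (Ls 1 - {a}) (Ls 2 - {d}) (Ls 3 - {d}) (Ls 4) (Ls 5) (Ls 6)"
  \<comment> \<open>For equal lists, different \<open>a\<close> and \<open>d\<close> already make
    \<open>Ls 0 - {a}\<close> and \<open>Ls 2 - {d}\<close> different. Otherwise a colour
    \<open>u\<close> of \<open>Ls 0\<close> outside \<open>Ls 2\<close> is kept by choosing another
    colour for \<open>a\<close>, and the remaining edges are coloured greedily.\<close>
  proof (cases "Ls 0 = Ls 2")
    case True
    obtain h i f d a g where m: "h \<in> Ls 12" "i \<in> Ls 13" "f \<in> Ls 10" "d \<in> Ls 8" "a \<in> Ls 9" "g \<in> Ls 11"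
      and ne: "a \<noteq> f" "f \<noteq> d" "f \<noteq> g" "f \<noteq> h" "d \<noteq> g" "d \<noteq> h" "g \<noteq> h" "g \<noteq> i" "h \<noteq> i" "a \<noteq> d"
      by (rule bowtie_colors[OF L(13,14,11,9,10,12)])
    have "lcol (Ls 7 - {a, d}) (Ls 0 - {a}) (Ls 1 - {a}) (Ls 2 - {d}) (Ls 3 - {d}) (Ls 4) (Ls 5) (Ls 6)"
      using st[of a d] True ne by blast
    then show ?thesis using m ne
      by - (rule bexI[of _ d], rule bexI[of _ a], rule bexI[of _ f], rule bexI[of _ g], rule bexI[of _ h],
        rule bexI[of _ i], auto)
  next
    case False
    then have "\<not> Ls 0 \<subseteq> Ls 2" using card_subset_eq[of "Ls 2" "Ls 0"] fin[of 2] L(1,3) by auto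
    then obtain u where u: "u \<in> Ls 0" "u \<notin> Ls 2" by blast
    obtain a where a: "a \<in> Ls 9" "a \<noteq> u" using ex_notin_of_card[of "{u}" "Ls 9"] L by auto
    obtain f where f: "f \<in> Ls 10" "f \<noteq> a" using ex_notin_of_card[of "{a}" "Ls 10"] L by auto
    obtain h where h: "h \<in> Ls 12" "h \<noteq> f" using ex_notin_of_card[of "{f}" "Ls 12"] L by auto
    obtain i where i: "i \<in> Ls 13" "i \<noteq> h" using ex_notin_of_card[of "{h}" "Ls 13"] L by auto
    have c3: "card {x, y, z} < 4" for x y z :: nat by (simp add: card_insert_if)
    obtain g where g: "g \<in> Ls 11" "g \<notin> {f, h, i}" using ex_notin_of_card[of "{f, h, i}" "Ls 11"] L c3 by auto
    obtain d where d: "d \<in> Ls 8" "d \<notin> {f, h, g}" using ex_notin_of_card[of "{f, h, g}" "Ls 8"] L c3 by auto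
    have "lcol (Ls 7 - {a, d}) (Ls 0 - {a}) (Ls 1 - {a}) (Ls 2 - {d}) (Ls 3 - {d}) (Ls 4) (Ls 5) (Ls 6)"
      using st[of a d] u a by blast
    then show ?thesis using a f h i g d
      by - (rule bexI[of _ d], rule bexI[of _ a], rule bexI[of _ f], rule bexI[of _ g], rule bexI[of _ h],
        rule bexI[of _ i], auto)
  qed
  then obtain d a f g h i where d: "d \<in> Ls 8" "a \<in> Ls 9" "f \<in> Ls 10" "g \<in> Ls 11" "h \<in> Ls 12" "i \<in> Ls 13"
      "a \<noteq> f" "f \<noteq> d" "f \<noteq> g" "f \<noteq> h" "d \<noteq> g" "d \<noteq> h" "g \<noteq> h" "g \<noteq> i" "h \<noteq> i"
    and lc: "lcol (Ls 7 - {a, d}) (Ls 0 - {a}) (Ls 1 - {a}) (Ls 2 - {d}) (Ls 3 - {d}) (Ls 4) (Ls 5) (Ls 6)" by blast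
  from lc show "\<exists>x. (\<forall>i<length ?es. x i \<in> Ls i) \<and> (\<forall>i<length ?es. \<forall>j<i. share (?es ! i) (?es ! j) \<longrightarrow> x i \<noteq> x j)"
  proof (rule lcolE)
    fix p q r s x y z e assume c: "p \<in> Ls 0 - {a}" "q \<in> Ls 1 - {a}" "r \<in> Ls 2 - {d}" "s \<in> Ls 3 - {d}" "x \<in> Ls 4" "y \<in> Ls 5" "z \<in> Ls 6" "e \<in> Ls 7 - {a, d}"
      "p \<noteq> q" "p \<noteq> r" "q \<noteq> s" "r \<noteq> s" "x \<notin> {p, q, r, s}" "y \<notin> {p, r}" "z \<notin> {q, s}" "x \<noteq> y" "x \<noteq> z" "y \<noteq> z"
      "e \<notin> {p, q, r, s}"
    have cf: "[0..<length ?es] = [0,1,2,3,4,5,6,7,8,9,10,11,12,13]" "conflicts ?es = [(1,0),(2,0),(3,1),(3,2),(4,0),(4,1),(4,2),(4,3),(5,0),(5,2),(5,4),(6,1),(6,3),(6,4),(6,5),(7,0),(7,1),(7,2),(7,3),(8,2),(8,3),(8,7),(9,0),(9,1),(9,7),(10,8),(10,9),(11,8),(11,10),(12,8),(12,10),(12,11),(13,11),(13,12)]" by code_simp+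
    show ?thesis
      by (rule colors_exI[of "[p, q, r, s, x, y, z, e, d, a, f, g, h, i]"]; unfold cf; use c d in auto)
  qed
qed simp

section \<open>Critical graphs\<close>

definition config_degrees :: "(nat \<times> nat) list \<Rightarrow> nat list \<Rightarrow> nat list" where
  "config_degrees ces xs =
     map (\<lambda>k. xs ! k + length (filter (\<lambda>(a, b). a = k \<or> b = k) ces)) [0..<length xs]"

text \<open>
  A graph that cannot be coloured from \<open>L\<close> although all its proper subgraphs can. The relation
  \<open>X\<close> collects pairs of crossing edges.
\<close>

locale critical =
  fixes E :: "'a set set" and L :: "'a set \<Rightarrow> nat set" and X :: "'a set \<Rightarrow> 'a set \<Rightarrow> bool"
  assumes finite_E: "finite E"
    and card_edge: "e \<in> E \<Longrightarrow> card e = 2"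
    and degree_le: "vertex_degree E v \<le> 4"
    and lists: "e \<in> E \<Longrightarrow> finite (L e) \<and> 4 \<le> card (L e)"
    and critical: "E' \<subset> E \<Longrightarrow> list_colorable E' L"
    and not_colorable: "\<not> list_colorable E L"
    and X_sym: "X e f \<Longrightarrow> X f e"
    and X_far: "\<lbrakk>e \<in> E; f \<in> E; X e f; e' \<in> E; f' \<in> E; X e' f'; x \<in> e \<union> f; y \<in> e' \<union> f';
        x = y \<or> {x, y} \<in> E \<or> (\<exists>z. {x, z} \<in> E \<and> {z, y} \<in> E)\<rbrakk> \<Longrightarrow> {e, f} = {e', f'}"
begin

definition N :: "'a \<Rightarrow> 'a set" where
  "N v = {w. {v, w} \<in> E}"

lemma N_sym: "w \<in> N v \<longleftrightarrow> v \<in> N w"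
  unfolding N_def by (simp add: insert_commute)

lemma not_self_N: "v \<notin> N v"
  using card_edge[of "{v}"] unfolding N_def by auto

lemma edge_N: "{v, w} \<in> E \<longleftrightarrow> w \<in> N v"
  unfolding N_def by simp

lemma N_image: "{e \<in> E. v \<in> e} = (\<lambda>w. {v, w}) ` N v"
proof (intro subset_antisym subsetI)
  fix e assume e: "e \<in> {e \<in> E. v \<in> e}"
  then obtain a b where "e = {a, b}" using card_edge by (metis (lifting) card_2_iff mem_Collect_eq)
  then show "e \<in> (\<lambda>w. {v, w}) ` N v" using e unfolding N_def by (auto simp: insert_commute)
qed (auto simp: N_def)

lemma vertex_degree_N: "vertex_degree E v = card (N v)"
  unfolding vertex_degree_def N_image by (rule card_image) (auto simp: inj_on_def doubleton_eq_iff)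

lemma card_N_le: "card (N v) \<le> 4"
  using degree_le vertex_degree_N by simp

lemma finite_N: "finite (N v)"
proof -
  have "finite ((\<lambda>w. {v, w}) ` N v)" unfolding N_image[symmetric] using finite_E by simp
  then show ?thesis by (rule finite_imageD) (auto simp: inj_on_def doubleton_eq_iff)
qed

text \<open>Form in which reducible configurations are used: \<open>bs\<close> lists the degree
  bounds under which the edges keep enough colours.\<close>

lemma config_False:
  assumes "choosable ces ks" "config ces xs ks" "config_degrees ces xs = bs"
    and "distinct vs" "list_all (\<lambda>(a, b). {vs ! a, vs ! b} \<in> E) ces"
    and "list_all2 (\<lambda>v b. card (N v) \<le> b) vs bs"
  shows False
proof -
  have len: "length vs = length xs"
    using list_all2_lengthD[OF assms(6)] assms(3) unfolding config_degrees_def by auto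
  have "list_colorable E L"
  proof (rule config_reducible[OF assms(1,2) finite_E assms(4) len])
    show "{vs ! a, vs ! b} \<in> E" if "(a, b) \<in> set ces" for a b
      using assms(5) that unfolding list_all_iff by auto
    show "vertex_degree E (vs ! k) \<le> xs ! k + length (filter (\<lambda>(a, b). a = k \<or> b = k) ces)"
      if "k < length vs" for k
      using list_all2_nthD[OF assms(6) that] len that
      unfolding assms(3)[symmetric] config_degrees_def vertex_degree_N by simp
  qed (use lists critical in auto)
  then show False using not_colorable by blast
qed

text \<open>Otherwise the edge has at most three adjacent edges and can be coloured last.\<close>

lemma edge_degree_sum:
  assumes "{u, v} \<in> E"
  shows "6 \<le> card (N u) + card (N v)"
proof (rule ccontr)
  assume n: "\<not> ?thesis"
  have uv: "u \<noteq> v" using assms not_self_N edge_N by blast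
  have "card (N u) \<ge> 1" "card (N v) \<ge> 1"
    using assms edge_N N_sym finite_N by (metis One_nat_def Suc_leI card_gt_0_iff empty_iff)+
  show False
  proof (rule config_False[where vs = "[u, v]"])
    show "choosable [(0, 1)] (map Suc [0])" by (rule choosable_alon_tarsi; code_simp)
    show "config [(0, 1)] [card (N u) - 1, card (N v) - 1] (map Suc [0])"
      using n \<open>card (N u) \<ge> 1\<close> \<open>card (N v) \<ge> 1\<close> unfolding config_def by simp
    show "config_degrees [(0, 1)] [card (N u) - 1, card (N v) - 1] = [card (N u), card (N v)]"
      using \<open>card (N u) \<ge> 1\<close> \<open>card (N v) \<ge> 1\<close> unfolding config_degrees_def by simp
  qed (use assms uv in simp_all)
qed

lemma card_N_ge_2:
  assumes "{u, v} \<in> E"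
  shows "2 \<le> card (N u)"
  using edge_degree_sum[OF assms] card_N_le[of v] by linarith

section \<open>Configurations that a critical graph does not contain\<close>

lemma no_C4:
  assumes "distinct [a, b, u, v]" "{a, u} \<in> E" "{a, v} \<in> E" "{b, u} \<in> E" "{b, v} \<in> E"
    and "card (N u) \<le> 2" "card (N v) \<le> 2"
  shows False
proof (rule config_False[where vs = "[a, b, u, v]"])
  show "choosable [(0,2),(0,3),(1,2),(1,3)] (map Suc [1,1,1,1])" using choosable_C4 by simp
  show "config [(0,2),(0,3),(1,2),(1,3)] [2, 2, 0, 0] (map Suc [1,1,1,1])" by code_simp
  show "config_degrees [(0,2),(0,3),(1,2),(1,3)] [2, 2, 0, 0] = [4, 4, 2, 2]" by code_simp
qed (use assms card_N_le in simp_all)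

lemma no_bowtie:
  assumes "distinct [w, u, y, v, x]" "{w, y} \<in> E" "{y, x} \<in> E" "{w, u} \<in> E" "{w, v} \<in> E" "{u, v} \<in> E" "{w, x} \<in> E"
    and "card (N v) \<le> 2" "card (N x) \<le> 2"
  shows False
proof (rule config_False[where vs = "[w, u, y, v, x]"])
  show "choosable [(0,2),(2,4),(0,1),(0,3),(1,3),(0,4)] (map Suc [1,1,1,3,1,3])" using choosable_bowtie by simp
  show "config [(0,2),(2,4),(0,1),(0,3),(1,3),(0,4)] [0, 2, 2, 0, 0] (map Suc [1,1,1,3,1,3])" by code_simp
  show "config_degrees [(0,2),(2,4),(0,1),(0,3),(1,3),(0,4)] [0, 2, 2, 0, 0] = [4, 4, 4, 2, 2]" by code_simp
qed (use assms card_N_le in simp_all)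

lemma no_K4:
  assumes "distinct [a, b, u, v]" "{a, b} \<in> E" "{b, u} \<in> E" "{a, v} \<in> E" "{a, u} \<in> E" "{b, v} \<in> E" "{u, v} \<in> E"
    and "card (N u) \<le> 3" "card (N v) \<le> 3"
  shows False
proof (rule config_False[where vs = "[a, b, u, v]"])
  show "choosable [(0,1),(1,2),(0,3),(0,2),(1,3),(2,3)] (map Suc [1,2,2,2,2,3])" using choosable_K4 by simp
  show "config [(0,1),(1,2),(0,3),(0,2),(1,3),(2,3)] [1, 1, 0, 0] (map Suc [1,2,2,2,2,3])" by code_simp
  show "config_degrees [(0,1),(1,2),(0,3),(0,2),(1,3),(2,3)] [1, 1, 0, 0] = [4, 4, 3, 3]" by code_simp
qed (use assms card_N_le in simp_all)

lemma no_K4_minus: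
  assumes "distinct [a, b, u, v]" "{a, v} \<in> E" "{a, u} \<in> E" "{b, u} \<in> E" "{u, v} \<in> E" "{b, v} \<in> E"
    and "card (N b) \<le> 3" "card (N u) \<le> 3" "card (N v) \<le> 3"
  shows False
proof (rule config_False[where vs = "[a, b, u, v]"])
  show "choosable [(0,3),(0,2),(1,2),(2,3),(1,3)] (map Suc [1,1,1,3,2])" using choosable_K4_minus by simp
  show "config [(0,3),(0,2),(1,2),(2,3),(1,3)] [2, 1, 0, 0] (map Suc [1,1,1,3,2])" by code_simp
  show "config_degrees [(0,3),(0,2),(1,2),(2,3),(1,3)] [2, 1, 0, 0] = [4, 3, 3, 3]" by code_simp
qed (use assms card_N_le in simp_all)

lemma no_K4_minus_triangle:
  assumes "distinct [a, b, u, v, c, w]" "{a, u} \<in> E" "{b, c} \<in> E" "{a, v} \<in> E" "{b, w} \<in> E" "{c, w} \<in> E" "{b, u} \<in> E" "{b, v} \<in> E" "{u, v} \<in> E"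
    and "card (N u) \<le> 3" "card (N v) \<le> 3" "card (N w) \<le> 2"
  shows False
proof (rule config_False[where vs = "[a, b, u, v, c, w]"])
  show "choosable [(0,2),(1,4),(0,3),(1,5),(4,5),(1,2),(1,3),(2,3)] (map Suc [1,0,1,3,1,3,3,3])" using choosable_K4_minus_triangle by simp
  show "config [(0,2),(1,4),(0,3),(1,5),(4,5),(1,2),(1,3),(2,3)] [2, 0, 0, 0, 2, 0] (map Suc [1,0,1,3,1,3,3,3])" by code_simp
  show "config_degrees [(0,2),(1,4),(0,3),(1,5),(4,5),(1,2),(1,3),(2,3)] [2, 0, 0, 0, 2, 0] = [4, 4, 3, 3, 4, 2]" by code_simp
qed (use assms card_N_le in simp_all)

lemma no_kite100:
  assumes "distinct [a, b, c, d, u]" "{b, d} \<in> E" "{a, b} \<in> E" "{a, c} \<in> E" "{c, d} \<in> E" "{b, c} \<in> E" "{b, u} \<in> E" "{a, u} \<in> E"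
    and "card (N c) \<le> 3" "card (N u) \<le> 2"
  shows False
proof (rule config_False[where vs = "[a, b, c, d, u]"])
  show "choosable [(1,3),(0,1),(0,2),(2,3),(1,2),(1,4),(0,4)] (map Suc [1,2,2,1,3,3,2])" using choosable_kite100 by simp
  show "config [(1,3),(0,1),(0,2),(2,3),(1,2),(1,4),(0,4)] [1, 0, 0, 2, 0] (map Suc [1,2,2,1,3,3,2])" by code_simp
  show "config_degrees [(1,3),(0,1),(0,2),(2,3),(1,2),(1,4),(0,4)] [1, 0, 0, 2, 0] = [4, 4, 3, 4, 2]" by code_simp
qed (use assms card_N_le in simp_all)

lemma no_kite110:
  assumes "distinct [a, b, c, d, u, v]" "{a, c} \<in> E" "{a, u} \<in> E" "{c, d} \<in> E" "{b, d} \<in> E" "{c, v} \<in> E" "{b, c} \<in> E" "{b, u} \<in> E" "{b, v} \<in> E"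
    and "card (N u) \<le> 2" "card (N v) \<le> 2"
  shows False
proof (rule config_False[where vs = "[a, b, c, d, u, v]"])
  show "choosable [(0,2),(0,4),(2,3),(1,3),(2,5),(1,2),(1,4),(1,5)] (map Suc [1,1,1,1,3,3,3,3])" using choosable_kite110 by simp
  show "config [(0,2),(0,4),(2,3),(1,3),(2,5),(1,2),(1,4),(1,5)] [2, 0, 0, 2, 0, 0] (map Suc [1,1,1,1,3,3,3,3])" by code_simp
  show "config_degrees [(0,2),(0,4),(2,3),(1,3),(2,5),(1,2),(1,4),(1,5)] [2, 0, 0, 2, 0, 0] = [4, 4, 4, 4, 2, 2]" by code_simp
qed (use assms card_N_le in simp_all)

lemma no_kite101:
  assumes "distinct [a, b, c, d, u, w]" "{a, u} \<in> E" "{a, b} \<in> E" "{b, d} \<in> E" "{a, c} \<in> E" "{b, u} \<in> E" "{b, c} \<in> E" "{c, d} \<in> E" "{d, w} \<in> E" "{c, w} \<in> E"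
    and "card (N u) \<le> 2" "card (N w) \<le> 2"
  shows False
proof (rule config_False[where vs = "[a, b, c, d, u, w]"])
  show "choosable [(0,4),(0,1),(1,3),(0,2),(1,4),(1,2),(2,3),(3,5),(2,5)] (map Suc [2,1,2,2,3,3,2,2,3])" using choosable_kite101 by simp
  show "config [(0,4),(0,1),(1,3),(0,2),(1,4),(1,2),(2,3),(3,5),(2,5)] [1, 0, 0, 1, 0, 0] (map Suc [2,1,2,2,3,3,2,2,3])" by code_simp
  show "config_degrees [(0,4),(0,1),(1,3),(0,2),(1,4),(1,2),(2,3),(3,5),(2,5)] [1, 0, 0, 1, 0, 0] = [4, 4, 4, 4, 2, 2]" by code_simp
qed (use assms card_N_le in simp_all)

lemma no_kite111a:
  assumes "distinct [a, b, c, d, u, v, w]" "{b, d} \<in> E" "{a, c} \<in> E" "{b, c} \<in> E" "{a, u} \<in> E" "{b, u} \<in> E" "{c, w} \<in> E" "{d, w} \<in> E" "{b, v} \<in> E" "{c, v} \<in> E"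
    and "card (N u) \<le> 2" "card (N v) \<le> 2" "card (N w) \<le> 2"
  shows False
proof (rule config_False[where vs = "[a, b, c, d, u, v, w]"])
  show "choosable [(1,3),(0,2),(1,2),(0,4),(1,4),(2,6),(3,6),(1,5),(2,5)] (map Suc [1,1,2,0,3,3,1,3,3])" using choosable_kite111a by simp
  show "config [(1,3),(0,2),(1,2),(0,4),(1,4),(2,6),(3,6),(1,5),(2,5)] [2, 0, 0, 2, 0, 0, 0] (map Suc [1,1,2,0,3,3,1,3,3])" by code_simp
  show "config_degrees [(1,3),(0,2),(1,2),(0,4),(1,4),(2,6),(3,6),(1,5),(2,5)] [2, 0, 0, 2, 0, 0, 0] = [4, 4, 4, 4, 2, 2, 2]" by code_simp
qed (use assms card_N_le in simp_all)

lemma no_kite111b: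
  assumes "distinct [a, b, c, d, u, v, w]" "{b, d} \<in> E" "{b, v} \<in> E" "{a, u} \<in> E" "{a, b} \<in> E" "{a, c} \<in> E" "{b, u} \<in> E" "{c, d} \<in> E" "{c, w} \<in> E" "{d, w} \<in> E" "{c, v} \<in> E"
    and "card (N u) \<le> 2" "card (N v) \<le> 2" "card (N w) \<le> 2"
  shows False
proof (rule config_False[where vs = "[a, b, c, d, u, v, w]"])
  show "choosable [(1,3),(1,5),(0,4),(0,1),(0,2),(1,4),(2,3),(2,6),(3,6),(2,5)] (map Suc [0,3,2,1,2,3,2,3,2,3])" using choosable_kite111b by simp
  show "config [(1,3),(1,5),(0,4),(0,1),(0,2),(1,4),(2,3),(2,6),(3,6),(2,5)] [1, 0, 0, 1, 0, 0, 0] (map Suc [0,3,2,1,2,3,2,3,2,3])" by code_simp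
  show "config_degrees [(1,3),(1,5),(0,4),(0,1),(0,2),(1,4),(2,3),(2,6),(3,6),(2,5)] [1, 0, 0, 1, 0, 0, 0] = [4, 4, 4, 4, 2, 2, 2]" by code_simp
qed (use assms card_N_le in simp_all)

lemma no_lump0:
  assumes "distinct [a, b, c, d, v]" "{a, d} \<in> E" "{a, b} \<in> E" "{a, c} \<in> E" "{b, d} \<in> E" "{c, d} \<in> E" "{b, c} \<in> E" "{b, v} \<in> E" "{c, v} \<in> E"
    and "card (N d) \<le> 3" "card (N v) \<le> 2"
  shows False
proof (rule config_False[where vs = "[a, b, c, d, v]"])
  show "choosable [(0,3),(0,1),(0,2),(1,3),(2,3),(1,2),(1,4),(2,4)] (map Suc [1,1,2,3,3,3,3,3])" using choosable_lump0 by simp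
  show "config [(0,3),(0,1),(0,2),(1,3),(2,3),(1,2),(1,4),(2,4)] [1, 0, 0, 0, 0] (map Suc [1,1,2,3,3,3,3,3])" by code_simp
  show "config_degrees [(0,3),(0,1),(0,2),(1,3),(2,3),(1,2),(1,4),(2,4)] [1, 0, 0, 0, 0] = [4, 4, 4, 3, 2]" by code_simp
qed (use assms card_N_le in simp_all)

lemma no_q3:
  assumes "distinct [a, b, c, d, v]" "{a, b} \<in> E" "{a, c} \<in> E" "{b, d} \<in> E" "{c, d} \<in> E" "{b, c} \<in> E" "{b, v} \<in> E" "{c, v} \<in> E"
    and "card (N a) \<le> 3" "card (N v) \<le> 2"
  shows False
proof (rule config_False[where vs = "[a, b, c, d, v]"])
  show "choosable [(0,1),(0,2),(1,3),(2,3),(1,2),(1,4),(2,4)] ([3,3,2,2,4,4,4])" using choosable_q3 by simp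
  show "config [(0,1),(0,2),(1,3),(2,3),(1,2),(1,4),(2,4)] [1, 0, 0, 2, 0] ([3,3,2,2,4,4,4])" by code_simp
  show "config_degrees [(0,1),(0,2),(1,3),(2,3),(1,2),(1,4),(2,4)] [1, 0, 0, 2, 0] = [3, 4, 4, 4, 2]" by code_simp
qed (use assms card_N_le in simp_all)

lemma no_q_triangle:
  assumes "distinct [a, b, c, d, v, w, x]" "{a, b} \<in> E" "{a, c} \<in> E" "{b, d} \<in> E" "{c, d} \<in> E" "{b, c} \<in> E" "{b, v} \<in> E" "{c, v} \<in> E" "{d, x} \<in> E" "{d, w} \<in> E" "{w, x} \<in> E"
    and "card (N v) \<le> 2" "card (N w) \<le> 2"
  shows False
proof (rule config_False[where vs = "[a, b, c, d, v, w, x]"])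
  show "choosable [(0,1),(0,2),(1,3),(2,3),(1,2),(1,4),(2,4),(3,6),(3,5),(5,6)] ([2,2,4,4,4,4,4,2,4,2])" using choosable_q_triangle by simp
  show "config [(0,1),(0,2),(1,3),(2,3),(1,2),(1,4),(2,4),(3,6),(3,5),(5,6)] [2, 0, 0, 0, 0, 0, 2] ([2,2,4,4,4,4,4,2,4,2])" by code_simp
  show "config_degrees [(0,1),(0,2),(1,3),(2,3),(1,2),(1,4),(2,4),(3,6),(3,5),(5,6)] [2, 0, 0, 0, 0, 0, 2] = [4, 4, 4, 4, 2, 2, 4]" by code_simp
qed (use assms card_N_le in simp_all)

lemma no_lump_pendant:
  assumes "distinct [a, b, c, d, v, x]" "{a, b} \<in> E" "{a, c} \<in> E" "{b, d} \<in> E" "{c, d} \<in> E" "{b, c} \<in> E" "{b, v} \<in> E" "{c, v} \<in> E" "{a, d} \<in> E" "{d, x} \<in> E"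
    and "card (N v) \<le> 2" "card (N x) \<le> 3"
  shows False
proof (rule config_False[where vs = "[a, b, c, d, v, x]"])
  show "choosable [(0,1),(0,2),(1,3),(2,3),(1,2),(1,4),(2,4),(0,3),(3,5)] ([3,3,4,4,4,4,4,3,2])" using choosable_lump_pendant by simp
  show "config [(0,1),(0,2),(1,3),(2,3),(1,2),(1,4),(2,4),(0,3),(3,5)] [1, 0, 0, 0, 0, 2] ([3,3,4,4,4,4,4,3,2])" by code_simp
  show "config_degrees [(0,1),(0,2),(1,3),(2,3),(1,2),(1,4),(2,4),(0,3),(3,5)] [1, 0, 0, 0, 0, 2] = [4, 4, 4, 4, 2, 3]" by code_simp
qed (use assms card_N_le in simp_all)

lemma no_lump_cap:
  assumes "distinct [a, b, c, d, v, x]" "{a, b} \<in> E" "{a, c} \<in> E" "{b, d} \<in> E" "{c, d} \<in> E" "{b, c} \<in> E" "{b, v} \<in> E" "{c, v} \<in> E" "{a, d} \<in> E" "{a, x} \<in> E" "{d, x} \<in> E"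
    and "card (N v) \<le> 2"
  shows False
proof (rule config_False[where vs = "[a, b, c, d, v, x]"])
  show "choosable [(0,1),(0,2),(1,3),(2,3),(1,2),(1,4),(2,4),(0,3),(0,5),(3,5)] ([4,4,4,4,4,4,4,4,2,2])" using choosable_lump_cap by simp
  show "config [(0,1),(0,2),(1,3),(2,3),(1,2),(1,4),(2,4),(0,3),(0,5),(3,5)] [0, 0, 0, 0, 0, 2] ([4,4,4,4,4,4,4,4,2,2])" by code_simp
  show "config_degrees [(0,1),(0,2),(1,3),(2,3),(1,2),(1,4),(2,4),(0,3),(0,5),(3,5)] [0, 0, 0, 0, 0, 2] = [4, 4, 4, 4, 2, 4]" by code_simp
qed (use assms card_N_le in simp_all)

lemma no_lump_bowtie:
  assumes "distinct [a, b, c, d, v, k, i, j, w]" "{a, b} \<in> E" "{a, c} \<in> E" "{b, d} \<in> E" "{c, d} \<in> E" "{b, c} \<in> E" "{b, v} \<in> E" "{c, v} \<in> E" "{a, d} \<in> E" "{d, k} \<in> E" "{a, i} \<in> E" "{k, i} \<in> E" "{k, w} \<in> E" "{k, j} \<in> E" "{j, w} \<in> E"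
    and "card (N v) \<le> 2" "card (N w) \<le> 2"
  shows False
proof (rule config_False[where vs = "[a, b, c, d, v, k, i, j, w]"])
  show "choosable [(0,1),(0,2),(1,3),(2,3),(1,2),(1,4),(2,4),(0,3),(3,5),(0,6),(5,6),(5,8),(5,7),(7,8)] ([4,4,4,4,4,4,4,4,4,2,2,4,2,2])" using choosable_lump_bowtie by simp
  show "config [(0,1),(0,2),(1,3),(2,3),(1,2),(1,4),(2,4),(0,3),(3,5),(0,6),(5,6),(5,8),(5,7),(7,8)] [0, 0, 0, 0, 0, 0, 2, 2, 0] ([4,4,4,4,4,4,4,4,4,2,2,4,2,2])" by code_simp
  show "config_degrees [(0,1),(0,2),(1,3),(2,3),(1,2),(1,4),(2,4),(0,3),(3,5),(0,6),(5,6),(5,8),(5,7),(7,8)] [0, 0, 0, 0, 0, 0, 2, 2, 0] = [4, 4, 4, 4, 2, 4, 4, 4, 2]" by code_simp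
qed (use assms card_N_le in simp_all)

text \<open>
  A piece with the ends \<open>i\<close>, \<open>j\<close> is attached to the rest of the graph only at these two vertices.
\<close>

definition piece :: "'a set \<Rightarrow> 'a \<Rightarrow> 'a \<Rightarrow> bool" where
  "piece B i j \<longleftrightarrow> i \<noteq> j \<and> i \<notin> B \<and> j \<notin> B \<and> (\<forall>x\<in>B. N x \<subseteq> B \<union> {i, j})"

text \<open>Degree 4 at the ends is recorded here and in the next two definitions because later
  arguments count the neighbours of an end. It comes for free: an end of smaller degree makes the
  piece reducible.\<close>

definition ear :: "'a set \<Rightarrow> 'a \<Rightarrow> 'a \<Rightarrow> bool" where
  "ear B i j \<longleftrightarrow> (\<exists>k. B = {k} \<and> N k = {i, j} \<and> card (N i) = 4 \<and> card (N j) = 4)"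

text \<open>The non-edge \<open>ij\<close> belongs to the shape because the edge would complete a
  reducible K4, see \<open>no_K4\<close>.\<close>

definition kite :: "'a set \<Rightarrow> 'a \<Rightarrow> 'a \<Rightarrow> bool" where
  "kite B i j \<longleftrightarrow> (\<exists>b c. B = {b, c} \<and> N b = {i, c, j} \<and> N c = {i, b, j} \<and>
     card (N i) = 4 \<and> card (N j) = 4 \<and> {i, j} \<notin> E \<and> X {i, c} {b, j})"

text \<open>The graph of \<open>qcol\<close> with \<open>i\<close> and \<open>j\<close> in the roles
  of \<open>a\<close> and \<open>d\<close>; the edge \<open>ij\<close> decides between
  \<open>open_cap\<close> and \<open>lump\<close>.\<close>

definition capped :: "'a set \<Rightarrow> 'a \<Rightarrow> 'a \<Rightarrow> 'a \<Rightarrow> 'a \<Rightarrow> 'a \<Rightarrow> bool" where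
  "capped B i j b v c \<longleftrightarrow> B = {b, v, c} \<and> N b = {i, v, c, j} \<and> N c = {i, b, v, j} \<and> N v = {b, c} \<and>
     card (N i) = 4 \<and> card (N j) = 4 \<and> X {i, c} {b, j}"

definition open_cap :: "'a set \<Rightarrow> 'a \<Rightarrow> 'a \<Rightarrow> bool" where
  "open_cap B i j \<longleftrightarrow> {i, j} \<notin> E \<and> (\<exists>b v c. capped B i j b v c)"

definition lump :: "'a set \<Rightarrow> 'a \<Rightarrow> 'a \<Rightarrow> bool" where
  "lump B i j \<longleftrightarrow> {i, j} \<in> E \<and> (\<exists>b v c. capped B i j b v c)"

text \<open>A lump occupies three of the four edges at each of its ends, so it can only be continued
  by a single edge there. \<open>tailed\<close> does this on one side and \<open>fat_ear\<close> on
  both.\<close>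

definition tailed :: "'a set \<Rightarrow> 'a \<Rightarrow> 'a \<Rightarrow> bool" where
  "tailed B i j \<longleftrightarrow> (\<exists>d B'. B = insert d B' \<and> d \<notin> B' \<and> lump B' i d \<and> {d, j} \<in> E)"

definition fat_ear :: "'a set \<Rightarrow> 'a \<Rightarrow> 'a \<Rightarrow> bool" where
  "fat_ear B i j \<longleftrightarrow> (\<exists>a d B'. B = insert a (insert d B') \<and> a \<notin> B' \<and> d \<notin> B' \<and> a \<noteq> d \<and> lump B' a d \<and>
     {i, a} \<in> E \<and> {d, j} \<in> E)"

definition typed :: "'a set \<Rightarrow> 'a \<Rightarrow> 'a \<Rightarrow> bool" where
  "typed B i j \<longleftrightarrow> B = {} \<or> ear B i j \<or> kite B i j \<or> open_cap B i j \<or> lump B i j \<or>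
     tailed B i j \<or> tailed B j i \<or> fat_ear B i j"

lemma piece_sym: "piece B i j \<Longrightarrow> piece B j i"
  unfolding piece_def by (auto simp: insert_commute)

lemma ear_sym: "ear B i j \<Longrightarrow> ear B j i"
  unfolding ear_def by (auto simp: insert_commute)

lemma kite_sym:
  assumes "kite B i j"
  shows "kite B j i"
proof -
  obtain b c where "B = {b, c}" "N b = {i, c, j}" "N c = {i, b, j}" "card (N i) = 4" "card (N j) = 4"
      "{i, j} \<notin> E" "X {i, c} {b, j}"
    using assms unfolding kite_def by blast
  then show ?thesis unfolding kite_def using X_sym[of "{i, c}" "{b, j}"]
    by (intro exI[of _ c] exI[of _ b]) (simp add: insert_commute)
qed

lemma capped_sym: "capped B i j b v c \<Longrightarrow> capped B j i c v b"
  unfolding capped_def using X_sym[of "{i, c}" "{b, j}"] by (simp add: insert_commute)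

lemma open_cap_sym: "open_cap B i j \<Longrightarrow> open_cap B j i"
  unfolding open_cap_def using capped_sym by (metis insert_commute)

lemma lump_sym: "lump B i j \<Longrightarrow> lump B j i"
  unfolding lump_def using capped_sym by (metis insert_commute)

lemma fat_ear_sym:
  assumes "fat_ear B i j"
  shows "fat_ear B j i"
proof -
  obtain a d B' where *: "B = insert a (insert d B')" "a \<notin> B'" "d \<notin> B'" "a \<noteq> d" "lump B' a d"
     "{i, a} \<in> E" "{d, j} \<in> E" using assms unfolding fat_ear_def by blast
  show ?thesis unfolding fat_ear_def
    by (rule exI[of _ d], rule exI[of _ a], rule exI[of _ B'])
      (use * lump_sym in \<open>simp add: insert_commute\<close>)
qed

lemma typed_sym: "typed B i j \<Longrightarrow> typed B j i"
  unfolding typed_def using ear_sym kite_sym open_cap_sym lump_sym fat_ear_sym by blast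

lemma capped_facts:
  assumes "capped B i j b v c" "i \<noteq> j" "i \<notin> B" "j \<notin> B"
  shows "distinct [i, b, c, j, v]"
    "{i, b} \<in> E" "{i, c} \<in> E" "{b, j} \<in> E" "{c, j} \<in> E" "{b, c} \<in> E" "{b, v} \<in> E" "{c, v} \<in> E"
    "card (N v) \<le> 2" "card (N i) = 4" "card (N j) = 4" "b \<in> N i" "c \<in> N i" "b \<in> N j" "c \<in> N j" "v \<notin> N i" "v \<notin> N j"
    "N i \<inter> B = {b, c}" "N j \<inter> B = {b, c}"
proof -
  have c: "B = {b, v, c}" "N b = {i, v, c, j}" "N c = {i, b, v, j}" "N v = {b, c}"
    "card (N i) = 4" "card (N j) = 4" using assms unfolding capped_def by auto
  have "b \<noteq> v" "b \<noteq> c" "c \<noteq> v" using c not_self_N by blast+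
  then show "distinct [i, b, c, j, v]" using c assms by auto
  show "{i, b} \<in> E" "{i, c} \<in> E" "{b, j} \<in> E" "{c, j} \<in> E" "{b, c} \<in> E" "{b, v} \<in> E" "{c, v} \<in> E"
    using c unfolding edge_N by (auto simp: N_sym[of _ i])
  show "card (N v) \<le> 2" unfolding c(4) by (simp add: card_insert_if)
  show "card (N i) = 4" "card (N j) = 4" using c by auto
  show "b \<in> N i" "c \<in> N i" "b \<in> N j" "c \<in> N j" using c N_sym by blast+
  show "v \<notin> N i" "v \<notin> N j" using c(4) N_sym assms(3,4) c(1) by blast+
  then show "N i \<inter> B = {b, c}" "N j \<inter> B = {b, c}" using c(1) \<open>b \<in> N i\<close> \<open>c \<in> N i\<close> \<open>b \<in> N j\<close> \<open>c \<in> N j\<close> by auto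
qed

lemma card_4_cover:
  assumes "card A = 4" "A \<subseteq> {a, b, c, d}"
  shows "A = {a, b, c, d}"
proof (rule card_seteq)
  show "card {a, b, c, d} \<le> card A" using assms(1) by (simp add: card_insert_if)
qed (use assms in simp_all)

lemma card_4_not_3: "card A = 4 \<Longrightarrow> \<not> A \<subseteq> {a, b, c}"
  using card_mono[of "{a, b, c}" A] by (auto simp: card_insert_if split: if_splits)

text \<open>Degree 4 leaves each end of a lump exactly one neighbour outside. A common outer
  neighbour is excluded by \<open>no_lump_cap\<close>, and one of degree at most 3 by
  \<open>no_lump_pendant\<close>.\<close>

lemma lump_outer:
  assumes l: "capped B i j b v c" "{i, j} \<in> E" and p: "i \<noteq> j" "i \<notin> B" "j \<notin> B"
  obtains t y where "N i = {b, c, j, t}" "N j = {b, c, i, y}" "t \<notin> B \<union> {i, j}" "y \<notin> B \<union> {i, j}" "t \<noteq> y"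
    "card (N t) = 4" "card (N y) = 4"
proof -
  note f = capped_facts[OF l(1) p] and f' = capped_facts[OF capped_sym[OF l(1)] p(1)[symmetric] p(3,2)]
  have B: "B = {b, v, c}" using l unfolding capped_def by auto
  have ex: "\<exists>t. N i = {b, c, j, t} \<and> t \<notin> B \<union> {i, j}" if "card (N i) = 4" "b \<in> N i" "c \<in> N i" "j \<in> N i" "v \<notin> N i"
    "distinct [i, b, c, j, v]" for i j
  proof -
    have "card (N i - {b, c, j}) = 1" using that finite_N by (simp add: card_Diff_subset)
    then obtain t where t: "N i - {b, c, j} = {t}" by (auto simp: card_1_singleton_iff)
    then have "N i = {b, c, j, t}" using that by blast
    moreover have "t \<notin> B \<union> {i, j}" using t that B not_self_N by blast
    ultimately show ?thesis by blast
  qed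
  have ij: "j \<in> N i" "i \<in> N j" using l(2) edge_N N_sym by blast+
  obtain t where t: "N i = {b, c, j, t}" "t \<notin> B \<union> {i, j}" using ex[of i j] f ij by blast
  obtain y where y: "N j = {b, c, i, y}" "y \<notin> B \<union> {i, j}" using ex[of j i] f ij by auto
  have tE: "{i, t} \<in> E" "{j, y} \<in> E" using t y edge_N by auto
  have "t \<noteq> y"
  proof
    assume "t = y"
    then show False using no_lump_cap[of i b c j v y] f l(2) t y B tE by auto
  qed
  moreover have "card (N y) = 4"
  proof (rule ccontr)
    assume "card (N y) \<noteq> 4"
    then have "card (N y) \<le> 3" using card_N_le[of y] by simp
    then show False using no_lump_pendant[of i b c j v y] f l(2) y B tE by auto
  qed
  moreover have "card (N t) = 4"
  proof (rule ccontr)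
    assume "card (N t) \<noteq> 4"
    then have "card (N t) \<le> 3" using card_N_le[of t] by simp
    then show False using no_lump_pendant[of j c b i v t] f' l(2) t B tE by (auto simp: insert_commute)
  qed
  ultimately show ?thesis using that t y by blast
qed

text \<open>A crossing of the piece at distance at most 1 from \<open>p\<close>. Two of them reached
  through the same \<open>p\<close> are within distance 2, the range of
  \<open>X_far\<close>.\<close>

definition near :: "'a set \<Rightarrow> 'a \<Rightarrow> 'a \<Rightarrow> 'a \<Rightarrow> bool" where
  "near B i j p \<longleftrightarrow> (\<exists>e f x. e \<in> E \<and> f \<in> E \<and> X e f \<and> e \<union> f \<subseteq> B \<union> {i, j} \<and> x \<in> e \<union> f \<and> (x = p \<or> {x, p} \<in> E))"

lemma near_capped:
  assumes "capped B i j b v c" "i \<noteq> j" "i \<notin> B" "j \<notin> B" "x = i \<or> x = j" "x = p \<or> {x, p} \<in> E" "B \<union> {i, j} \<subseteq> B' \<union> {i', j'}"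
  shows "near B' i' j' p"
  unfolding near_def
proof (intro exI conjI)
  note f = capped_facts[OF assms(1-4)]
  show "{i, c} \<in> E" "{b, j} \<in> E" using f by auto
  show "X {i, c} {b, j}" using assms unfolding capped_def by blast
  show "{i, c} \<union> {b, j} \<subseteq> B' \<union> {i', j'}" using assms(1,7) unfolding capped_def by blast
  show "x \<in> {i, c} \<union> {b, j}" using assms by auto
  show "x = p \<or> {x, p} \<in> E" by fact
qed

text \<open>In a kite and in a capped crossing both ends belong to the crossing edges. A tail puts
  one edge in between, which \<open>near\<close> still tolerates.\<close>

lemma typed_near:
  assumes "typed B i j" "piece B i j"
  shows "B = {} \<or> ear B i j \<or> near B i j i \<and> near B i j j"
proof -
  have p: "i \<noteq> j" "i \<notin> B" "j \<notin> B" using assms unfolding piece_def by auto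
  have 1: "near B i j i \<and> near B i j j" if k: "kite B i j"
  proof -
    obtain b c where *: "B = {b, c}" "N b = {i, c, j}" "N c = {i, b, j}" "X {i, c} {b, j}"
      using k unfolding kite_def by blast
    then have "{i, c} \<in> E" "{b, j} \<in> E" unfolding edge_N by (auto simp: N_sym[of _ i])
    then show ?thesis unfolding near_def using * by (intro conjI exI[of _ "{i, c}"] exI[of _ "{b, j}"]) auto
  qed
  have 2: "near B i j i \<and> near B i j j" if "capped B i j b v c" for b v c
    using near_capped[OF that p] by blast
  have 3: "near B i j i \<and> near B i j j" if k: "tailed B i j" "piece B i j" for i j
  proof -
    obtain d B' b v c where *: "B = insert d B'" "d \<notin> B'" "capped B' i d b v c" "{d, j} \<in> E"
      using k(1) unfolding tailed_def lump_def by blast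
    have **: "i \<noteq> d" "i \<notin> B'" using k(2) * unfolding piece_def by auto
    show ?thesis
      using near_capped[OF *(3) ** *(2), of i i B i j] near_capped[OF *(3) ** *(2), of d j B i j] * by auto
  qed
  have 4: "near B i j i \<and> near B i j j" if k: "fat_ear B i j"
  proof -
    obtain a d B' b v c where *: "B = insert a (insert d B')" "a \<notin> B'" "d \<notin> B'" "a \<noteq> d" "capped B' a d b v c"
        "{i, a} \<in> E" "{d, j} \<in> E"
      using k unfolding fat_ear_def lump_def by blast
    have "{a, i} \<in> E" using *(6) by (simp add: insert_commute)
    then show ?thesis
      using near_capped[OF *(5,4,2,3), of a i B i j] near_capped[OF *(5,4,2,3), of d j B i j] * by auto
  qed
  have 5: "near B i j i \<and> near B i j j" if "tailed B j i"
    using 3[OF that piece_sym[OF assms(2)]] unfolding near_def by (simp add: insert_commute)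
  show ?thesis using assms(1) 1 2 3[OF _ assms(2)] 4 5 unfolding typed_def open_cap_def lump_def by blast
qed

text \<open>By \<open>X_far\<close> the two crossings are the same pair of edges, but then an edge
  with its two vertices would lie in both pieces, which share at most one.\<close>

lemma near_far:
  assumes "near B i j p" "near B' i' j' p" "(B \<union> {i, j}) \<inter> (B' \<union> {i', j'}) \<subseteq> {q}"
  shows False
proof -
  obtain e f x where 1: "e \<in> E" "f \<in> E" "X e f" "e \<union> f \<subseteq> B \<union> {i, j}" "x \<in> e \<union> f" "x = p \<or> {x, p} \<in> E"
    using assms(1) unfolding near_def by blast
  obtain e' f' y where 2: "e' \<in> E" "f' \<in> E" "X e' f'" "e' \<union> f' \<subseteq> B' \<union> {i', j'}" "y \<in> e' \<union> f'" "y = p \<or> {y, p} \<in> E"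
    using assms(2) unfolding near_def by blast
  have "x = y \<or> {x, y} \<in> E \<or> (\<exists>z. {x, z} \<in> E \<and> {z, y} \<in> E)"
    using 1(6) 2(6) by (metis insert_commute)
  then have "{e, f} = {e', f'}" by (rule X_far[OF 1(1-3) 2(1-3) 1(5) 2(5)])
  then have "e \<in> {e', f'}" by auto
  then have sub: "e \<subseteq> (B \<union> {i, j}) \<inter> (B' \<union> {i', j'})" using 1(4) 2(4) by auto
  obtain u w where uw: "e = {u, w}" "u \<noteq> w" using card_edge[OF 1(1)] by (auto simp: card_2_iff)
  show False using sub assms(3) uw by blast
qed

end

context critical
begin


section \<open>Two pieces with a common end\<close>

text \<open>The ear forces degree 4 at \<open>k\<close>, whose neighbours are confined to the two
  pieces and the two far ends. Depending on the other piece, too few candidates remain, or the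
  neighbourhood is determined and a reducible configuration appears.\<close>

lemma combine_ear:
  assumes p1: "piece B i k" and t: "typed B i k"
    and e: "ear C k j" "j \<noteq> i" "j \<notin> B" "C \<inter> (B \<union> {i}) = {}" "k \<noteq> j"
    and Nk: "N k \<subseteq> B \<union> C \<union> {i, j}"
  shows False
proof -
  have p: "i \<noteq> k" "i \<notin> B" "k \<notin> B" using p1 unfolding piece_def by auto
  obtain m where m: "C = {m}" "N m = {k, j}" "card (N k) = 4" "card (N j) = 4" using e(1) unfolding ear_def by blast
  have mE: "{k, m} \<in> E" "{j, m} \<in> E" "{m, j} \<in> E" "{m, k} \<in> E" "m \<in> N k" using m(2) N_sym unfolding edge_N by blast+
  have cm: "card (N m) \<le> 2" unfolding m(2) by (simp add: card_insert_if)
  have md: "m \<noteq> i" "m \<notin> B" "m \<noteq> j" "m \<noteq> k" using e(4) m(1,2) not_self_N[of m] by auto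
  have tail: "card (N t) = 4 \<Longrightarrow> t \<noteq> m" for t using cm by auto
  have cap_edge: "{x, y} \<in> E \<Longrightarrow> {y, x} \<in> E" for x y by (simp add: insert_commute)
  consider "B = {}" | "ear B i k" | "kite B i k" | "open_cap B i k" | "lump B i k" | "tailed B i k" | "tailed B k i"
    | "fat_ear B i k" using t unfolding typed_def by blast
  then show False
  proof cases
    case 1
    then show False using Nk m card_4_not_3[OF m(3), of m i j] by auto
  next
    case 2
    then obtain w where w: "B = {w}" "N w = {i, k}" unfolding ear_def by blast
    have "N k = {w, m, i, j}" by (rule card_4_cover[OF m(3)]) (use Nk w m in auto)
    then have "{k, j} \<in> E" "{k, i} \<in> E" "{k, w} \<in> E" "{i, w} \<in> E"
      using w(2) unfolding edge_N by (auto simp: N_sym[of w i])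
    moreover have "card (N w) \<le> 2" unfolding w(2) by (simp add: card_insert_if)
    ultimately show False using no_bowtie[of k i j w m] mE cm md p e w by auto
  next
    case 3
    then obtain b c where bc: "B = {b, c}" "N b = {i, c, k}" "N c = {i, b, k}" "{i, k} \<notin> E" unfolding kite_def by blast
    have "i \<notin> N k" using bc(4) edge_N N_sym by blast
    then have "N k = {b, c, m, j}" by (intro card_4_cover[OF m(3)]) (use Nk bc(1) m(1) in auto)
    then have "{k, j} \<in> E" "{k, b} \<in> E" "{k, c} \<in> E" unfolding edge_N by auto
    moreover have "{i, b} \<in> E" "{i, c} \<in> E" "{b, c} \<in> E" using bc unfolding edge_N by (auto simp: N_sym[of _ i])
    moreover have "card (N b) \<le> 3" "card (N c) \<le> 3" unfolding bc(2,3) by (simp_all add: card_insert_if)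
    moreover have "b \<noteq> c" using bc(2) not_self_N[of b] by auto
    ultimately show False using no_K4_minus_triangle[of i k b c j m] mE cm md p e bc by auto
  next
    case 4
    then obtain b v c where c: "capped B i k b v c" "{i, k} \<notin> E" unfolding open_cap_def by blast
    note f = capped_facts[OF c(1) p]
    have "i \<notin> N k" using c(2) edge_N N_sym by blast
    then have "N k \<subseteq> {b, c, m, j}" using Nk f(19) m(1) by blast
    then have "N k = {b, c, m, j}" by (rule card_4_cover[OF m(3)])
    then have "{k, j} \<in> E" unfolding edge_N by auto
    moreover have "B = {b, v, c}" using c unfolding capped_def by auto
    ultimately show False using no_q_triangle[of i b c k v m j] mE cm md p e f by auto
  next
    case 5
    then obtain b v c where c: "capped B i k b v c" "{i, k} \<in> E" unfolding lump_def by blast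
    have B: "B = {b, v, c}" using c unfolding capped_def by auto
    \<comment> \<open>The one neighbour of \<open>k\<close> outside the lump has degree 4, but the
      ear vertex \<open>m\<close> of degree 2 is such a neighbour.\<close>
    from c p show False
    proof (rule lump_outer)
      fix t y assume "N k = {b, c, i, y}" "card (N y) = 4"
      then show False using tail mE(5) md B by auto
    qed
  next
    case 6
    then obtain d B' b v c where c: "B = insert d B'" "d \<notin> B'" "capped B' i d b v c" "{i, d} \<in> E" "{d, k} \<in> E"
      unfolding tailed_def lump_def by blast
    have B: "B' = {b, v, c}" "N b = {i, v, c, d}" "N c = {i, b, v, d}" "N v = {b, c}" using c unfolding capped_def by auto
    have id: "i \<noteq> d" "i \<notin> B'" using p c by auto
    from c(3,4) id c(2) show False
    proof (rule lump_outer)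
      fix t y assume t: "N i = {b, c, d, t}" "N d = {b, c, i, y}" "t \<noteq> y"
      \<comment> \<open>Both lump ends are saturated: the outer neighbour of \<open>d\<close> is
        \<open>k\<close>, and that of \<open>i\<close> is a different vertex. So \<open>d\<close> is
        the only neighbour of \<open>k\<close> inside \<open>B\<close>, and \<open>i\<close> is
        none.\<close>
      have "k \<in> N d" using c(5) edge_N by blast
      then have "y = k" using t p c B by auto
      then have "k \<notin> N i" "k \<notin> N b" "k \<notin> N c" "k \<notin> N v" using t p c B by auto
      then have "N k \<subseteq> {d, m, j}" using Nk N_sym c(1) B m(1) by blast
      then show False using card_4_not_3[OF m(3)] by blast
    qed
  next
    case 7
    then obtain d B' b v c where c: "B = insert d B'" "d \<notin> B'" "capped B' k d b v c" "{k, d} \<in> E"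
      unfolding tailed_def lump_def by blast
    have B: "B' = {b, v, c}" using c unfolding capped_def by auto
    have kd: "k \<noteq> d" "k \<notin> B'" using p c by auto
    from c(3,4) kd c(2) show False
    proof (rule lump_outer)
      fix t y assume t: "N k = {b, c, d, t}" "card (N t) = 4"
      then show False using tail mE(5) md B c(1) by auto
    qed
  next
    case 8
    then obtain a d B' b v c where c: "B = insert a (insert d B')" "a \<notin> B'" "d \<notin> B'" "a \<noteq> d" "capped B' a d b v c"
       "{a, d} \<in> E" "{i, a} \<in> E" "{d, k} \<in> E"
      unfolding fat_ear_def lump_def by blast
    have B: "B' = {b, v, c}" "N b = {a, v, c, d}" "N c = {a, b, v, d}" "N v = {b, c}" using c(5) unfolding capped_def by auto
    note f = capped_facts[OF c(5,4,2,3)]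
    from c(5,6,4,2,3) show False
    proof (rule lump_outer)
      fix t y assume t: "N a = {b, c, d, t}" "N d = {b, c, a, y}" "t \<noteq> y"
      have ia: "i \<in> N a" "k \<in> N d" using c(7,8) edge_N N_sym by blast+
      have ne: "i \<noteq> b" "i \<noteq> c" "i \<noteq> d" "k \<noteq> b" "k \<noteq> c" "k \<noteq> a" "k \<noteq> d" "k \<noteq> v" using p c(1) B(1) by auto
      have "t = i" using t(1) ia(1) ne by simp
      moreover have "y = k" using t(2) ia(2) ne by simp
      ultimately have "k \<notin> N a" "k \<notin> N b" "k \<notin> N c" "k \<notin> N v" using t ne p(1) B by auto
      then have "N k \<subseteq> {d, i, m, j}" using Nk N_sym c(1) B(1) m(1) by blast
      \<comment> \<open>With the lump contracted, \<open>k\<close> is the centre of a bowtie: one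
        triangle goes through \<open>i\<close> and the lump, the other through \<open>j\<close> and
        \<open>m\<close>.\<close>
      then have "N k = {d, i, m, j}" by (rule card_4_cover[OF m(3)])
      then have "{k, j} \<in> E" "{k, i} \<in> E" unfolding edge_N by auto
      then show False
        using no_lump_bowtie[of a b c d v k i j m] mE cm md p e f c B cap_edge[OF c(7)] by auto
    qed
  qed
qed

text \<open>With nothing beyond \<open>k\<close>, the piece grows by the vertex \<open>k\<close>
  alone: the empty piece becomes an ear, a lump becomes tailed, and a tailed piece with
  \<open>k\<close> at its lump becomes a fat ear. In all other shapes \<open>k\<close> has degree 4,
  by definition or by \<open>lump_outer\<close>, but fewer than four possible neighbours.\<close>

lemma combine_empty:
  assumes p1: "piece B i k" and t: "typed B i k" and e: "j \<noteq> i" "j \<notin> B" "k \<noteq> j"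
    and Nk: "N k \<subseteq> B \<union> {i, j}" "N k \<noteq> {}"
  shows "typed (insert k B) i j"
proof -
  have p: "i \<noteq> k" "i \<notin> B" "k \<notin> B" using p1 unfolding piece_def by auto
  consider "B = {}" | "ear B i k" | "kite B i k" | "open_cap B i k" | "lump B i k" | "tailed B i k" | "tailed B k i"
    | "fat_ear B i k" using t unfolding typed_def by blast
  then show ?thesis
  proof cases
    case 1
    then have N: "N k \<subseteq> {i, j}" using Nk by auto
    obtain w where "{k, w} \<in> E" using Nk(2) unfolding N_def by blast
    then have "2 \<le> card (N k)" by (rule card_N_ge_2)
    then have N: "N k = {i, j}" using N e(1) by (intro card_seteq) (auto simp: card_insert_if)
    then have "{k, i} \<in> E" "{k, j} \<in> E" "card (N k) = 2" using e(1) unfolding edge_N by auto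
    then have "card (N i) = 4" "card (N j) = 4"
      using edge_degree_sum[of k i] edge_degree_sum[of k j] card_N_le[of i] card_N_le[of j] by auto
    then show ?thesis using 1 N unfolding typed_def ear_def by blast
  next
    case 2
    then obtain w where w: "B = {w}" "card (N k) = 4" unfolding ear_def by blast
    then show ?thesis using Nk card_4_not_3[OF w(2), of w i j] by auto
  next
    case 3
    then obtain b c where bc: "B = {b, c}" "card (N k) = 4" "{i, k} \<notin> E" unfolding kite_def by blast
    have "i \<notin> N k" using bc(3) edge_N N_sym by blast
    then show ?thesis using Nk bc(1) card_4_not_3[OF bc(2), of b c j] by auto
  next
    case 4
    then obtain b v c where c: "capped B i k b v c" "{i, k} \<notin> E" unfolding open_cap_def by blast
    note f = capped_facts[OF c(1) p]
    have "i \<notin> N k" using c(2) edge_N N_sym by blast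
    then have "N k \<subseteq> {b, c, j}" using Nk f(19) by blast
    then show ?thesis using card_4_not_3[OF f(11)] by blast
  next
    case 5
    then obtain b v c where c: "capped B i k b v c" "{i, k} \<in> E" unfolding lump_def by blast
    have "j \<in> N k"
      using c p
    proof (rule lump_outer)
      fix t y assume y: "N k = {b, c, i, y}" "y \<notin> B \<union> {i, k}"
      then have "y = j" using Nk by auto
      then show ?thesis using y by auto
    qed
    then have "tailed (insert k B) i j" unfolding tailed_def using 5 p edge_N by blast
    then show ?thesis unfolding typed_def by blast
  next
    case 6
    then obtain d B' b v c where c: "B = insert d B'" "d \<notin> B'" "capped B' i d b v c" "{i, d} \<in> E" "{d, k} \<in> E"
      unfolding tailed_def lump_def by blast
    have B: "B' = {b, v, c}" "N b = {i, v, c, d}" "N c = {i, b, v, d}" "N v = {b, c}" using c unfolding capped_def by auto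
    have id: "i \<noteq> d" "i \<notin> B'" using p c by auto
    from c(3,4) id c(2) show ?thesis
    proof (rule lump_outer)
      fix t y assume t: "N i = {b, c, d, t}" "N d = {b, c, i, y}" "t \<noteq> y" "card (N y) = 4"
      have "k \<in> N d" using c(5) edge_N by blast
      then have y: "y = k" using t p c B by auto
      then have "k \<notin> N i" "k \<notin> N b" "k \<notin> N c" "k \<notin> N v" using t p c B by auto
      then have "N k \<subseteq> {d, j, j}" using Nk(1) N_sym c(1) B by blast
      then show ?thesis using card_4_not_3[OF t(4)] y by blast
    qed
  next
    case 7
    then obtain d B' b v c where c: "B = insert d B'" "d \<notin> B'" "capped B' k d b v c" "{k, d} \<in> E" "{d, i} \<in> E"
      unfolding tailed_def lump_def by blast
    have B: "B' = {b, v, c}" using c unfolding capped_def by auto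
    have kd: "k \<noteq> d" "k \<notin> B'" using p c by auto
    have "j \<in> N k"
      using c(3,4) kd c(2)
    proof (rule lump_outer)
      fix t y assume t: "N k = {b, c, d, t}" "N d = {b, c, k, y}" "t \<notin> B' \<union> {k, d}" "t \<noteq> y"
      have "i \<in> N d" using c(5) edge_N by blast
      then have "y = i" using t p c B by auto
      then have "t = j" using Nk t c(1) by auto
      then show ?thesis using t by auto
    qed
    moreover have "lump B' d k" using c(3,4) lump_sym unfolding lump_def by blast
    moreover have "{i, d} \<in> E" using c(5) by (simp add: insert_commute)
    ultimately have "fat_ear (insert k B) i j"
      unfolding fat_ear_def using c kd edge_N
      by - (rule exI[of _ d], rule exI[of _ k], rule exI[of _ B'], auto)
    then show ?thesis unfolding typed_def by blast
  next
    case 8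
    then obtain a d B' b v c where c: "B = insert a (insert d B')" "a \<notin> B'" "d \<notin> B'" "a \<noteq> d" "capped B' a d b v c"
       "{a, d} \<in> E" "{i, a} \<in> E" "{d, k} \<in> E"
      unfolding fat_ear_def lump_def by blast
    have B: "B' = {b, v, c}" "N b = {a, v, c, d}" "N c = {a, b, v, d}" "N v = {b, c}" using c(5) unfolding capped_def by auto
    from c(5,6,4,2,3) show ?thesis
    proof (rule lump_outer)
      fix t y assume t: "N a = {b, c, d, t}" "N d = {b, c, a, y}" "t \<noteq> y" "card (N y) = 4"
      have ia: "i \<in> N a" "k \<in> N d" using c(7,8) edge_N N_sym by blast+
      have ne: "i \<noteq> b" "i \<noteq> c" "i \<noteq> d" "k \<noteq> b" "k \<noteq> c" "k \<noteq> a" "k \<noteq> d" "k \<noteq> v" using p c(1) B(1) by auto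
      have "t = i" using t(1) ia(1) ne by simp
      moreover have y: "y = k" using t(2) ia(2) ne by simp
      ultimately have "k \<notin> N a" "k \<notin> N b" "k \<notin> N c" "k \<notin> N v" using t ne p(1) B by auto
      then have "N k \<subseteq> {d, i, j}" using Nk(1) N_sym c(1) B(1) by blast
      then show ?thesis using card_4_not_3[OF t(4)] y by blast
    qed
  qed
qed

lemma combine:
  assumes p1: "piece B i k" "piece C k j" and t: "typed B i k" "typed C k j"
    and d: "i \<noteq> j" "(B \<union> {i}) \<inter> (C \<union> {j}) = {}"
    and Nk: "N k \<subseteq> B \<union> C \<union> {i, j}" "N k \<noteq> {}"
  shows "typed (insert k (B \<union> C)) i j"
proof -
  have kj: "k \<noteq> j" "k \<noteq> i" using p1 unfolding piece_def by auto
  consider "B = {}" | "C = {}" | "ear B i k" | "ear C k j" | "near B i k k" "near C k j k"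
    using typed_near[OF t(1) p1(1)] typed_near[OF t(2) p1(2)] by blast
  then show ?thesis
  proof cases
    case 1
    have "typed (insert k C) j i"
      by (rule combine_empty[OF piece_sym[OF p1(2)] typed_sym[OF t(2)]]) (use d kj Nk 1 in auto)
    then show ?thesis using typed_sym 1 by simp
  next
    case 2
    have "typed (insert k B) i j"
      by (rule combine_empty[OF p1(1) t(1)]) (use d kj Nk 2 in auto)
    then show ?thesis using 2 by simp
  next
    case 3
    have False by (rule combine_ear[OF piece_sym[OF p1(2)] typed_sym[OF t(2)] ear_sym[OF 3]]) (use d kj Nk in auto)
    then show ?thesis ..
  next
    case 4
    have False by (rule combine_ear[OF p1(1) t(1) 4]) (use d kj Nk in auto)
    then show ?thesis ..
  next
    case 5
    have "(B \<union> {i, k}) \<inter> (C \<union> {k, j}) \<subseteq> {k}" using d p1 unfolding piece_def by auto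
    then show ?thesis using near_far[OF 5] by blast
  qed
qed

section \<open>The three pieces between the ends of two crossing edges\<close>

lemma N_edges: "N b = S \<Longrightarrow> x \<in> S \<Longrightarrow> {b, x} \<in> E \<and> {x, b} \<in> E"
  unfolding N_def by (auto simp: insert_commute)

text \<open>The nearby crossing must be the given one. A gap between consecutive ends of a crossing
  misses two of its ends, so it contains no crossing near them.\<close>

lemma near_crossing:
  assumes "near B i j p" "p \<in> e \<union> f" "e \<in> E" "f \<in> E" "X e f"
  shows "e \<union> f \<subseteq> B \<union> {i, j}"
proof -
  obtain e' f' x where 1: "e' \<in> E" "f' \<in> E" "X e' f'" "e' \<union> f' \<subseteq> B \<union> {i, j}" "x \<in> e' \<union> f'" "x = p \<or> {x, p} \<in> E"
    using assms(1) unfolding near_def by blast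
  have "{e', f'} = {e, f}" using X_far[OF 1(1-3) assms(3-5) 1(5) assms(2)] 1(6) by blast
  then have "e' \<union> f' = e \<union> f" by (metis Union_insert Union_empty Un_empty_right)
  then show ?thesis using 1(4) by simp
qed

text \<open>The ear forces degree 4 at \<open>b\<close>, which makes all its possible edges present.
  With the edge \<open>cd\<close> this is \<open>no_kite100\<close>; without it, \<open>c\<close>
  and \<open>u\<close> are two vertices of degree at most 2 on the same pair \<open>a, b\<close>,
  which is \<open>no_C4\<close>.\<close>

lemma kite_first_ear:
  assumes E: "{a, c} \<in> E" "{b, d} \<in> E" and dist: "distinct [a, b, c, d, u]"
    and u: "N u = {a, b}" "card (N a) = 4" "card (N b) = 4"
    and Nb: "N b \<subseteq> {u, a, c, d}" and Nc: "N c \<subseteq> {a, b, d}"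
  shows False
proof -
  have b: "N b = {u, a, c, d}" by (rule card_4_cover[OF u(3) Nb])
  have e: "{b, a} \<in> E" "{b, c} \<in> E" "{b, u} \<in> E" "{a, b} \<in> E" "{a, u} \<in> E" "{u, a} \<in> E" "{c, b} \<in> E"
    using b u(1) unfolding edge_N by (auto simp: N_sym[of _ c] N_sym[of _ a])
  have cu: "card (N u) \<le> 2" unfolding u(1) by (simp add: card_insert_if)
  show False
  proof (cases "d \<in> N c")
    case True
    then have "{c, d} \<in> E" using edge_N by blast
    moreover have "card (N c) \<le> 3" using card_mono[OF _ Nc] by (simp add: card_insert_if split: if_splits)
    ultimately show False using no_kite100[of a b c d u] E dist e cu by auto
  next
    case False
    then have "N c \<subseteq> {a, b}" using Nc by blast
    then have "card (N c) \<le> 2" using card_mono[of "{a, b}" "N c"] dist by simp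
    then show False using no_C4[of a b u c] E dist e cu by auto
  qed
qed

text \<open>The ear \<open>v\<close> forces degree 4 at \<open>c\<close> and thereby the edges
  \<open>bc\<close> and \<open>cd\<close> that complete \<open>no_kite110\<close>.\<close>

lemma kite_two_ears:
  assumes E: "{a, c} \<in> E" "{b, d} \<in> E" and dist: "distinct [a, b, c, d, u, v]"
    and u: "N u = {a, b}" "N v = {b, c}" "card (N b) = 4" "card (N c) = 4"
    and Nc: "N c \<subseteq> {v, a, b, d}"
  shows False
proof -
  have c: "N c = {v, a, b, d}" by (rule card_4_cover[OF u(4) Nc])
  have e: "{c, d} \<in> E" "{c, v} \<in> E" "{b, c} \<in> E" "{b, u} \<in> E" "{b, v} \<in> E" "{a, u} \<in> E"
    using c u(1,2) unfolding edge_N by (auto simp: N_sym[of _ b] N_sym[of _ a])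
  have "card (N u) \<le> 2" "card (N v) \<le> 2" unfolding u(1,2) by (simp_all add: card_insert_if)
  then show False using no_kite110[of a b c d u v] E dist e by auto
qed

text \<open>By \<open>near_crossing\<close> each of the three gaps is empty or an ear. Of the eight
  patterns only two survive: no ear gives a kite, and a single ear in the middle gives a capped
  crossing.\<close>

lemma combine_kite:
  assumes p: "piece B1 a b" "piece B2 b c" "piece B3 c d" and t: "typed B1 a b" "typed B2 b c" "typed B3 c d"
    and E: "{a, c} \<in> E" "{b, d} \<in> E" "X {a, c} {b, d}" and dist: "distinct [a, b, c, d]"
    and disj: "B1 \<inter> {c, d} = {}" "B2 \<inter> {a, d} = {}" "B3 \<inter> {a, b} = {}" "B1 \<inter> B2 = {}" "B1 \<inter> B3 = {}" "B2 \<inter> B3 = {}"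
    and Nb: "N b \<subseteq> B1 \<union> B2 \<union> {a, c, d}" and Nc: "N c \<subseteq> B2 \<union> B3 \<union> {a, b, d}"
  shows "typed ({b, c} \<union> B1 \<union> B2 \<union> B3) a d"
proof -
  have "B1 = {} \<or> ear B1 a b"
    using typed_near[OF t(1) p(1)] near_crossing[OF _ _ E, of B1 a b a] dist disj by auto
  then have 1: "B1 = {} \<or> (\<exists>u. B1 = {u} \<and> N u = {a, b} \<and> card (N a) = 4 \<and> card (N b) = 4)"
    unfolding ear_def by blast
  have "B2 = {} \<or> ear B2 b c"
    using typed_near[OF t(2) p(2)] near_crossing[OF _ _ E, of B2 b c b] dist disj by auto
  then have 2: "B2 = {} \<or> (\<exists>u. B2 = {u} \<and> N u = {b, c} \<and> card (N b) = 4 \<and> card (N c) = 4)"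
    unfolding ear_def by blast
  have "B3 = {} \<or> ear B3 c d"
    using typed_near[OF t(3) p(3)] near_crossing[OF _ _ E, of B3 c d c] dist disj by auto
  then have 3: "B3 = {} \<or> (\<exists>u. B3 = {u} \<and> N u = {c, d} \<and> card (N c) = 4 \<and> card (N d) = 4)"
    unfolding ear_def by blast
  have E': "{d, b} \<in> E" "{c, a} \<in> E" using E by (simp_all add: insert_commute)
  have pp: "B1 \<inter> {a, b} = {}" "B2 \<inter> {b, c} = {}" "B3 \<inter> {c, d} = {}" using p unfolding piece_def by auto
  have mem: "a \<in> N c" "c \<in> N a" "b \<in> N d" "d \<in> N b" using E E' edge_N by blast+
  have card2: "N u = {x, y} \<Longrightarrow> card (N u) \<le> 2" for u x y by (simp add: card_insert_if)
  show ?thesis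
  proof (cases "B2 = {}")
    case e2: True
    consider "B1 = {}" "B3 = {}" | u where "B1 = {u}" "N u = {a, b}" "card (N a) = 4" "card (N b) = 4" "B3 = {}"
      | w where "B3 = {w}" "N w = {c, d}" "card (N c) = 4" "card (N d) = 4" "B1 = {}"
      | u w where "B1 = {u}" "N u = {a, b}" "card (N b) = 4" "B3 = {w}" "N w = {c, d}" "card (N c) = 4"
      using 1 3 by blast
    then show ?thesis
    proof cases
      case 1
      have Nb': "N b \<subseteq> {a, c, d}" and Nc': "N c \<subseteq> {a, b, d}" using Nb Nc 1 e2 by auto
      have cb: "2 \<le> card (N b)" "2 \<le> card (N c)" using card_N_ge_2 E E' by (metis insert_commute)+
      have b3: "card (N b) \<le> 3" "card (N c) \<le> 3"
        using card_mono[OF _ Nb'] card_mono[OF _ Nc'] by (simp_all add: card_insert_if split: if_splits)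
      \<comment> \<open>Without \<open>bc\<close>, both \<open>b\<close> and \<open>c\<close> would
        have exactly the neighbours \<open>a\<close> and \<open>d\<close>.\<close>
      have bcE: "{b, c} \<in> E"
      proof (rule ccontr)
        assume n: "{b, c} \<notin> E"
        then have "c \<notin> N b" "b \<notin> N c" using edge_N N_sym by blast+
        then have s: "N b \<subseteq> {a, d}" "N c \<subseteq> {a, d}" using Nb' Nc' by auto
        have "card {a, d} = 2" using dist by simp
        then have "N b = {a, d}" "N c = {a, d}" using card_seteq[OF _ s(1)] card_seteq[OF _ s(2)] cb by simp_all
        then have "{a, b} \<in> E" "{d, c} \<in> E" "{a, c} \<in> E" "{d, b} \<in> E" "card (N b) \<le> 2" "card (N c) \<le> 2"
          using E E' card2 edge_N N_sym by blast+
        then show False using no_C4[of a d b c] dist by auto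
      qed
      have "card (N b) = 3" "card (N c) = 3" using edge_degree_sum[OF bcE] b3 by auto
      then have N: "N b = {a, c, d}" "N c = {a, b, d}"
        using card_seteq[OF _ Nb'] card_seteq[OF _ Nc'] by (simp_all add: card_insert_if)
      have e: "{a, b} \<in> E" "{c, d} \<in> E" "{b, a} \<in> E" "{d, c} \<in> E" "{c, b} \<in> E"
        using N_edges[OF N(1)] N_edges[OF N(2)] by auto
      have "{a, d} \<notin> E" using no_K4[of a d b c] dist e E E' bcE b3 by auto
      moreover have "card (N a) = 4"
      proof (rule ccontr)
        assume "card (N a) \<noteq> 4"
        then have "card (N a) \<le> 3" using card_N_le[of a] by simp
        then show False using no_K4_minus[of d a b c] dist e E E' bcE b3 by auto
      qed
      moreover have "card (N d) = 4"
      proof (rule ccontr)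
        assume "card (N d) \<noteq> 4"
        then have "card (N d) \<le> 3" using card_N_le[of d] by simp
        then show False using no_K4_minus[of a d b c] dist e E E' bcE b3 by auto
      qed
      moreover have "{b, c} \<union> B1 \<union> B2 \<union> B3 = {b, c}" using 1 e2 by simp
      ultimately have "kite ({b, c} \<union> B1 \<union> B2 \<union> B3) a d" unfolding kite_def using N E(3) by blast
      then show ?thesis unfolding typed_def by blast
    next
      case 2
      have False by (rule kite_first_ear[OF E(1,2), of u]) (use 2 e2 dist disj pp Nb Nc in auto)
      then show ?thesis ..
    next
      case 3
      have False by (rule kite_first_ear[OF E'(1,2), of w]) (use 3 e2 dist disj pp Nb Nc in auto)
      then show ?thesis ..
    next
      case 4
      have b: "N b = {u, a, c, d}" by (rule card_4_cover[OF 4(3)]) (use Nb 4 e2 in auto)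
      have c: "N c = {w, a, b, d}" by (rule card_4_cover[OF 4(6)]) (use Nc 4 e2 in auto)
      have "{a, u} \<in> E" "{a, b} \<in> E" "{b, u} \<in> E" "{b, c} \<in> E" "{c, d} \<in> E" "{d, w} \<in> E" "{c, w} \<in> E"
        using N_edges[OF b] N_edges[OF c] N_edges[OF 4(2)] N_edges[OF 4(5)] by auto
      then have False using no_kite101[of a b c d u w] E dist disj pp 4 card2[OF 4(2)] card2[OF 4(5)] by auto
      then show ?thesis ..
    qed
  next
    case False
    then obtain v where v: "B2 = {v}" "N v = {b, c}" "card (N b) = 4" "card (N c) = 4" using 2 by blast
    have vE: "{b, v} \<in> E" "{c, v} \<in> E" using N_edges[OF v(2)] by auto
    consider "B1 = {}" "B3 = {}" | u where "B1 = {u}" "N u = {a, b}" "B3 = {}"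
      | w where "B3 = {w}" "N w = {c, d}" "B1 = {}"
      | u w where "B1 = {u}" "N u = {a, b}" "B3 = {w}" "N w = {c, d}"
      using 1 3 by blast
    then show ?thesis
    proof cases
      case 1
      have b: "N b = {a, v, c, d}" by (rule card_4_cover[OF v(3)]) (use Nb 1 v in auto)
      have c: "N c = {a, b, v, d}" by (rule card_4_cover[OF v(4)]) (use Nc 1 v in auto)
      have e: "{a, b} \<in> E" "{b, a} \<in> E" "{b, c} \<in> E" "{c, b} \<in> E" "{c, d} \<in> E" "{d, c} \<in> E"
        using N_edges[OF b] N_edges[OF c] by auto
      have dv: "distinct [a, b, c, d, v]" using dist disj pp v by auto
      have cv: "card (N v) \<le> 2" by (rule card2[OF v(2)])
      have "card (N a) = 4"
      proof (rule ccontr)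
        assume "card (N a) \<noteq> 4"
        then have "card (N a) \<le> 3" using card_N_le[of a] by simp
        then show False
          using no_lump0[of d c b a v] no_q3[of a b c d v] dv e E E' vE cv by (auto simp: insert_commute)
      qed
      moreover have "card (N d) = 4"
      proof (rule ccontr)
        assume "card (N d) \<noteq> 4"
        then have "card (N d) \<le> 3" using card_N_le[of d] by simp
        then show False
          using no_lump0[of a b c d v] no_q3[of d c b a v] dv e E E' vE cv by (auto simp: insert_commute)
      qed
      ultimately have "capped {b, v, c} a d b v c" unfolding capped_def using b c v E(3) by auto
      moreover have "{b, c} \<union> B1 \<union> B2 \<union> B3 = {b, v, c}" using 1 v by auto
      ultimately show ?thesis unfolding typed_def open_cap_def lump_def by metis
    next
      case 2
      have False by (rule kite_two_ears[OF E(1,2) _ 2(2) v(2-4)]) (use 2 v dist disj pp Nc in auto)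
      then show ?thesis ..
    next
      case 3
      have w': "N w = {d, c}" and v': "N v = {c, b}" using 3(2) v(2) by auto
      have n: "N b \<subseteq> {v, d, c, a}" using Nb 3(3) v(1) by auto
      have "distinct [d, c, b, a, w, v]" using dist disj pp 3(1) v(1) by auto
      then have False by (rule kite_two_ears[OF E' _ w' v' v(4,3) n])
      then show ?thesis ..
    next
      case 4
      have uw: "{a, u} \<in> E" "{b, u} \<in> E" "{c, w} \<in> E" "{d, w} \<in> E" using N_edges[OF 4(2)] N_edges[OF 4(4)] by auto
      have d7: "distinct [a, b, c, d, u, v, w]" using dist disj pp 4 v by auto
      note c2 = card2[OF 4(2)] card2[OF v(2)] card2[OF 4(4)]
      have False
      proof (cases "c \<in> N b")
        case True
        then have "{b, c} \<in> E" using edge_N by blast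
        then show False using no_kite111a[of a b c d u v w] E uw vE d7 c2 by auto
      next
        case n: False
        then have "b \<notin> N c" using N_sym by blast
        have b: "N b = {u, v, a, d}" by (rule card_4_cover[OF v(3)]) (use Nb 4 v n in auto)
        have c: "N c = {v, w, a, d}" by (rule card_4_cover[OF v(4)]) (use Nc 4 v \<open>b \<notin> N c\<close> in auto)
        have "{a, b} \<in> E" "{c, d} \<in> E" using N_edges[OF b] N_edges[OF c] by auto
        then show False using no_kite111b[of a b c d u v w] E uw vE d7 c2 by auto
      qed
      then show ?thesis ..
    qed
  qed
qed

text \<open>No piece can be the whole graph, because its ends have neighbours outside.\<close>

lemma typed_not_all:
  assumes t: "typed B i j" and p: "piece B i j" and all: "\<Union>E = B \<union> {i, j}"
  shows False
proof -
  have ij: "i \<noteq> j" "i \<notin> B" "j \<notin> B" using p unfolding piece_def by auto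
  have N: "N x \<subseteq> B \<union> {i, j} - {x}" for x using all not_self_N unfolding N_def by blast
  \<comment> \<open>The ends of a lump have two different outer neighbours, so a graph with only one
    further vertex has no room for them.\<close>
  have lump_False: False if l: "lump B' a d" "a \<noteq> d" "a \<notin> B'" "d \<notin> B'" "N a \<union> N d \<subseteq> B' \<union> {a, d, x}" for B' a d x
  proof -
    obtain b v c where c: "capped B' a d b v c" "{a, d} \<in> E" using l unfolding lump_def by blast
    from c l(2-4) show False
    proof (rule lump_outer)
      fix t y assume "N a = {b, c, d, t}" "N d = {b, c, a, y}" "t \<notin> B' \<union> {a, d}" "y \<notin> B' \<union> {a, d}" "t \<noteq> y"
      then show False using l(5) by auto
    qed
  qed
  have tail_False: False if l: "tailed B i j" "i \<notin> B" "\<And>x. N x \<subseteq> B \<union> {i, j}" for i j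
  proof -
    obtain d B' where d: "B = insert d B'" "d \<notin> B'" "lump B' i d" using l(1) unfolding tailed_def by blast
    show False by (rule lump_False[OF d(3), of j]) (use d l(2) l(3)[of i] l(3)[of d] in auto)
  qed
  consider "B = {}" | "ear B i j" | "kite B i j" | "open_cap B i j" | "lump B i j" | "tailed B i j" | "tailed B j i"
    | "fat_ear B i j" using t unfolding typed_def by blast
  then show False
  proof cases
    case 1
    have "i \<in> \<Union>E" using all by blast
    then obtain e where "e \<in> E" "i \<in> e" by blast
    then have "e \<in> (\<lambda>w. {i, w}) ` N i" using N_image by blast
    then obtain w where "{i, w} \<in> E" unfolding N_def by blast
    then have "2 \<le> card (N i)" by (rule card_N_ge_2)
    moreover have "N i \<subseteq> {j}" using N[of i] 1 by auto
    ultimately show False using card_mono[of "{j}" "N i"] by simp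
  next
    case 2
    then obtain k where k: "B = {k}" "card (N i) = 4" unfolding ear_def by blast
    then show False using N[of i] card_4_not_3[OF k(2), of k j j] by auto
  next
    case 3
    then obtain b c where k: "B = {b, c}" "card (N i) = 4" unfolding kite_def by blast
    then show False using N[of i] card_4_not_3[OF k(2), of b c j] by auto
  next
    case 4
    then obtain b v c where c: "capped B i j b v c" unfolding open_cap_def by blast
    have "N i \<subseteq> {b, c, j}" using capped_facts(18)[OF c ij] N[of i] by blast
    then show False using card_4_not_3[OF capped_facts(10)[OF c ij]] by blast
  next
    case 5
    then show False by (rule lump_False[of _ _ _ i]) (use ij N[of i] N[of j] in auto)
  next
    case 6
    then show False by (rule tail_False) (use ij N in auto)
  next
    case 7
    then show False by (rule tail_False) (use ij N in auto)
  next
    case 8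
    then obtain a d B' where c: "B = insert a (insert d B')" "a \<notin> B'" "d \<notin> B'" "a \<noteq> d" "lump B' a d"
      "{i, a} \<in> E" "{d, j} \<in> E" unfolding fat_ear_def by blast
    obtain b v k where c': "capped B' a d b v k" "{a, d} \<in> E" using c unfolding lump_def by blast
    have B: "B' = {b, v, k}" "N b = {a, v, k, d}" "N k = {a, b, v, d}" "N v = {b, k}" using c' unfolding capped_def by auto
    have ia: "i \<in> N a" "j \<in> N d" using c edge_N N_sym by blast+
    have ne: "i \<notin> insert a (insert d B')" "j \<notin> insert a (insert d B')" using ij c by auto
    from c' c(4,2,3) show False
    proof (rule lump_outer)
      fix t y assume t: "N a = {b, k, d, t}" "N d = {b, k, a, y}" "t \<noteq> y" "card (N y) = 4"
      have "t = i" "y = j" using t ia ne B(1) by auto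
      then have "j \<notin> N a" "j \<notin> N b" "j \<notin> N k" "j \<notin> N v" using t ne B ij(1) by auto
      then have "N j \<subseteq> {d, i, i}" using N[of j] N_sym c(1) B(1) by blast
      then show False using card_4_not_3[OF t(4)] \<open>y = j\<close> by blast
    qed
  qed
qed

end

section \<open>Convex drawings\<close>

text \<open>The condition for two chords to cross when the vertices are placed on a circle in their
  linear order.\<close>

definition interleaved :: "'a::linorder set \<Rightarrow> 'a set \<Rightarrow> bool" where
  "interleaved e f \<longleftrightarrow> (\<exists>a b c d. a < b \<and> b < c \<and> c < d \<and> (e = {a, c} \<and> f = {b, d} \<or> e = {b, d} \<and> f = {a, c}))"

lemma interleaved_sym: "interleaved e f \<Longrightarrow> interleaved f e"
  unfolding interleaved_def by blast

lemma interleavedI: "a < b \<Longrightarrow> b < c \<Longrightarrow> c < d \<Longrightarrow> interleaved {a, c} {b, d}"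
  unfolding interleaved_def by blast

locale convex_critical = critical E L interleaved
  for E :: "'a::linorder set set" and L +
  assumes interleaved_once: "\<lbrakk>e \<in> E; f \<in> E; g \<in> E; interleaved e f; interleaved e g\<rbrakk> \<Longrightarrow> f = g"
begin

definition between :: "'a \<Rightarrow> 'a \<Rightarrow> 'a set" where
  "between i j = {v \<in> \<Union>E. i < v \<and> v < j}"

lemma N_subset: "N x \<subseteq> \<Union>E"
  unfolding N_def by blast

lemma finite_V: "finite (\<Union>E)"
  using finite_E card_edge by (metis card.infinite finite_Union zero_neq_numeral)

lemma finite_between: "finite (between i j)"
  by (rule finite_subset[OF _ finite_V]) (auto simp: between_def)

lemma N_nonempty:
  assumes "x \<in> \<Union>E"
  shows "N x \<noteq> {}"
proof -
  obtain e where "e \<in> E" "x \<in> e" using assms by blast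
  then have "e \<in> (\<lambda>w. {x, w}) ` N x" using N_image by blast
  then show ?thesis by blast
qed

lemma pieceI:
  assumes "i < j" "\<And>x y. x \<in> between i j \<Longrightarrow> y \<in> N x \<Longrightarrow> i \<le> y \<and> y \<le> j"
  shows "piece (between i j) i j"
  unfolding piece_def
proof (intro conjI ballI subsetI)
  fix x y assume "x \<in> between i j" "y \<in> N x"
  then have "i \<le> y" "y \<le> j" "y \<in> \<Union>E" using assms(2) N_subset by blast+
  then show "y \<in> between i j \<union> {i, j}" unfolding between_def by auto
qed (use assms(1) in \<open>auto simp: between_def\<close>)

lemma pieceD: "piece (between i j) i j \<Longrightarrow> x \<in> between i j \<Longrightarrow> y \<in> N x \<Longrightarrow> i < j \<Longrightarrow> i \<le> y \<and> y \<le> j"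
  unfolding piece_def between_def by fastforce

lemma typed_split:
  assumes p: "piece (between i j) i j" and k: "k \<in> between i j"
    and l: "piece (between i k) i k" "typed (between i k) i k"
    and r: "piece (between k j) k j" "typed (between k j) k j"
  shows "typed (between i j) i j"
proof -
  have ikj: "i < k" "k < j" "k \<in> \<Union>E" using k unfolding between_def by auto
  have eq: "insert k (between i k \<union> between k j) = between i j"
    using ikj unfolding between_def by auto
  have "typed (insert k (between i k \<union> between k j)) i j"
  proof (rule combine[OF l(1) r(1) l(2) r(2)])
    show "i \<noteq> j" using ikj by auto
    show "(between i k \<union> {i}) \<inter> (between k j \<union> {j}) = {}" using ikj unfolding between_def by auto
    have "N k \<subseteq> between i j \<union> {i, j}" using p k unfolding piece_def by blast
    then show "N k \<subseteq> between i k \<union> between k j \<union> {i, j}" using not_self_N[of k] unfolding eq[symmetric] by blast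
    show "N k \<noteq> {}" using N_nonempty[OF ikj(3)] .
  qed
  then show ?thesis unfolding eq .
qed

lemma typed_between:
  assumes "piece (between i j) i j" "i < j" "i \<in> \<Union>E" "j \<in> \<Union>E"
  shows "typed (between i j) i j"
  using assms
proof (induction "card (between i j)" arbitrary: i j rule: less_induct)
  case less
  note p = less.prems(1) and ij = less.prems(2)
  have IH: "typed (between a b) a b" if "piece (between a b) a b" "a < b" "a \<in> \<Union>E" "b \<in> \<Union>E" "i \<le> a" "b \<le> j" "k \<in> between i j"
    "k \<notin> between a b" for a b k
  proof (rule less.hyps)
    show "card (between a b) < card (between i j)"
      by (rule psubset_card_mono[OF finite_between]) (use that in \<open>auto simp: between_def\<close>)
  qed (use that in auto)
  show ?case
  proof (cases "between i j = {}")
    case True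
    then show ?thesis unfolding typed_def by blast
  next
    case ne: False
    show ?thesis
    proof (cases "N i \<inter> between i j = {}")
      case True
      \<comment> \<open>If \<open>i\<close> has no inner neighbour, the interval splits at its first
        inner vertex with an empty left part.\<close>
      define k where "k = Min (between i j)"
      have k: "k \<in> between i j" "\<And>x. x \<in> between i j \<Longrightarrow> k \<le> x"
        unfolding k_def using ne finite_between by (auto intro: Min_in Min_le)
      have ikj: "i < k" "k < j" "k \<in> \<Union>E" using k unfolding between_def by auto
      have e: "between i k = {}" using k(2) ikj unfolding between_def by fastforce
      have l: "piece (between i k) i k" by (rule pieceI) (use e ikj in auto)
      have r: "piece (between k j) k j"
      proof (rule pieceI)
        fix x y assume x: "x \<in> between k j" "y \<in> N x"
        then have xi: "x \<in> between i j" using ikj unfolding between_def by auto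
        have "i \<le> y \<and> y \<le> j" using pieceD[OF p xi x(2) ij] .
        moreover have "y \<noteq> i" using True xi x(2) N_sym by blast
        moreover have "y \<in> \<Union>E" using x(2) N_subset by blast
        ultimately have "y \<in> between i j \<or> y = j" unfolding between_def by auto
        then show "k \<le> y \<and> y \<le> j" using k(2) ikj unfolding between_def by auto
      qed (use ikj in auto)
      show ?thesis
        by (rule typed_split[OF p k(1) l _ r]) (use IH[OF l _ _ _ _ _ k(1)] IH[OF r _ _ _ _ _ k(1)] ikj less.prems in \<open>auto simp: between_def\<close>)
    next
      case False
      \<comment> \<open>The farthest inner neighbour of \<open>i\<close>: no edge from
        \<open>i\<close> ends strictly between \<open>k\<close> and \<open>j\<close>, so only an
        edge interleaving with \<open>ik\<close> can prevent a split at \<open>k\<close>.\<close>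
      define k where "k = Max (N i \<inter> between i j)"
      have fin: "finite (N i \<inter> between i j)" using finite_between by blast
      have k: "k \<in> between i j" "k \<in> N i" "\<And>x. x \<in> between i j \<Longrightarrow> x \<in> N i \<Longrightarrow> x \<le> k"
        unfolding k_def using Max_in[OF fin False] Max_ge[OF fin] by auto
      have ikj: "i < k" "k < j" "k \<in> \<Union>E" using k unfolding between_def by auto
      have ikE: "{i, k} \<in> E" using k edge_N by blast
      show ?thesis
      proof (cases "\<exists>s t. {s, t} \<in> E \<and> i < s \<and> s < k \<and> k < t")
        case no: False
        have l: "piece (between i k) i k"
        proof (rule pieceI)
          fix x y assume x: "x \<in> between i k" "y \<in> N x"
          then have xi: "x \<in> between i j" "i < x" "x < k" using ikj unfolding between_def by auto
          have "i \<le> y \<and> y \<le> j" using pieceD[OF p xi(1) x(2) ij] .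
          moreover have "\<not> k < y" using no xi x(2) edge_N by blast
          ultimately show "i \<le> y \<and> y \<le> k" by auto
        qed (use ikj in auto)
        have r: "piece (between k j) k j"
        proof (rule pieceI)
          fix x y assume x: "x \<in> between k j" "y \<in> N x"
          then have xi: "x \<in> between i j" "k < x" "x < j" using ikj unfolding between_def by auto
          have "i \<le> y \<and> y \<le> j" using pieceD[OF p xi(1) x(2) ij] .
          moreover have "y \<noteq> i" using k(3)[OF xi(1)] xi x(2) N_sym by force
          moreover have "\<not> (i < y \<and> y < k)"
          proof
            assume "i < y \<and> y < k"
            moreover have "{y, x} \<in> E" using x(2) edge_N N_sym by blast
            ultimately show False using no xi by blast
          qed
          ultimately show "k \<le> y \<and> y \<le> j" by auto
        qed (use ikj in auto)
        show ?thesis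
          by (rule typed_split[OF p k(1) l _ r]) (use IH[OF l _ _ _ _ _ k(1)] IH[OF r _ _ _ _ _ k(1)] ikj less.prems in \<open>auto simp: between_def\<close>)
      next
        case True
        then obtain s t where st: "{s, t} \<in> E" "i < s" "s < k" "k < t" by blast
        \<comment> \<open>Since \<open>ik\<close> and \<open>st\<close> interleave only with each
          other, any other edge stays within one of the gaps that they bound; \<open>U1\<close> says
          this for \<open>ik\<close> and \<open>U2\<close> for \<open>st\<close>.\<close>
        have U1: "p = s \<and> q = t" if "{p, q} \<in> E" "i < p" "p < k" "k < q" for p q
        proof -
          have "{p, q} = {s, t}"
            by (rule interleaved_once[OF ikE that(1) st(1)]) (use that st in \<open>auto intro: interleavedI\<close>)
          then show ?thesis using that st by (auto simp: doubleton_eq_iff)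
        qed
        have U2: "{p, q} = {i, k}" if "{p, q} \<in> E" "p < s \<and> s < q \<and> q < t \<or> s < p \<and> p < t \<and> t < q" for p q
        proof (rule interleaved_once[OF st(1) that(1) ikE])
          show "interleaved {s, t} {i, k}" using st by (intro interleaved_sym[OF interleavedI]) auto
          show "interleaved {s, t} {p, q}" using that(2) interleavedI interleaved_sym by blast
        qed
        have sV: "s \<in> \<Union>E" "t \<in> \<Union>E" using st(1) by auto
        have sb: "s \<in> between i j" using st ikj sV unfolding between_def by auto
        have "t \<in> N s" using st(1) edge_N by blast
        then have "t \<le> j" using pieceD[OF p sb] ij by blast
        then consider "t < j" | "t = j" by fastforce
        then show ?thesis
        proof cases
          \<comment> \<open>If \<open>st\<close> ends before \<open>j\<close>, no edge passes over
            \<open>t\<close> within the interval, which therefore splits at \<open>t\<close>; the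
            crossing remains in the left part.\<close>
          case 1
          have tb: "t \<in> between i j" using st sV 1 unfolding between_def by auto
          have l: "piece (between i t) i t"
          proof (rule pieceI)
            fix x y assume x: "x \<in> between i t" "y \<in> N x"
            then have xi: "x \<in> between i j" "i < x" "x < t" using 1 unfolding between_def by auto
            have "i \<le> y \<and> y \<le> j" using pieceD[OF p xi(1) x(2) ij] .
            moreover have "\<not> t < y"
            proof
              assume y: "t < y"
              have xy: "{x, y} \<in> E" using x(2) edge_N by blast
              show False
              proof (cases "x < k")
                case True
                moreover have "k < y" using y st by simp
                ultimately show False using U1[OF xy xi(2)] y by auto
              next
                case False
                then have "{x, y} = {i, k}" by (intro U2[OF xy]) (use xi y st in auto)
                then show False using y st by (auto simp: doubleton_eq_iff)
              qed
            qed
            ultimately show "i \<le> y \<and> y \<le> t" by auto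
          qed (use st in auto)
          have r: "piece (between t j) t j"
          proof (rule pieceI)
            fix x y assume x: "x \<in> between t j" "y \<in> N x"
            then have xi: "x \<in> between i j" "t < x" "x < j" using st unfolding between_def by auto
            have "i \<le> y \<and> y \<le> j" using pieceD[OF p xi(1) x(2) ij] .
            moreover have "\<not> y < t"
            proof
              assume y: "y < t"
              have xy: "{y, x} \<in> E" using x(2) edge_N N_sym by blast
              have "y \<noteq> i" using k(3)[OF xi(1)] xi x(2) N_sym st by force
              then have iy: "i < y" using \<open>i \<le> y \<and> y \<le> j\<close> by auto
              show False
              proof (cases "y < k")
                case True
                moreover have "k < x" using xi st by simp
                ultimately show False using U1[OF xy iy] xi by auto
              next
                case False
                then have "{y, x} = {i, k}" by (intro U2[OF xy]) (use xi y st in auto)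
                then show False using xi st by (auto simp: doubleton_eq_iff)
              qed
            qed
            ultimately show "t \<le> y \<and> y \<le> j" by auto
          qed (use 1 in auto)
          show ?thesis
            by (rule typed_split[OF p tb l _ r]) (use IH[OF l _ _ _ _ _ tb] IH[OF r _ _ _ _ _ tb] st 1 sV less.prems in \<open>auto simp: between_def\<close>)
        next
          \<comment> \<open>Here \<open>i, s, k, j\<close> are the four ends of a crossing, and the
            interval consists of two of them and the three gaps.\<close>
          case 2
          have B1: "piece (between i s) i s"
          proof (rule pieceI)
            fix x y assume x: "x \<in> between i s" "y \<in> N x"
            then have xi: "x \<in> between i j" "i < x" "x < s" using st ikj unfolding between_def by auto
            have "i \<le> y \<and> y \<le> j" using pieceD[OF p xi(1) x(2) ij] .
            moreover have "\<not> s < y"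
            proof
              assume y: "s < y"
              have xy: "{x, y} \<in> E" using x(2) edge_N by blast
              show False
              proof (cases "k < y")
                case True
                moreover have "x < k" using xi st by simp
                ultimately show False using U1[OF xy xi(2)] xi st by auto
              next
                case False
                then have "{x, y} = {i, k}" by (intro U2[OF xy]) (use xi y st in auto)
                then show False using xi st by (auto simp: doubleton_eq_iff)
              qed
            qed
            ultimately show "i \<le> y \<and> y \<le> s" by auto
          qed (use st in auto)
          have B2: "piece (between s k) s k"
          proof (rule pieceI)
            fix x y assume x: "x \<in> between s k" "y \<in> N x"
            then have xi: "x \<in> between i j" "s < x" "x < k" using st ikj unfolding between_def by auto
            have iyj: "i \<le> y \<and> y \<le> j" using pieceD[OF p xi(1) x(2) ij] .
            have xy: "{x, y} \<in> E" "{y, x} \<in> E" using x(2) edge_N N_sym by blast+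
            have "i < x" using xi st by simp
            then have "\<not> k < y" using U1[OF xy(1) _ xi(3)] xi by auto
            moreover have "\<not> y < s"
            proof
              assume "y < s"
              then have "{y, x} = {i, k}" by (intro U2[OF xy(2)]) (use xi st in auto)
              then show False using xi st by (auto simp: doubleton_eq_iff)
            qed
            ultimately show "s \<le> y \<and> y \<le> k" by auto
          qed (use st in auto)
          have B3: "piece (between k j) k j"
          proof (rule pieceI)
            fix x y assume x: "x \<in> between k j" "y \<in> N x"
            then have xi: "x \<in> between i j" "k < x" "x < j" using ikj unfolding between_def by auto
            have "i \<le> y \<and> y \<le> j" using pieceD[OF p xi(1) x(2) ij] .
            moreover have "y \<noteq> i" using k(3)[OF xi(1)] xi x(2) N_sym by force
            moreover have "\<not> (i < y \<and> y < k)"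
            proof
              assume y: "i < y \<and> y < k"
              have "{y, x} \<in> E" using x(2) edge_N N_sym by blast
              then show False using U1[of y x] y xi 2 by auto
            qed
            ultimately show "k \<le> y \<and> y \<le> j" by auto
          qed (use ikj in auto)
          have T1: "typed (between i s) i s"
            by (rule IH[OF B1 _ _ _ _ _ k(1)]) (use st ikj sV less.prems in \<open>auto simp: between_def\<close>)
          have T2: "typed (between s k) s k"
            by (rule IH[OF B2 _ _ _ _ _ k(1)]) (use st ikj sV less.prems in \<open>auto simp: between_def\<close>)
          have T3: "typed (between k j) k j"
            by (rule IH[OF B3 _ _ _ _ _ k(1)]) (use st ikj sV less.prems in \<open>auto simp: between_def\<close>)
          have eq: "{s, k} \<union> between i s \<union> between s k \<union> between k j = between i j"
            using st ikj sV unfolding between_def by auto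
          have "typed ({s, k} \<union> between i s \<union> between s k \<union> between k j) i j"
          proof (rule combine_kite[OF B1 B2 B3 T1 T2 T3 ikE])
            show "{s, j} \<in> E" using st 2 by simp
            show "interleaved {i, k} {s, j}" using st ikj by (intro interleavedI) auto
            show "distinct [i, s, k, j]" using st ikj by auto
            have "N s \<subseteq> between i j \<union> {i, j}" "N k \<subseteq> between i j \<union> {i, j}" using p sb k(1) unfolding piece_def by blast+
            moreover have "y \<notin> between k j" if "y \<in> N s" for y
              using U1[of s y] that st 2 unfolding between_def edge_N by auto
            moreover have "y \<notin> between i s" if "y \<in> N k" for y
            proof
              assume y: "y \<in> between i s"
              have "{y, k} \<in> E" using that edge_N N_sym by blast
              then have "{y, k} = {i, k}" by (rule U2) (use y st in \<open>auto simp: between_def\<close>)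
              then show False using y by (auto simp: doubleton_eq_iff between_def)
            qed
            ultimately show "N s \<subseteq> between i s \<union> between s k \<union> {i, k, j}" "N k \<subseteq> between s k \<union> between k j \<union> {i, s, j}"
              using not_self_N[of s] not_self_N[of k] unfolding eq[symmetric] by blast+
          qed (use st ikj in \<open>auto simp: between_def\<close>)
          then show ?thesis unfolding eq .
        qed
      qed
    qed
  qed
qed

lemma contradiction: False
proof -
  have "E \<noteq> {}" using not_colorable unfolding list_colorable_def proper_edge_coloring_def by auto
  then obtain e where e: "e \<in> E" by blast
  then obtain u w where uw: "e = {u, w}" "u \<noteq> w" using card_edge by (meson card_2_iff)
  have ne: "\<Union>E \<noteq> {}" using e uw by blast
  define i where "i = Min (\<Union>E)"
  define j where "j = Max (\<Union>E)"
  have ij: "i \<in> \<Union>E" "j \<in> \<Union>E" "\<And>x. x \<in> \<Union>E \<Longrightarrow> i \<le> x \<and> x \<le> j"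
    unfolding i_def j_def using finite_V ne Min_in Max_in by auto
  have "u \<in> \<Union>E" "w \<in> \<Union>E" using e uw by auto
  then have "i \<le> u" "u \<le> j" "i \<le> w" "w \<le> j" using ij(3) by blast+
  then have "i < j" using uw(2) by (metis antisym not_less order_trans)
  have p: "piece (between i j) i j"
    by (rule pieceI[OF \<open>i < j\<close>]) (use ij(3) N_subset in blast)
  have "\<Union>E = between i j \<union> {i, j}" using ij unfolding between_def by force
  then show False using typed_not_all[OF typed_between[OF p \<open>i < j\<close> ij(1,2)] p] by blast
qed

end

section \<open>Theta curves\<close>

definition joins :: "complex set \<Rightarrow> complex \<Rightarrow> complex \<Rightarrow> bool" where
  "joins A a b \<longleftrightarrow> (\<exists>g. arc g \<and> pathstart g = a \<and> pathfinish g = b \<and> path_image g = A)"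

definition jordan :: "complex set \<Rightarrow> bool" where
  "jordan J \<longleftrightarrow> (\<exists>g. simple_path g \<and> pathfinish g = pathstart g \<and> path_image g = J)"

lemma joins_sym: "joins A a b \<Longrightarrow> joins A b a"
  unfolding joins_def by (metis arc_reversepath path_image_reversepath pathfinish_reversepath pathstart_reversepath)

lemma joins_ends: "joins A a b \<Longrightarrow> a \<in> A" "joins A a b \<Longrightarrow> b \<in> A"
  unfolding joins_def by auto

lemma joins_neq: "joins A a b \<Longrightarrow> a \<noteq> b"
  unfolding joins_def by (metis arc_distinct_ends)

lemma joins_compact: "joins A a b \<Longrightarrow> compact A"
  unfolding joins_def by (metis arc_imp_path compact_path_image)

lemma joins_connected: "joins A a b \<Longrightarrow> connected A"
  unfolding joins_def by (metis arc_imp_path connected_path_image)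

lemma joins_interior_connected: "joins A a b \<Longrightarrow> connected (A - {a, b})"
  unfolding joins_def by (metis arc_imp_simple_path connected_simple_path_endless)

lemma joins_interior_nonempty: "joins A a b \<Longrightarrow> A - {a, b} \<noteq> {}"
  unfolding joins_def by (metis arc_imp_simple_path nonempty_simple_path_endless)

lemma joins_interior_closure:
  assumes "joins A a b"
  shows "A \<subseteq> closure (A - {a, b})"
proof -
  obtain g where g: "arc g" "pathstart g = a" "pathfinish g = b" "path_image g = A"
    using assms unfolding joins_def by blast
  have e: "A - {a, b} = g ` {0<..<1}" using simple_path_endless[OF arc_imp_simple_path[OF g(1)]] g by simp
  have "g ` closure {0<..<1::real} \<subseteq> closure (g ` {0<..<1})"
    by (rule image_closure_subset)
      (use arc_imp_path[OF g(1)] closure_subset[of "g ` {0<..<1}"] in \<open>auto simp: path_def\<close>)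
  then show ?thesis unfolding e using g(4) by (simp add: path_image_def)
qed

lemma joins_join:
  assumes "joins A a b" "joins B b c" "A \<inter> B = {b}"
  shows "joins (A \<union> B) a c"
proof -
  obtain g where g: "arc g" "pathstart g = a" "pathfinish g = b" "path_image g = A"
    using assms(1) unfolding joins_def by blast
  obtain h where h: "arc h" "pathstart h = b" "pathfinish h = c" "path_image h = B"
    using assms(2) unfolding joins_def by blast
  have "arc (g +++ h)" using g h assms(3) by (intro arc_join) auto
  then show ?thesis unfolding joins_def using g h by (intro exI[of _ "g +++ h"]) (simp add: path_image_join)
qed

lemma joins_loop:
  assumes "joins A a b" "joins B a b" "A \<inter> B = {a, b}"
  shows "jordan (A \<union> B)"
proof -
  obtain g where g: "arc g" "pathstart g = a" "pathfinish g = b" "path_image g = A"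
    using assms(1) unfolding joins_def by blast
  obtain h where h: "arc h" "pathstart h = b" "pathfinish h = a" "path_image h = B"
    using joins_sym[OF assms(2)] unfolding joins_def by blast
  have "simple_path (g +++ h)" using g h assms(3) by (intro simple_path_join_loop) auto
  then show ?thesis unfolding jordan_def using g h by (intro exI[of _ "g +++ h"]) (simp add: path_image_join)
qed

lemma jordanD:
  assumes "jordan J"
  shows "compact J" "inside J \<noteq> {}" "open (inside J)" "connected (inside J)" "open (outside J)" "connected (outside J)"
    "frontier (inside J) = J"
proof -
  obtain g where g: "simple_path g" "pathfinish g = pathstart g" "path_image g = J"
    using assms unfolding jordan_def by blast
  show "compact J" using g compact_simple_path_image by blast
  show "inside J \<noteq> {}" "open (inside J)" "connected (inside J)" "open (outside J)" "connected (outside J)"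
    "frontier (inside J) = J"
    using Jordan_inside_outside[OF g(1,2)] g(3) by auto
qed

lemma closure_inside_jordan: "jordan J \<Longrightarrow> closure (inside J) = inside J \<union> J"
  using jordanD(3,7)[of J] by (metis closure_Un_frontier)

lemma connected_inside_or_outside:
  assumes "connected S" "S \<inter> J = {}"
  shows "S \<subseteq> inside J \<or> S \<subseteq> outside J"
proof (rule ccontr)
  assume "\<not> ?thesis"
  then have "inside J \<inter> S \<noteq> {}" "outside J \<inter> S \<noteq> {}" using inside_Un_outside[of J] assms(2) by blast+
  then show False using inside_outside_intersect_connected[OF assms(1)] assms(2) by blast
qed

text \<open>
  If no arc of a theta curve runs inside the other two, then the two circles through the third
  arc fail to separate a point inside the first circle from infinity, and by Janiszewski's theorem
  so does their union.
\<close>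

lemma theta_inside:
  assumes A: "joins A a b" and B: "joins B a b" and C: "joins C a b"
    and AB: "A \<inter> B = {a, b}" and AC: "A \<inter> C = {a, b}" and BC: "B \<inter> C = {a, b}"
  shows "A - {a, b} \<subseteq> inside (B \<union> C) \<or> B - {a, b} \<subseteq> inside (A \<union> C) \<or> C - {a, b} \<subseteq> inside (A \<union> B)"
proof (rule ccontr)
  assume n: "\<not> ?thesis"
  have J: "jordan (A \<union> B)" "jordan (A \<union> C)" "jordan (B \<union> C)"
    using joins_loop A B C AB AC BC by blast+
  have out: "P - {a, b} \<subseteq> outside Q" if "joins P a b" "P \<inter> Q = {a, b}" "\<not> P - {a, b} \<subseteq> inside Q" for P Q
    using connected_inside_or_outside[OF joins_interior_connected[OF that(1)], of Q] that by blast
  have nA: "\<not> A - {a, b} \<subseteq> inside (B \<union> C)" and nB: "\<not> B - {a, b} \<subseteq> inside (A \<union> C)"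
    and nC: "\<not> C - {a, b} \<subseteq> inside (A \<union> B)" using n by simp_all
  have oA: "A - {a, b} \<subseteq> outside (B \<union> C)" by (rule out[OF A _ nA]) (use AB AC in blast)
  have oB: "B - {a, b} \<subseteq> outside (A \<union> C)" by (rule out[OF B _ nB]) (use AB BC in blast)
  have oC: "C - {a, b} \<subseteq> outside (A \<union> B)" by (rule out[OF C _ nC]) (use AC BC in blast)
  \<comment> \<open>The inside of \<open>A\<close> and \<open>B\<close> avoids \<open>C\<close>, so
    it lies on one side of the circle through \<open>P\<close> and \<open>C\<close>. If that were
    the inside, the closure would contain the remaining arc \<open>Q\<close>, which runs
    outside.\<close>
  have sep: "inside (A \<union> B) \<subseteq> outside (P \<union> C)" if "P = A \<and> Q = B \<or> P = B \<and> Q = A" for P Q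
  proof -
    have oQ: "Q - {a, b} \<subseteq> outside (P \<union> C)" "joins Q a b" "jordan (P \<union> C)" using that oA oB A B J by auto
    have ab: "a \<in> A \<union> B" "b \<in> A \<union> B" using joins_ends[OF A] by auto
    have "inside (A \<union> B) \<inter> C = {}" using oC inside_Int_outside[of "A \<union> B"] inside_no_overlap[of "A \<union> B"] ab by blast
    then have "inside (A \<union> B) \<inter> (P \<union> C) = {}" using that inside_no_overlap[of "A \<union> B"] by blast
    then have "inside (A \<union> B) \<subseteq> inside (P \<union> C) \<or> inside (A \<union> B) \<subseteq> outside (P \<union> C)"
      by (rule connected_inside_or_outside[OF jordanD(4)[OF J(1)]])
    moreover have "\<not> inside (A \<union> B) \<subseteq> inside (P \<union> C)"
    proof
      assume "inside (A \<union> B) \<subseteq> inside (P \<union> C)"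
      then have "closure (inside (A \<union> B)) \<subseteq> closure (inside (P \<union> C))" by (rule closure_mono)
      then have "A \<union> B \<subseteq> inside (P \<union> C) \<union> (P \<union> C)"
        using closure_inside_jordan[OF J(1)] closure_inside_jordan[OF oQ(3)] by blast
      moreover obtain z where "z \<in> Q - {a, b}" using joins_interior_nonempty[OF oQ(2)] by blast
      ultimately show False
        using oQ(1) that inside_Int_outside[of "P \<union> C"] outside_no_overlap[of "P \<union> C"] by blast
    qed
    ultimately show ?thesis by blast
  qed
  obtain q where q: "q \<in> inside (A \<union> B)" using jordanD(2)[OF J(1)] by blast
  have "bounded (A \<union> B \<union> C)" using A B C joins_compact compact_imp_bounded by (metis bounded_Un)
  then obtain w where w: "w \<in> outside (A \<union> B \<union> C)" using outside_bounded_nonempty by blast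
  have cc: "connected_component (- (P \<union> C)) q w" if "P = A \<or> P = B" for P
  proof -
    have "q \<in> outside (P \<union> C)" using sep[of A B] sep[of B A] q that by blast
    moreover have "w \<in> outside (P \<union> C)" using outside_mono[of "P \<union> C" "A \<union> B \<union> C"] w that by blast
    moreover have "connected (outside (P \<union> C))" using J jordanD(6) that by blast
    moreover have "outside (P \<union> C) \<subseteq> - (P \<union> C)" using outside_no_overlap[of "P \<union> C"] by blast
    ultimately show ?thesis unfolding connected_component_def by blast
  qed
  \<comment> \<open>Janiszewski's theorem asks for a connected intersection of the two circles,
    which is the arc \<open>C\<close>.\<close>
  have "(A \<union> C) \<inter> (B \<union> C) = (A \<inter> B) \<union> C" by blast
  then have "(A \<union> C) \<inter> (B \<union> C) = C" unfolding AB using joins_ends[OF C] by auto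
  then have "connected_component (- ((A \<union> C) \<union> (B \<union> C))) q w"
    using joins_connected[OF C]
    by (intro Janiszewski[OF jordanD(1)[OF J(2)] compact_imp_closed[OF jordanD(1)[OF J(3)]] _ cc cc]) simp_all
  then have "connected_component (- (A \<union> B)) q w"
    by (rule connected_component_of_subset) blast
  then have "w \<in> inside (A \<union> B)" using q inside_same_component by blast
  moreover have "w \<in> outside (A \<union> B)" using outside_mono[of "A \<union> B" "A \<union> B \<union> C"] w by blast
  ultimately show False using inside_Int_outside[of "A \<union> B"] by blast
qed

text \<open>\<open>C\<close> divides the inside of the circle into two regions, and the connected
  interior of \<open>D\<close> lies in one of them. But \<open>t\<close> is not in the closure of
  the region bounded by \<open>A\<close> and \<open>C\<close>, nor \<open>s\<close> in that of the
  other.\<close>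

lemma no_crossing_chords:
  assumes A: "joins A a b" and B: "joins B a b" and C: "joins C a b"
    and AB: "A \<inter> B = {a, b}" and AC: "A \<inter> C = {a, b}" and BC: "B \<inter> C = {a, b}"
    and D: "joins D s t" and s: "s \<in> A - {a, b}" and t: "t \<in> B - {a, b}" and CD: "C \<inter> D = {}"
    and Cin: "C - {a, b} \<subseteq> inside (A \<union> B)" and Din: "D - {s, t} \<subseteq> inside (A \<union> B)"
  shows False
proof -
  have neq: "a \<noteq> b" using joins_neq[OF A] .
  obtain g1 where g1: "simple_path g1" "pathstart g1 = a" "pathfinish g1 = b" "path_image g1 = A"
    using A arc_imp_simple_path unfolding joins_def by blast
  obtain g2 where g2: "simple_path g2" "pathstart g2 = a" "pathfinish g2 = b" "path_image g2 = B"
    using B arc_imp_simple_path unfolding joins_def by blast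
  obtain g3 where g3: "simple_path g3" "pathstart g3 = a" "pathfinish g3 = b" "path_image g3 = C"
    using C arc_imp_simple_path unfolding joins_def by blast
  have ne: "path_image g3 \<inter> inside (path_image g1 \<union> path_image g2) \<noteq> {}"
    using Cin joins_interior_nonempty[OF C] g1 g2 g3 by blast
  have split: "inside (A \<union> C) \<inter> inside (B \<union> C) = {}"
    "inside (A \<union> C) \<union> inside (B \<union> C) \<union> (C - {a, b}) = inside (A \<union> B)"
    by (rule split_inside_simple_closed_curve[OF g1(1-3) g2(1-3) g3(1-3) neq];
        use AB AC BC g1 g2 g3 ne in simp)+
  have J: "jordan (A \<union> C)" "jordan (B \<union> C)" using joins_loop A B C AC BC by blast+
  have sub: "D - {s, t} \<subseteq> inside (A \<union> C) \<union> inside (B \<union> C)" using Din split(2) CD by blast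
  have "D - {s, t} \<subseteq> inside (A \<union> C) \<or> D - {s, t} \<subseteq> inside (B \<union> C)"
    using connectedD[OF joins_interior_connected[OF D] jordanD(3)[OF J(1)] jordanD(3)[OF J(2)] _ sub] split(1) sub
    by blast
  then have "D \<subseteq> closure (inside (A \<union> C)) \<or> D \<subseteq> closure (inside (B \<union> C))"
    using joins_interior_closure[OF D] closure_mono by (meson order_trans)
  then have "D \<subseteq> inside (A \<union> C) \<union> (A \<union> C) \<or> D \<subseteq> inside (B \<union> C) \<union> (B \<union> C)"
    using closure_inside_jordan J by metis
  then have "t \<in> inside (A \<union> C) \<union> (A \<union> C) \<or> s \<in> inside (B \<union> C) \<union> (B \<union> C)"
    using joins_ends[OF D] by blast
  moreover have "t \<notin> A \<union> C" "s \<notin> B \<union> C" using s t AB AC BC by blast+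
  moreover have "t \<notin> inside (A \<union> B)" "s \<notin> inside (A \<union> B)" using s t inside_no_overlap[of "A \<union> B"] by blast+
  ultimately show False using split(2) by blast
qed

section \<open>Plane graphs\<close>

fun path_edges :: "'a list \<Rightarrow> 'a set set" where
  "path_edges (x # y # zs) = insert {x, y} (path_edges (y # zs))"
| "path_edges _ = {}"

lemma path_edges_append: "path_edges (xs @ y # zs) = path_edges (xs @ [y]) \<union> path_edges (y # zs)"
proof (induction xs)
  case (Cons x xs)
  then show ?case by (cases xs) auto
qed simp

lemma path_edges_rev: "path_edges (rev xs) = path_edges xs"
proof (induction xs rule: path_edges.induct)
  case (1 x y zs)
  have "path_edges (rev (x # y # zs)) = path_edges (rev zs @ y # [x])" by simp
  also have "\<dots> = path_edges (rev (y # zs)) \<union> {{y, x}}" by (subst path_edges_append) simp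
  finally show ?case using 1 by (simp add: insert_commute)
qed simp_all

lemma path_edges_subset: "e \<in> path_edges xs \<Longrightarrow> e \<subseteq> set xs"
  by (induction xs rule: path_edges.induct) auto

lemma path_edges_ends:
  assumes "{a, b} \<in> path_edges (a # u @ [b])" "distinct (a # u @ [b])"
  shows "u = []"
proof (rule ccontr)
  assume "u \<noteq> []"
  then obtain y u' where u: "u = y # u'" by (cases u) auto
  have "{a, b} \<in> path_edges (y # u' @ [b]) \<or> {a, b} = {a, y}" using assms u by auto
  then show False using assms(2) u path_edges_subset[of "{a, b}" "y # u' @ [b]"] by (auto simp: doubleton_eq_iff)
qed

text \<open>A consequence of lying on the boundary of the outer face; unlike that property, it
  refers only to closed curves in the drawing and is visibly inherited by subgraphs.\<close>

definition outer_point :: "complex set \<Rightarrow> complex \<Rightarrow> bool" where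
  "outer_point D z \<longleftrightarrow> (\<forall>J. jordan J \<and> J \<subseteq> D \<longrightarrow> z \<notin> inside J)"

text \<open>
  The vertices in \<open>U\<close> are those on the outer face; the remaining ones will be crossings, which are
  pairwise non-adjacent.
\<close>

locale plane_graph =
  fixes W :: "complex set" and F :: "complex set set" and h :: "complex set \<Rightarrow> complex set" and U :: "complex set"
  assumes finite_W: "finite W" and U_subset: "U \<subseteq> W"
    and edge: "e \<in> F \<Longrightarrow> \<exists>a b. e = {a, b} \<and> a \<in> W \<and> b \<in> W \<and> joins (h e) a b"
    and edge_W: "e \<in> F \<Longrightarrow> h e \<inter> W = e"
    and edge_int: "e \<in> F \<Longrightarrow> f \<in> F \<Longrightarrow> e \<noteq> f \<Longrightarrow> h e \<inter> h f \<subseteq> e \<inter> f"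
    and indep: "{a, b} \<in> F \<Longrightarrow> a \<in> U \<or> b \<in> U"
    and outer: "z \<in> U \<Longrightarrow> outer_point (\<Union>(h ` F)) z"
begin

lemma edge_joins: "{a, b} \<in> F \<Longrightarrow> joins (h {a, b}) a b"
  using edge[of "{a, b}"] joins_sym by (metis doubleton_eq_iff)

lemma edge_in_W: "{a, b} \<in> F \<Longrightarrow> a \<in> W \<and> b \<in> W"
  using edge[of "{a, b}"] by (metis doubleton_eq_iff)

lemma edge_neq: "{a, b} \<in> F \<Longrightarrow> a \<noteq> b"
  using edge_joins joins_neq by blast

definition vpath :: "complex list \<Rightarrow> bool" where
  "vpath xs \<longleftrightarrow> distinct xs \<and> set xs \<subseteq> W \<and> path_edges xs \<subseteq> F"

definition img :: "complex list \<Rightarrow> complex set" where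
  "img xs = \<Union>(h ` path_edges xs)"

lemma vpath_rev: "vpath (rev xs) \<longleftrightarrow> vpath xs"
  unfolding vpath_def path_edges_rev by simp

lemma vpath_joins:
  assumes "vpath (x # y # zs)"
  shows "joins (img (x # y # zs)) x (last (y # zs))"
  using assms
proof (induction zs arbitrary: x y)
  case Nil
  then show ?case using edge_joins unfolding vpath_def img_def by simp
next
  case (Cons z zs)
  have "vpath (y # z # zs)" using Cons.prems unfolding vpath_def by auto
  then have j: "joins (img (y # z # zs)) y (last (z # zs))" by (rule Cons.IH)
  have xy: "{x, y} \<in> F" using Cons.prems unfolding vpath_def by auto
  have "h {x, y} \<inter> h e \<subseteq> {y}" if e: "e \<in> path_edges (y # z # zs)" for e
  proof -
    have "e \<subseteq> set (y # z # zs)" using path_edges_subset e by blast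
    then have x: "x \<notin> e" using Cons.prems unfolding vpath_def by auto
    have "e \<in> F" using e Cons.prems unfolding vpath_def by auto
    then have "h {x, y} \<inter> h e \<subseteq> {x, y} \<inter> e" using edge_int[OF xy] x by blast
    then show ?thesis using x by blast
  qed
  then have "h {x, y} \<inter> img (y # z # zs) \<subseteq> {y}" unfolding img_def by blast
  then have "h {x, y} \<inter> img (y # z # zs) = {y}"
    using joins_ends(2)[OF edge_joins[OF xy]] joins_ends(1)[OF j] by blast
  then have "joins (h {x, y} \<union> img (y # z # zs)) x (last (z # zs))"
    using joins_join[OF edge_joins[OF xy] j] by blast
  then show ?case unfolding img_def by simp
qed

lemma vpath_joins':
  assumes "vpath (a # u @ [b])"
  shows "joins (img (a # u @ [b])) a b"
proof (cases u)
  case Nil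
  then show ?thesis using assms vpath_joins[of a b "[]"] by simp
next
  case (Cons y ys)
  then show ?thesis using assms vpath_joins[of a y "ys @ [b]"] by simp
qed

lemma img_Int:
  assumes "vpath xs" "vpath ys" "path_edges xs \<inter> path_edges ys = {}"
  shows "img xs \<inter> img ys \<subseteq> set xs \<inter> set ys"
proof
  fix z assume "z \<in> img xs \<inter> img ys"
  then obtain e f where ef: "e \<in> path_edges xs" "f \<in> path_edges ys" "z \<in> h e" "z \<in> h f" unfolding img_def by blast
  then have "z \<in> e \<inter> f" using edge_int[of e f] assms unfolding vpath_def by blast
  then show "z \<in> set xs \<inter> set ys" using path_edges_subset ef by blast
qed

lemma set_img:
  assumes "vpath (a # u @ [b])"
  shows "set u \<subseteq> img (a # u @ [b])"
proof
  fix z assume "z \<in> set u"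
  then obtain p q where u: "u = p @ z # q" by (meson split_list)
  obtain r rs where r: "q @ [b] = r # rs" by (cases q) auto
  have "a # u @ [b] = (a # p) @ z # r # rs" using u r by simp
  then have e: "{z, r} \<in> path_edges (a # u @ [b])" by (metis path_edges_append UnI2 path_edges.simps(1) insertI1)
  then have "{z, r} \<in> F" using assms unfolding vpath_def by auto
  then have "z \<in> h {z, r}" using joins_ends edge_joins by blast
  then show "z \<in> img (a # u @ [b])" unfolding img_def using e by blast
qed

text \<open>A shared edge would have both ends in \<open>{a, b}\<close> and thus be the edge
  \<open>ab\<close>, which would have to be the whole of both paths; the last hypothesis rules this
  out.\<close>

lemma paths_Int:
  assumes "vpath (a # u @ [b])" "vpath (a # v @ [b])" "set u \<inter> set v = {}" "u \<noteq> [] \<or> v \<noteq> []"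
  shows "img (a # u @ [b]) \<inter> img (a # v @ [b]) = {a, b}"
proof -
  have d: "distinct (a # u @ [b])" "distinct (a # v @ [b])" using assms unfolding vpath_def by auto
  have "path_edges (a # u @ [b]) \<inter> path_edges (a # v @ [b]) = {}"
  proof (rule ccontr)
    assume "\<not> ?thesis"
    then obtain e where e: "e \<in> path_edges (a # u @ [b])" "e \<in> path_edges (a # v @ [b])" by blast
    then have "e \<subseteq> set (a # u @ [b]) \<inter> set (a # v @ [b])" using path_edges_subset by blast
    then have "e \<subseteq> {a, b}" using assms(3) by auto
    have "e \<in> F" using e assms(1) unfolding vpath_def by blast
    then obtain x y where xy: "e = {x, y}" "joins (h e) x y" using edge by blast
    then have "e = {a, b}" using joins_neq[OF xy(2)] \<open>e \<subseteq> {a, b}\<close> by auto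
    then show False using path_edges_ends[OF _ d(1)] path_edges_ends[OF _ d(2)] e assms(4) by metis
  qed
  then have "img (a # u @ [b]) \<inter> img (a # v @ [b]) \<subseteq> set (a # u @ [b]) \<inter> set (a # v @ [b])"
    by (rule img_Int[OF assms(1,2)])
  moreover have "set (a # u @ [b]) \<inter> set (a # v @ [b]) = {a, b}" using assms(3) d by auto
  ultimately show ?thesis
    using joins_ends[OF vpath_joins'[OF assms(1)]] joins_ends[OF vpath_joins'[OF assms(2)]] by blast
qed

lemma img_D: "vpath xs \<Longrightarrow> img xs \<subseteq> \<Union>(h ` F)"
  unfolding vpath_def img_def by blast

lemma not_inside_paths:
  assumes "vpath (a # u @ [b])" "vpath (a # v @ [b])" "vpath (a # w @ [b])"
    and "set v \<inter> set w = {}" "v \<noteq> [] \<or> w \<noteq> []" "set u \<inter> U \<noteq> {}"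
  shows "\<not> img (a # u @ [b]) - {a, b} \<subseteq> inside (img (a # v @ [b]) \<union> img (a # w @ [b]))"
proof
  assume i: "img (a # u @ [b]) - {a, b} \<subseteq> inside (img (a # v @ [b]) \<union> img (a # w @ [b]))"
  obtain z where z: "z \<in> set u" "z \<in> U" using assms(6) by blast
  then have "z \<in> img (a # u @ [b]) - {a, b}" using set_img[OF assms(1)] assms(1) unfolding vpath_def by auto
  moreover have "jordan (img (a # v @ [b]) \<union> img (a # w @ [b]))"
    using joins_loop[OF vpath_joins'[OF assms(2)] vpath_joins'[OF assms(3)] paths_Int[OF assms(2-5)]] .
  moreover have "img (a # v @ [b]) \<union> img (a # w @ [b]) \<subseteq> \<Union>(h ` F)" using img_D assms by blast
  ultimately show False using outer[OF z(2)] i unfolding outer_point_def by blast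
qed

text \<open>By \<open>theta_inside\<close> some path runs inside the other two, and a path through
  an outer vertex cannot be that one.\<close>

lemma theta_paths:
  assumes p: "vpath (a # u @ [b])" "vpath (a # v @ [b])" "vpath (a # w @ [b])"
    and d: "set u \<inter> set v = {}" "set u \<inter> set w = {}" "set v \<inter> set w = {}"
    and uv: "set u \<inter> U \<noteq> {}" "set v \<inter> U \<noteq> {}"
  shows "img (a # w @ [b]) - {a, b} \<subseteq> inside (img (a # u @ [b]) \<union> img (a # v @ [b]))"
proof -
  have ne: "u \<noteq> []" "v \<noteq> []" using uv by auto
  have "img (a # u @ [b]) \<inter> img (a # v @ [b]) = {a, b}" "img (a # u @ [b]) \<inter> img (a # w @ [b]) = {a, b}"
    "img (a # v @ [b]) \<inter> img (a # w @ [b]) = {a, b}"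
    using paths_Int p d ne by simp_all
  from theta_inside[OF vpath_joins'[OF p(1)] vpath_joins'[OF p(2)] vpath_joins'[OF p(3)] this]
  show ?thesis
    using not_inside_paths[OF p(1,2,3)] not_inside_paths[OF p(2,1,3)] d ne uv by blast
qed

text \<open>The counterpart of the fact that an outerplanar graph contains no subdivision of
  K_{2,3}.\<close>

lemma theta_paths_False:
  assumes p: "vpath (a # u @ [b])" "vpath (a # v @ [b])" "vpath (a # w @ [b])"
    and d: "set u \<inter> set v = {}" "set u \<inter> set w = {}" "set v \<inter> set w = {}"
    and uv: "set u \<inter> U \<noteq> {}" "set v \<inter> U \<noteq> {}" "set w \<inter> U \<noteq> {}"
  shows False
proof -
  have "u \<noteq> []" using uv by auto
  then show False using theta_paths[OF p d uv(1,2)] not_inside_paths[OF p(3,1,2) d(1) _ uv(3)] by blast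
qed

text \<open>
  A closed walk \<open>a, u\<^sub>1, s, u\<^sub>2, b, v\<^sub>2, t, v\<^sub>1\<close> with two disjoint chords, from \<open>a\<close> to \<open>b\<close>
  and from \<open>s\<close> to \<open>t\<close>.
\<close>

lemma chords_False:
  assumes c: "vpath (a # u1 @ s # u2 @ [b])" "vpath (a # v1 @ t # v2 @ [b])"
    and m: "vpath (a # m @ [b])" "vpath (s # n @ [t])"
    and d: "set (u1 @ s # u2) \<inter> set (v1 @ t # v2) = {}"
      "set m \<inter> (set (u1 @ s # u2) \<union> set (v1 @ t # v2)) = {}"
      "set n \<inter> (set (a # u1 @ s # u2 @ [b]) \<union> set (v1 @ t # v2)) = {}" "set m \<inter> set n = {}"
    and o1: "set (u1 @ s # u2) \<inter> U \<noteq> {}" "set (v1 @ t # v2) \<inter> U \<noteq> {}"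
    and o2: "(set u1 \<union> {a} \<union> set v1) \<inter> U \<noteq> {}" "(set u2 \<union> {b} \<union> set v2) \<inter> U \<noteq> {}"
  shows False
proof -
  let ?A = "img (a # u1 @ s # u2 @ [b])" and ?B = "img (a # v1 @ t # v2 @ [b])"
  let ?C = "img (a # m @ [b])" and ?D = "img (s # n @ [t])"
  have A: "joins ?A a b" "joins ?B a b" "joins ?C a b" "joins ?D s t"
    using vpath_joins'[of a "u1 @ s # u2" b] vpath_joins'[of a "v1 @ t # v2" b] vpath_joins' c m by simp_all
  have Cin: "?C - {a, b} \<subseteq> inside (?A \<union> ?B)"
    using theta_paths[of a "u1 @ s # u2" b "v1 @ t # v2" m] c m d o1 by (simp add: Int_commute Int_Un_distrib Int_Un_distrib2)
  \<comment> \<open>The same closed walk, read as two paths from \<open>s\<close> to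
    \<open>t\<close>. This lets \<open>theta_paths\<close> place the second chord inside as
    well.\<close>
  let ?L = "s # (rev u1 @ a # v1) @ [t]" and ?R = "s # (u2 @ b # rev v2) @ [t]"
  have eA: "path_edges (a # u1 @ s # u2 @ [b]) = path_edges (a # u1 @ [s]) \<union> path_edges (s # u2 @ [b])"
    using path_edges_append[of "a # u1" s "u2 @ [b]"] by simp
  have eB: "path_edges (a # v1 @ t # v2 @ [b]) = path_edges (a # v1 @ [t]) \<union> path_edges (t # v2 @ [b])"
    using path_edges_append[of "a # v1" t "v2 @ [b]"] by simp
  have eL: "path_edges ?L = path_edges (a # u1 @ [s]) \<union> path_edges (a # v1 @ [t])"
    using path_edges_append[of "s # rev u1" a "v1 @ [t]"] path_edges_rev[of "a # u1 @ [s]"] by simp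
  have eR: "path_edges ?R = path_edges (s # u2 @ [b]) \<union> path_edges (t # v2 @ [b])"
    using path_edges_append[of "s # u2" b "rev v2 @ [t]"] path_edges_rev[of "t # v2 @ [b]"] by simp
  have vL: "vpath ?L" and vR: "vpath ?R"
    using c d(1) unfolding vpath_def eL eR eA eB by auto
  have img: "img ?L \<union> img ?R = ?A \<union> ?B" unfolding img_def eL eR eA eB by blast
  have "?D - {s, t} \<subseteq> inside (img ?L \<union> img ?R)"
  proof (rule theta_paths[OF vL vR m(2)])
    have "distinct (a # u1 @ s # u2 @ [b])" "distinct (a # v1 @ t # v2 @ [b])" using c unfolding vpath_def by auto
    then show "set (rev u1 @ a # v1) \<inter> set (u2 @ b # rev v2) = {}" using d(1) by auto
    show "set (rev u1 @ a # v1) \<inter> set n = {}" "set (u2 @ b # rev v2) \<inter> set n = {}" using d(3) by auto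
    show "set (rev u1 @ a # v1) \<inter> U \<noteq> {}" "set (u2 @ b # rev v2) \<inter> U \<noteq> {}" using o2 by auto
  qed
  then have Din: "?D - {s, t} \<subseteq> inside (?A \<union> ?B)" unfolding img .
  have ne: "u1 @ s # u2 \<noteq> []" "v1 @ t # v2 \<noteq> []" by auto
  have dc: "distinct (a # u1 @ s # u2 @ [b])" "distinct (a # v1 @ t # v2 @ [b])" using c unfolding vpath_def by auto
  have AB: "?A \<inter> ?B = {a, b}" using paths_Int[of a "u1 @ s # u2" b "v1 @ t # v2"] c d(1) by simp
  have AC: "?A \<inter> ?C = {a, b}" using paths_Int[of a "u1 @ s # u2" b m] c m d(2) by auto
  have BC: "?B \<inter> ?C = {a, b}" using paths_Int[of a "v1 @ t # v2" b m] c m d(2) by auto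
  have disj: "set (a # m @ [b]) \<inter> set (s # n @ [t]) = {}" using d dc by auto
  have "path_edges (a # m @ [b]) \<inter> path_edges (s # n @ [t]) = {}"
  proof (rule ccontr)
    assume "\<not> ?thesis"
    then obtain e where e: "e \<in> path_edges (a # m @ [b])" "e \<in> path_edges (s # n @ [t])" by blast
    then have "e \<subseteq> {}" using path_edges_subset disj by blast
    moreover have "e \<in> F" using e m unfolding vpath_def by blast
    ultimately show False using edge[of e] by auto
  qed
  then have CD: "?C \<inter> ?D = {}" using img_Int[OF m] disj by blast
  have s: "s \<in> ?A - {a, b}" using set_img[of a "u1 @ s # u2" b] c dc by auto
  have t: "t \<in> ?B - {a, b}" using set_img[of a "v1 @ t # v2" b] c dc by auto
  show False by (rule no_crossing_chords[OF A(1-3) AB AC BC A(4) s t CD Cin Din])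
qed

end

lemma path_edges_append2:
  "path_edges (xs @ ys) = path_edges xs \<union> path_edges ys \<union> (if xs = [] \<or> ys = [] then {} else {{last xs, hd ys}})"
proof (induction xs)
  case (Cons x xs)
  then show ?case by (cases xs; cases ys) auto
qed simp

lemma path_edges_nth: "Suc i < length xs \<Longrightarrow> {xs ! i, xs ! Suc i} \<in> path_edges xs"
proof (induction xs arbitrary: i rule: path_edges.induct)
  case (1 x y zs)
  then show ?case by (cases i) auto
qed auto

definition slice :: "'a list \<Rightarrow> nat \<Rightarrow> nat \<Rightarrow> 'a list" where
  "slice C p q = take (q - p) (drop p C)"

lemma set_slice: "q \<le> length C \<Longrightarrow> set (slice C p q) = nth C ` {p..<q}"
proof (intro subset_antisym subsetI)
  fix x assume q: "q \<le> length C" and "x \<in> set (slice C p q)"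
  then obtain i where "i < q - p" "x = C ! (p + i)" unfolding slice_def by (auto simp: in_set_conv_nth)
  then show "x \<in> nth C ` {p..<q}" by (intro image_eqI[of _ _ "p + i"]) auto
next
  fix x assume q: "q \<le> length C" and "x \<in> nth C ` {p..<q}"
  then obtain r where r: "p \<le> r" "r < q" "x = C ! r" by auto
  then have "slice C p q ! (r - p) = x" "r - p < length (slice C p q)" using q unfolding slice_def by auto
  then show "x \<in> set (slice C p q)" by (metis nth_mem)
qed

lemma slice_split:
  assumes "p \<le> i" "i < q" "q \<le> length C"
  shows "slice C p q = slice C p i @ C ! i # slice C (Suc i) q"
proof -
  have "slice C p q = take (i - p) (drop p C) @ take (q - i) (drop i C)"
    unfolding slice_def using assms take_add[of "i - p" "q - i" "drop p C"] by simp
  moreover have "take (q - i) (drop i C) = C ! i # take (q - Suc i) (drop (Suc i) C)"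
    using assms by (metis Cons_nth_drop_Suc Suc_diff_Suc less_le_trans take_Suc_Cons)
  ultimately show ?thesis unfolding slice_def by simp
qed

lemma slice_all: "slice C 0 (length C) = C"
  unfolding slice_def by simp

context plane_graph
begin

section \<open>A cycle through all outer vertices\<close>

definition cyc :: "complex list \<Rightarrow> bool" where
  "cyc C \<longleftrightarrow> vpath C \<and> 3 \<le> length C \<and> {last C, hd C} \<in> F"

lemma cyc_rotate:
  assumes "cyc (xs @ y # ys)"
  shows "cyc (y # ys @ xs)"
proof (cases "xs = []")
  case False
  have "path_edges (xs @ y # ys) = path_edges xs \<union> path_edges (y # ys) \<union> {{last xs, y}}"
    using False by (subst path_edges_append2) auto
  moreover have "path_edges (y # ys @ xs) = path_edges (y # ys) \<union> path_edges xs \<union> {{last (y # ys), hd xs}}"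
    using False path_edges_append2[of "y # ys" xs] by auto
  ultimately show ?thesis using assms False unfolding cyc_def vpath_def by auto
qed (use assms in simp)

lemma cyc_arcs:
  assumes "cyc (a # X @ b # Y)"
  shows "vpath (a # X @ [b])" "vpath (a # rev Y @ [b])"
proof -
  have e: "path_edges (a # X @ b # Y) = path_edges (a # X @ [b]) \<union> path_edges (b # Y)"
    using path_edges_append[of "a # X" b Y] by simp
  then show "vpath (a # X @ [b])" using assms unfolding cyc_def vpath_def by auto
  have "path_edges (b # Y @ [a]) = path_edges (b # Y) \<union> {{last (b # Y), a}}"
    using path_edges_append2[of "b # Y" "[a]"] by auto
  then have "vpath (b # Y @ [a])" using assms e unfolding cyc_def vpath_def by auto
  then show "vpath (a # rev Y @ [b])" using vpath_rev[of "b # Y @ [a]"] by simp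
qed

text \<open>\<open>s\<close> and \<open>t\<close> cut the cycle into two arcs. By
  \<open>theta_paths_False\<close> one of them has no inner vertex in \<open>U\<close>; replacing it
  by the path through \<open>m\<close> loses no outer vertex and gains one.\<close>

lemma larger_cycle:
  assumes C: "cyc C" and st: "s \<in> set C" "t \<in> set C" "s \<noteq> t"
    and m: "vpath (s # m @ [t])" "set m \<inter> set C = {}" "set m \<inter> U \<noteq> {}"
  shows "\<exists>C'. cyc C' \<and> card (set C \<inter> U) < card (set C' \<inter> U)"
proof -
  obtain xs ys where C1: "C = xs @ s # ys" using st by (meson split_list)
  then have "cyc (s # ys @ xs)" using C cyc_rotate by blast
  moreover have "t \<in> set (ys @ xs)" using st C1 by auto
  then obtain A B where AB: "ys @ xs = A @ t # B" by (meson split_list)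
  ultimately have c: "cyc (s # A @ t # B)" by simp
  have "set C = insert s (set (ys @ xs))" using C1 by auto
  then have setC: "set C = {s, t} \<union> set A \<union> set B" unfolding AB by auto
  have dist: "distinct (s # A @ t # B)" "distinct (s # m @ [t])" using c m unfolding cyc_def vpath_def by auto
  have mne: "m \<noteq> []" using m by auto
  have less: "card (set C \<inter> U) < card (set C' \<inter> U)" if "set C \<inter> U \<subseteq> set C'" "set m \<subseteq> set C'" for C'
    by (rule psubset_card_mono) (use that m in auto)
  show ?thesis
  proof (cases "set A \<inter> U = {}")
    case True
    have e: "path_edges (s # m @ t # B) = path_edges (s # m @ [t]) \<union> path_edges (t # B)"
      using path_edges_append[of "s # m" t B] by simp
    have "path_edges (s # A @ t # B) = path_edges (s # A @ [t]) \<union> path_edges (t # B)"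
      using path_edges_append[of "s # A" t B] by simp
    then have "cyc (s # m @ t # B)"
      using c m dist mne setC unfolding cyc_def vpath_def e by (cases m) auto
    moreover have "card (set C \<inter> U) < card (set (s # m @ t # B) \<inter> U)"
      by (rule less) (use setC True in auto)
    ultimately show ?thesis by blast
  next
    case A: False
    show ?thesis
    proof (cases "set B \<inter> U = {}")
      case True
      have e: "path_edges (s # A @ t # rev m) = path_edges (s # A @ [t]) \<union> path_edges (t # rev m)"
        using path_edges_append[of "s # A" t "rev m"] by simp
      have e1: "path_edges (s # A @ t # B) = path_edges (s # A @ [t]) \<union> path_edges (t # B)"
        using path_edges_append[of "s # A" t B] by simp
      have e2: "path_edges (s # m @ [t]) = path_edges (t # rev m) \<union> {{s, hd m}}"
        using path_edges_rev[of "s # m @ [t]"] path_edges_append2[of "t # rev m" "[s]"] mne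
        by (auto simp: last_rev insert_commute)
      have "last (s # A @ t # rev m) = hd m" using mne by (simp add: last_rev)
      moreover have "distinct (s # A @ t # rev m)" using dist m(2) setC by auto
      moreover have "set (s # A @ t # rev m) \<subseteq> W" using c m unfolding cyc_def vpath_def by auto
      moreover have "path_edges (s # A @ t # rev m) \<subseteq> F"
        using c m e1 e2 unfolding cyc_def vpath_def e by blast
      moreover have "{hd m, s} \<in> F" using m(1) e2 unfolding vpath_def by (simp add: insert_commute)
      moreover have "3 \<le> length (s # A @ t # rev m)" using mne by (cases m) auto
      ultimately have "cyc (s # A @ t # rev m)" unfolding cyc_def vpath_def by simp
      moreover have "card (set C \<inter> U) < card (set (s # A @ t # rev m) \<inter> U)"
        by (rule less) (use setC True in auto)
      ultimately show ?thesis by blast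
    next
      case False
      have "False"
        by (rule theta_paths_False[OF cyc_arcs[OF c] m(1)]) (use A False m dist setC in auto)
      then show ?thesis ..
    qed
  qed
qed

definition nb :: "complex set \<Rightarrow> complex set" where
  "nb D = {y \<in> W - D. \<exists>x\<in>D. {x, y} \<in> F}"

definition adj_in :: "complex set \<Rightarrow> (complex \<times> complex) set" where
  "adj_in S = {(u, v). u \<in> S \<and> v \<in> S \<and> {u, v} \<in> F}"

lemma adj_in_sym: "(x, y) \<in> (adj_in S)\<^sup>* \<Longrightarrow> (y, x) \<in> (adj_in S)\<^sup>*"
proof -
  have "sym (adj_in S)" unfolding adj_in_def sym_def by (auto simp: insert_commute)
  then show "(x, y) \<in> (adj_in S)\<^sup>* \<Longrightarrow> (y, x) \<in> (adj_in S)\<^sup>*" using sym_rtrancl by (meson symD)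
qed

lemma path_within:
  assumes "(x, y) \<in> (adj_in S)\<^sup>*" "x \<in> S" "S \<subseteq> W"
  obtains xs where "vpath xs" "xs \<noteq> []" "hd xs = x" "last xs = y" "set xs \<subseteq> S"
proof -
  have "\<exists>xs. vpath xs \<and> xs \<noteq> [] \<and> hd xs = x \<and> last xs = y \<and> set xs \<subseteq> S"
    using assms(1)
  proof induction
    case base
    show ?case using assms by (intro exI[of _ "[x]"]) (auto simp: vpath_def)
  next
    case (step y z)
    then obtain xs where xs: "vpath xs" "xs \<noteq> []" "hd xs = x" "last xs = y" "set xs \<subseteq> S" by blast
    have z: "z \<in> S" "{y, z} \<in> F" using step(2) unfolding adj_in_def by auto
    show ?case
    proof (cases "z \<in> set xs")
      case True
      then obtain p q where pq: "xs = p @ z # q" by (meson split_list)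
      have "path_edges xs = path_edges (p @ [z]) \<union> path_edges (z # q)" unfolding pq by (rule path_edges_append)
      then have "vpath (p @ [z])" using xs(1) pq unfolding vpath_def by auto
      moreover have "hd (p @ [z]) = x" using xs(3) pq by (cases p) auto
      ultimately show ?thesis using xs(5) pq by (intro exI[of _ "p @ [z]"]) auto
    next
      case False
      have "vpath (xs @ [z])" using xs False z assms(3) unfolding vpath_def path_edges_append2 by auto
      then show ?thesis using xs z by (intro exI[of _ "xs @ [z]"]) auto
    qed
  qed
  then show ?thesis using that by blast
qed

text \<open>2-connectedness in terms of neighbourhoods: a neighbourhood that separates
  \<open>D\<close> from something has at least two vertices.\<close>

definition tight :: bool where
  "tight \<longleftrightarrow> (\<forall>D\<subseteq>W. D \<noteq> {} \<longrightarrow> W - D - nb D \<noteq> {} \<longrightarrow> (\<exists>s\<in>nb D. \<exists>t\<in>nb D. s \<noteq> t))"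

lemma two_neighbours:
  assumes tight "D \<subseteq> W" "D \<noteq> {}" "p \<in> W - D" "q \<in> W - D" "p \<noteq> q"
  obtains s t where "s \<in> nb D" "t \<in> nb D" "s \<noteq> t"
proof (cases "W - D - nb D = {}")
  case True
  then have "p \<in> nb D" "q \<in> nb D" using assms by auto
  then show ?thesis using that assms by blast
next
  case False
  then show ?thesis using that assms unfolding tight_def by blast
qed

lemma nb_reach: "nb {y. (w, y) \<in> (adj_in S)\<^sup>*} \<inter> S = {}" if "w \<in> S"
proof -
  have "y \<in> {y. (w, y) \<in> (adj_in S)\<^sup>*}" if y: "(w, x) \<in> (adj_in S)\<^sup>*" "{x, y} \<in> F" "y \<in> S" for x y
  proof -
    have "x \<in> S" using y(1) \<open>w \<in> S\<close> by (induction) (auto simp: adj_in_def)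
    then have "(x, y) \<in> adj_in S" using y unfolding adj_in_def by blast
    then show ?thesis using y(1) by (simp add: rtrancl.rtrancl_into_rtrancl)
  qed
  then show ?thesis unfolding nb_def by blast
qed

lemma reach_subset: "w \<in> S \<Longrightarrow> {y. (w, y) \<in> (adj_in S)\<^sup>*} \<subseteq> S"
proof
  fix y assume w: "w \<in> S" "y \<in> {y. (w, y) \<in> (adj_in S)\<^sup>*}"
  then have "(w, y) \<in> (adj_in S)\<^sup>*" by simp
  then show "y \<in> S" by induction (use w in \<open>auto simp: adj_in_def\<close>)
qed

lemma vpath_Cons: "vpath xs \<Longrightarrow> xs \<noteq> [] \<Longrightarrow> s \<in> W \<Longrightarrow> s \<notin> set xs \<Longrightarrow> {s, hd xs} \<in> F \<Longrightarrow> vpath (s # xs)"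
  unfolding vpath_def by (cases xs) auto

lemma vpath_snoc: "vpath xs \<Longrightarrow> xs \<noteq> [] \<Longrightarrow> t \<in> W \<Longrightarrow> t \<notin> set xs \<Longrightarrow> {last xs, t} \<in> F \<Longrightarrow> vpath (xs @ [t])"
  unfolding vpath_def path_edges_append2 by auto

text \<open>The component of \<open>w\<close> off the cycle has two attachment vertices by
  tightness, hence a path between them. What needs care is that this path meets \<open>U\<close>,
  for it need not contain \<open>w\<close>.\<close>

lemma outer_ear:
  assumes tight and C: "cyc C" and w: "w \<in> U" "w \<notin> set C"
  obtains s t m where "s \<in> set C" "t \<in> set C" "s \<noteq> t" "vpath (s # m @ [t])" "set m \<inter> set C = {}" "set m \<inter> U \<noteq> {}"
proof -
  have CW: "set C \<subseteq> W" "distinct C" "3 \<le> length C" using C unfolding cyc_def vpath_def by auto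
  then have "0 < length C" "1 < length C" by auto
  then have "C ! 0 \<noteq> C ! 1" "C ! 0 \<in> set C" "C ! 1 \<in> set C"
    using CW(2) nth_eq_iff_index_eq[of C 0 1] by (auto intro: nth_mem)
  then obtain p q where pq: "p \<in> set C" "q \<in> set C" "p \<noteq> q" by blast
  define S where "S = W - set C"
  define D where "D = {y. (w, y) \<in> (adj_in S)\<^sup>*}"
  have wS: "w \<in> S" using w U_subset unfolding S_def by auto
  have DS: "D \<subseteq> S" unfolding D_def by (rule reach_subset[OF wS])
  have "nb D \<inter> S = {}" unfolding D_def by (rule nb_reach[OF wS])
  moreover have "nb D \<subseteq> W" unfolding nb_def by blast
  ultimately have nbD: "nb D \<subseteq> set C" unfolding S_def by blast
  have "w \<in> D" unfolding D_def by simp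
  obtain s t where st: "s \<in> nb D" "t \<in> nb D" "s \<noteq> t"
    by (rule two_neighbours[OF assms(1), of D p q]) (use DS \<open>w \<in> D\<close> pq CW in \<open>auto simp: S_def\<close>)
  obtain xs' where xs': "xs' \<in> D" "{xs', s} \<in> F" using st(1) unfolding nb_def by blast
  obtain xt where xt: "xt \<in> D" "{xt, t} \<in> F" using st(2) unfolding nb_def by blast
  have "(xs', xt) \<in> (adj_in S)\<^sup>*"
    using adj_in_sym[of w xs' S] xs'(1) xt(1) unfolding D_def by (meson mem_Collect_eq rtrancl_trans)
  then obtain m where m: "vpath m" "m \<noteq> []" "hd m = xs'" "last m = xt" "set m \<subseteq> S"
    using path_within[of xs' xt S] xs' DS unfolding S_def by blast
  have stC: "s \<in> set C" "t \<in> set C" "s \<in> W" "t \<in> W" using st nbD CW by auto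
  have mC: "set m \<inter> set C = {}" using m unfolding S_def by auto
  have v: "vpath (s # m @ [t])"
    using vpath_snoc[of "s # m" t] vpath_Cons[of m s] m stC mC st(3) xs' xt by (auto simp: insert_commute)
  show ?thesis
  proof (cases "set m \<inter> U = {}")
    case False
    then show ?thesis using that stC st v mC by blast
  next
    case True
    \<comment> \<open>Vertices outside \<open>U\<close> are pairwise non-adjacent, so a path without
      outer vertices has length one.\<close>
    obtain x where x: "m = [x]"
    proof (cases m)
      case (Cons x r)
      show ?thesis
      proof (cases r)
        case Nil then show ?thesis using Cons that by simp
      next
        case (Cons y r')
        then have "{x, y} \<in> F" using \<open>m = x # r\<close> m(1) unfolding vpath_def by auto
        then show ?thesis using indep True \<open>m = x # r\<close> Cons by auto
      qed
    qed (use m in simp)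
    have xD: "x \<in> D" "x \<notin> U" "x = xs'" "x = xt" using xs' m x True by auto
    have "x \<noteq> w" using xD w by auto
    have "(x, w) \<in> (adj_in S)\<^sup>*" using xD(1) adj_in_sym unfolding D_def by blast
    then obtain w' where w': "(x, w') \<in> adj_in S" using \<open>x \<noteq> w\<close> by (metis converse_rtranclE)
    then have w'S: "w' \<in> S" "{x, w'} \<in> F" unfolding adj_in_def by auto
    then have w'U: "w' \<in> U" "w' \<noteq> x" using indep xD edge_neq by blast+
    \<comment> \<open>The path is rerouted through an outer neighbour \<open>w'\<close> of
      \<open>x\<close>. Without \<open>x\<close> and the cycle, the component of \<open>w'\<close>
      still has two attachment vertices, so one of them, \<open>z\<close>, lies on the cycle. The
      other end of the new path is whichever of \<open>s\<close>, \<open>t\<close> differs from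
      \<open>z\<close>.\<close>
    define S2 where "S2 = W - set C - {x}"
    define D2 where "D2 = {y. (w', y) \<in> (adj_in S2)\<^sup>*}"
    have w'S2: "w' \<in> S2" using w'S w'U unfolding S_def S2_def by auto
    have DS2: "D2 \<subseteq> S2" unfolding D2_def by (rule reach_subset[OF w'S2])
    have "nb D2 \<inter> S2 = {}" unfolding D2_def by (rule nb_reach[OF w'S2])
    moreover have "nb D2 \<subseteq> W" unfolding nb_def by blast
    ultimately have nbD2: "nb D2 \<subseteq> set C \<union> {x}" unfolding S2_def by blast
    have "w' \<in> D2" unfolding D2_def by simp
    obtain s2 t2 where st2: "s2 \<in> nb D2" "t2 \<in> nb D2" "s2 \<noteq> t2"
      by (rule two_neighbours[OF assms(1), of D2 p q]) (use DS2 \<open>w' \<in> D2\<close> pq CW in \<open>auto simp: S2_def\<close>)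
    then obtain z where z: "z \<in> nb D2" "z \<in> set C" using nbD2 by blast
    then obtain yz where yz: "yz \<in> D2" "{yz, z} \<in> F" unfolding nb_def by blast
    obtain ys where ys: "vpath ys" "ys \<noteq> []" "hd ys = w'" "last ys = yz" "set ys \<subseteq> S2"
      using path_within[of w' yz S2] yz w'S2 unfolding D2_def S2_def by blast
    obtain e where e: "e \<in> {s, t}" "e \<noteq> z" using st(3) by blast
    have eC: "e \<in> set C" "e \<in> W" "{e, x} \<in> F" using e stC xs' xt xD by (auto simp: insert_commute)
    have xS: "x \<in> W" "x \<notin> set C" using xD DS unfolding S_def by auto
    have 1: "vpath (x # ys)" by (rule vpath_Cons) (use ys w'S xS in \<open>auto simp: S2_def\<close>)
    have 2: "vpath ((x # ys) @ [z])"
      by (rule vpath_snoc[OF 1]) (use ys yz z CW xS in \<open>auto simp: S2_def\<close>)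
    have 3: "vpath (e # (x # ys) @ [z])"
      by (rule vpath_Cons[OF 2]) (use eC ys z e xS in \<open>auto simp: S2_def\<close>)
    have "w' \<in> set (x # ys)" using ys by (metis hd_in_set list.set_intros(2))
    then show ?thesis
      using that[of e z "x # ys"] eC z e 3 ys w'U xS by (auto simp: S2_def)
  qed
qed

lemma cycle_through_outer:
  assumes tight "4 \<le> card U"
  obtains C where "cyc C" "U \<subseteq> set C"
proof -
  have finU: "finite U" using U_subset finite_W finite_subset by blast
  obtain w where w: "w \<in> U" using assms(2) by fastforce
  have "2 \<le> card (U - {w})" using assms(2) w finU by simp
  then obtain T where "T \<subseteq> U - {w}" "card T = 2" using obtain_subset_with_card_n by metis
  then obtain p q where pq: "p \<in> U - {w}" "q \<in> U - {w}" "p \<noteq> q" by (auto simp: card_2_iff)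
  have wW: "w \<in> W" using w U_subset by auto
  obtain s t where st: "s \<in> nb {w}" "t \<in> nb {w}" "s \<noteq> t"
    by (rule two_neighbours[OF assms(1), of "{w}" p q]) (use pq wW U_subset in auto)
  then have ws: "{w, s} \<in> F" "{w, t} \<in> F" "s \<in> W - {w}" "t \<in> W - {w}" unfolding nb_def by auto
  \<comment> \<open>Everything reachable from \<open>s\<close> without \<open>w\<close> has at most
    the neighbour \<open>w\<close>, so by tightness nothing else is left, and \<open>t\<close> is
    reached. Together with \<open>w\<close> this path closes to a cycle.\<close>
  define D where "D = {y. (s, y) \<in> (adj_in (W - {w}))\<^sup>*}"
  have DS: "D \<subseteq> W - {w}" unfolding D_def by (rule reach_subset[OF ws(3)])
  have "nb D \<inter> (W - {w}) = {}" unfolding D_def by (rule nb_reach[OF ws(3)])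
  moreover have "nb D \<subseteq> W" unfolding nb_def by blast
  ultimately have nbD: "nb D \<subseteq> {w}" by blast
  have "s \<in> D" unfolding D_def by simp
  have "W - D - nb D = {}"
  proof (rule ccontr)
    assume "W - D - nb D \<noteq> {}"
    then obtain x y where "x \<in> nb D" "y \<in> nb D" "x \<noteq> y" using assms(1) DS \<open>s \<in> D\<close> unfolding tight_def by blast
    then show False using nbD by blast
  qed
  then have "t \<in> D" using nbD ws by blast
  then obtain xs where xs: "vpath xs" "xs \<noteq> []" "hd xs = s" "last xs = t" "set xs \<subseteq> W - {w}"
    using path_within[of s t "W - {w}"] ws unfolding D_def by blast
  have "2 \<le> length xs"
  proof (cases xs)
    case (Cons a r)
    then show ?thesis using xs st(3) by (cases r) auto
  qed (use xs in simp)
  moreover have "vpath (w # xs)" by (rule vpath_Cons) (use xs ws wW in auto)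
  ultimately have c0: "cyc (w # xs)" unfolding cyc_def using xs ws by (auto simp: insert_commute)
  have "card (set C \<inter> U) < card U + 1" for C
    using card_mono[OF finU, of "set C \<inter> U"] by simp
  then obtain C where C: "cyc C" "\<And>C'. cyc C' \<Longrightarrow> card (set C' \<inter> U) \<le> card (set C \<inter> U)"
    using ex_has_greatest_nat[of cyc "w # xs" "\<lambda>C. card (set C \<inter> U)" "card U + 1"] c0 by (metis less_imp_le)
  have "U \<subseteq> set C"
  proof
    fix v assume v: "v \<in> U"
    show "v \<in> set C"
    proof (rule ccontr)
      assume "v \<notin> set C"
      then obtain s t m where "s \<in> set C" "t \<in> set C" "s \<noteq> t" "vpath (s # m @ [t])" "set m \<inter> set C = {}" "set m \<inter> U \<noteq> {}"
        using outer_ear[OF assms(1) C(1) v] by blast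
      then show False using larger_cycle[OF C(1)] C(2) by (meson not_less)
    qed
  qed
  then show ?thesis using that C by blast
qed

end

text \<open>The pair \<open>p\<close>, \<open>q\<close> separates \<open>u\<close> from \<open>v\<close> in the cyclic order of the indices of a closed walk.\<close>

definition sep :: "nat \<Rightarrow> nat \<Rightarrow> nat \<Rightarrow> nat \<Rightarrow> bool" where
  "sep p q u v \<longleftrightarrow> u \<notin> {p, q} \<and> v \<notin> {p, q} \<and> p \<noteq> q \<and>
     (min p q < u \<and> u < max p q) \<noteq> (min p q < v \<and> v < max p q)"

lemma sep_swap: "sep p q u v \<Longrightarrow> sep u v p q"
  unfolding sep_def min_def max_def by (auto split: if_splits)

lemma sep_sym: "sep p q u v \<Longrightarrow> sep p q v u" "sep p q u v \<Longrightarrow> sep q p u v"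
  unfolding sep_def by (auto simp: min.commute max.commute)

lemma sep_trans: "sep p q u v \<Longrightarrow> w \<notin> {p, q} \<Longrightarrow> \<not> sep p q u w \<Longrightarrow> sep p q w v"
  unfolding sep_def by auto

lemma sep_cases:
  "i < k \<Longrightarrow> sep i k p q \<Longrightarrow> i < p \<and> p < k \<and> (q < i \<or> k < q) \<or> i < q \<and> q < k \<and> (p < i \<or> k < p)"
  unfolding sep_def min_def max_def by auto

lemma sep_neq: "sep p q u v \<Longrightarrow> distinct [p, q, u, v]"
  unfolding sep_def by auto

text \<open>The trace of an edge of the original graph after cutting at crossings: an edge, or a
  path through one crossing \<open>x\<close>. \<open>Z\<close> collects the vertices used, so
  disjoint sets \<open>Z\<close> stand for edges that do not meet.\<close>

definition conn :: "complex set set \<Rightarrow> complex set \<Rightarrow> complex \<Rightarrow> complex \<Rightarrow> complex set \<Rightarrow> bool" where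
  "conn F U a c Z \<longleftrightarrow> a \<in> U \<and> c \<in> U \<and> a \<noteq> c \<and>
     (Z = {a, c} \<and> {a, c} \<in> F \<or> (\<exists>x. x \<notin> U \<and> Z = {a, x, c} \<and> {a, x} \<in> F \<and> {x, c} \<in> F))"

definition noncrossing :: "complex set set \<Rightarrow> complex set \<Rightarrow> (complex \<Rightarrow> nat) \<Rightarrow> bool" where
  "noncrossing F U pos \<longleftrightarrow>
     (\<forall>a b c d Z Z'. conn F U a c Z \<longrightarrow> conn F U b d Z' \<longrightarrow> Z \<inter> Z' = {} \<longrightarrow> \<not> (pos a < pos b \<and> pos b < pos c \<and> pos c < pos d))"

lemma conn_sym: "conn F U a c Z \<Longrightarrow> conn F U c a Z"
  unfolding conn_def by (auto simp: insert_commute)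

context plane_graph
begin

section \<open>Chords of the cycle and the order along it\<close>

text \<open>The cycle is cut into five slices and rotated to start at \<open>i\<close>, which gives
  the form of \<open>chords_False\<close>; the hypotheses on \<open>U\<close> supply outer vertices
  on both sides of either chord.\<close>

lemma index_chords_False:
  assumes C: "cyc C" and i: "i < j" "j < k" "k < l" "l < length C"
    and m: "vpath (C ! i # m @ [C ! k])" "set m \<inter> set C = {}"
    and n: "vpath (C ! j # n @ [C ! l])" "set n \<inter> set C = {}" and mn: "set m \<inter> set n = {}"
    and o: "\<exists>p. i < p \<and> p < k \<and> C ! p \<in> U" "\<exists>p<length C. (p < i \<or> k < p) \<and> C ! p \<in> U"
      "\<exists>p. j < p \<and> p < l \<and> C ! p \<in> U" "\<exists>p<length C. (p < j \<or> l < p) \<and> C ! p \<in> U"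
  shows False
proof -
  define P0 P1 P2 P3 P4 where P: "P0 = slice C 0 i" "P1 = slice C (Suc i) j" "P2 = slice C (Suc j) k"
    "P3 = slice C (Suc k) l" "P4 = slice C (Suc l) (length C)"
  have Ceq: "C = P0 @ C ! i # P1 @ C ! j # P2 @ C ! k # P3 @ C ! l # P4"
    using slice_all[of C] slice_split[of 0 i "length C" C] slice_split[of "Suc i" j "length C" C]
      slice_split[of "Suc j" k "length C" C] slice_split[of "Suc k" l "length C" C] i unfolding P by simp
  then have c: "cyc (C ! i # (P1 @ C ! j # P2) @ C ! k # P3 @ C ! l # P4 @ P0)"
    using cyc_rotate[of P0 "C ! i" "P1 @ C ! j # P2 @ C ! k # P3 @ C ! l # P4"] C by simp
  have sets: "set P0 = nth C ` {0..<i}" "set P1 = nth C ` {Suc i..<j}" "set P2 = nth C ` {Suc j..<k}"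
    "set P3 = nth C ` {Suc k..<l}" "set P4 = nth C ` {Suc l..<length C}"
    unfolding P using i by (intro set_slice; simp)+
  have setC: "set P0 \<subseteq> set C" "set P1 \<subseteq> set C" "set P2 \<subseteq> set C" "set P3 \<subseteq> set C" "set P4 \<subseteq> set C"
      "C ! i \<in> set C" "C ! j \<in> set C" "C ! k \<in> set C" "C ! l \<in> set C"
    using i unfolding sets by auto
  have dist: "distinct (C ! i # (P1 @ C ! j # P2) @ C ! k # P3 @ C ! l # P4 @ P0)"
    using c unfolding cyc_def vpath_def by blast
  show False
  proof (rule chords_False[of "C ! i" P1 "C ! j" P2 "C ! k" "rev (P4 @ P0)" "C ! l" "rev P3" m n])
    show "vpath (C ! i # P1 @ C ! j # P2 @ [C ! k])" using cyc_arcs(1)[OF c] by simp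
    show "vpath (C ! i # rev (P4 @ P0) @ C ! l # rev P3 @ [C ! k])" using cyc_arcs(2)[OF c] by simp
    show "vpath (C ! i # m @ [C ! k])" "vpath (C ! j # n @ [C ! l])" by fact+
    show "set (P1 @ C ! j # P2) \<inter> set (rev (P4 @ P0) @ C ! l # rev P3) = {}" using dist by auto
    show "set m \<inter> (set (P1 @ C ! j # P2) \<union> set (rev (P4 @ P0) @ C ! l # rev P3)) = {}"
      using m(2) setC by auto
    show "set n \<inter> (set (C ! i # P1 @ C ! j # P2 @ [C ! k]) \<union> set (rev (P4 @ P0) @ C ! l # rev P3)) = {}"
      using n(2) setC by auto
    show "set m \<inter> set n = {}" by fact
    have in1: "C ! p \<in> set (P1 @ C ! j # P2)" if "i < p" "p < k" for p
      using that sets by (cases "p = j"; cases "p < j") auto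
    then show "set (P1 @ C ! j # P2) \<inter> U \<noteq> {}" using o(1) by blast
    have "C ! p \<in> set (rev (P4 @ P0) @ C ! l # rev P3)" if "p < length C" "p < i \<or> k < p" for p
      using that sets by (cases "p = l"; cases "p < l"; cases "p < i") auto
    then show "set (rev (P4 @ P0) @ C ! l # rev P3) \<inter> U \<noteq> {}" using o(2) by blast
    have "C ! p \<in> set P1 \<union> {C ! i} \<union> set (rev (P4 @ P0))" if "p < length C" "p < j \<or> l < p" for p
      using that sets by (cases "p = i"; cases "p < i"; cases "p < j") auto
    then show "(set P1 \<union> {C ! i} \<union> set (rev (P4 @ P0))) \<inter> U \<noteq> {}" using o(4) by blast
    have "C ! p \<in> set P2 \<union> {C ! k} \<union> set (rev P3)" if "j < p" "p < l" for p
      using that sets by (cases "p = k"; cases "p < k") auto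
    then show "(set P2 \<union> {C ! k} \<union> set (rev P3)) \<inter> U \<noteq> {}" using o(3) by blast
  qed
qed

text \<open>Separation does not depend on the direction of a chord, so both chords may be taken
  ascending; then only two interleaving orders are possible.\<close>

lemma sep_chords_False:
  assumes C: "cyc C" and len: "i < length C" "j < length C" "k < length C" "l < length C" and s: "sep i k j l"
    and m: "vpath (C ! i # m @ [C ! k])" "set m \<inter> set C = {}"
    and n: "vpath (C ! j # n @ [C ! l])" "set n \<inter> set C = {}" and mn: "set m \<inter> set n = {}"
    and o: "\<exists>p<length C. \<exists>q<length C. C ! p \<in> U \<and> C ! q \<in> U \<and> sep i k p q"
      "\<exists>p<length C. \<exists>q<length C. C ! p \<in> U \<and> C ! q \<in> U \<and> sep j l p q"
  shows False
proof -
  have *: False if "i < k" "j < l" "i < length C" "j < length C" "k < length C" "l < length C" "sep i k j l"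
    "vpath (C ! i # m @ [C ! k])" "set m \<inter> set C = {}"
    "vpath (C ! j # n @ [C ! l])" "set n \<inter> set C = {}" "set m \<inter> set n = {}"
    "\<exists>p<length C. \<exists>q<length C. C ! p \<in> U \<and> C ! q \<in> U \<and> sep i k p q"
    "\<exists>p<length C. \<exists>q<length C. C ! p \<in> U \<and> C ! q \<in> U \<and> sep j l p q" for i j k l m n
  proof -
    have o1: "\<exists>p. i < p \<and> p < k \<and> C ! p \<in> U" "\<exists>p<length C. (p < i \<or> k < p) \<and> C ! p \<in> U"
      using that(13) sep_cases[OF that(1)] by blast+
    have o2: "\<exists>p. j < p \<and> p < l \<and> C ! p \<in> U" "\<exists>p<length C. (p < j \<or> l < p) \<and> C ! p \<in> U"
      using that(14) sep_cases[OF that(2)] by blast+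
    have "i < j \<and> j < k \<and> k < l \<or> j < i \<and> i < l \<and> l < k"
      using that(1,2,7) unfolding sep_def min_def max_def by auto
    then show False
    proof
      assume "i < j \<and> j < k \<and> k < l"
      then show False using index_chords_False[OF C, of i j k l m n] that o1 o2 by blast
    next
      assume "j < i \<and> i < l \<and> l < k"
      then show False using index_chords_False[OF C, of j i l k n m] that o1 o2 by blast
    qed
  qed
  have rv: "vpath (a # xs @ [b]) \<Longrightarrow> vpath (b # rev xs @ [a])" for a b xs
    using vpath_rev[of "a # xs @ [b]"] by simp
  have ik: "i \<noteq> k" "j \<noteq> l" using sep_neq[OF s] by auto
  have sw: "(\<exists>p<length C. \<exists>q<length C. C ! p \<in> U \<and> C ! q \<in> U \<and> sep u v p q) \<Longrightarrow>
      (\<exists>p<length C. \<exists>q<length C. C ! p \<in> U \<and> C ! q \<in> U \<and> sep v u p q)" for u v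
    using sep_sym(2) by blast
  consider "i < k" "j < l" | "k < i" "j < l" | "i < k" "l < j" | "k < i" "l < j" using ik by linarith
  then show False
  proof cases
    case 1 then show False using *[of i k j l m n] assms by blast
  next
    case 2 then show False
      using *[OF 2(1,2) len(3,2,1,4) sep_sym(2)[OF s] rv[OF m(1)] _ n _ sw[OF o(1)] o(2)] m mn by simp
  next
    case 3 then show False
      using *[OF 3(1,2) len(1,4,3,2) sep_sym(1)[OF s] m rv[OF n(1)] _ _ o(1) sw[OF o(2)]] n mn by simp
  next
    case 4 then show False
      using *[OF 4(1,2) len(3,4,1,2) sep_sym(1)[OF sep_sym(2)[OF s]] rv[OF m(1)] _ rv[OF n(1)] _ _ sw[OF o(1)] sw[OF o(2)]] m n mn by simp
  qed
qed

text \<open>The middle vertex of a connection may itself lie on the cycle. The connection then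
  consists of two chords, and \<open>p, q\<close> still separate the ends of one of them. The last
  conclusions say that an end moved to the middle vertex stays on the side of the original
  end.\<close>

lemma conn_chord:
  assumes C: "cyc C" and ac: "conn F U (C ! a) (C ! c) Z" "a < length C" "c < length C"
    and pq: "C ! p \<notin> Z" "C ! q \<notin> Z" "sep p q a c"
  obtains i k m where "i < length C" "k < length C" "vpath (C ! i # m @ [C ! k])" "set m \<inter> set C = {}"
    "set m \<union> {C ! i, C ! k} \<subseteq> Z" "sep p q i k" "i = a \<or> C ! i \<notin> U" "k = c \<or> C ! k \<notin> U" "i = a \<or> k = c"
    "\<not> sep p q i a" "\<not> sep p q k c"
proof -
  have inj: "C ! x = C ! y \<longleftrightarrow> x = y" if "x < length C" "y < length C" for x y
    using that C unfolding cyc_def vpath_def by (simp add: nth_eq_iff_index_eq)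
  have CW: "set C \<subseteq> W" using C unfolding cyc_def vpath_def by blast
  have ns: "\<not> sep p q x x" for x unfolding sep_def by auto
  have ed: "vpath (u # [] @ [v])" if "{u, v} \<in> F" for u v
    using that edge_in_W edge_neq unfolding vpath_def by auto
  have U: "C ! a \<in> U" "C ! c \<in> U" "C ! a \<noteq> C ! c" using ac(1) unfolding conn_def by auto
  consider "Z = {C ! a, C ! c}" "{C ! a, C ! c} \<in> F"
    | x where "x \<notin> U" "Z = {C ! a, x, C ! c}" "{C ! a, x} \<in> F" "{x, C ! c} \<in> F" "x \<notin> set C"
    | x where "Z = {C ! a, C ! x, C ! c}" "{C ! a, C ! x} \<in> F" "{C ! x, C ! c} \<in> F" "x < length C" "C ! x \<notin> U"
  proof -
    have "Z = {C ! a, C ! c} \<and> {C ! a, C ! c} \<in> F \<or>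
        (\<exists>x. x \<notin> U \<and> Z = {C ! a, x, C ! c} \<and> {C ! a, x} \<in> F \<and> {x, C ! c} \<in> F)"
      using ac(1) unfolding conn_def by blast
    then show ?thesis
    proof (elim disjE conjE exE)
      fix x assume x: "x \<notin> U" "Z = {C ! a, x, C ! c}" "{C ! a, x} \<in> F" "{x, C ! c} \<in> F"
      show ?thesis
      proof (cases "x \<in> set C")
        case True
        then obtain y where "y < length C" "C ! y = x" by (meson in_set_conv_nth)
        then show ?thesis using x that(3)[of y] by simp
      qed (use x that(2) in blast)
    qed (use that(1) in blast)
  qed
  then show ?thesis
  proof cases
    case 1
    show ?thesis
      by (rule that[of a c "[]"]) (use 1 ac pq ns ed[OF 1(2)] in auto)
  next
    case 2
    have "vpath (C ! a # [x] @ [C ! c])"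
      using 2 U edge_in_W edge_neq unfolding vpath_def by auto
    then show ?thesis
      by (intro that[of a c "[x]"]) (use 2 ac pq ns in auto)
  next
    case 3
    have xpq: "x \<notin> {p, q}" using pq(1,2) 3(1) by auto
    show ?thesis
    proof (cases "sep p q a x")
      case True
      have "\<not> sep p q x c" using True pq(3) unfolding sep_def by auto
      then show ?thesis
        by (intro that[of a x "[]"]) (use 3 ac pq ns ed[OF 3(2)] True in auto)
    next
      case False
      have s: "sep p q x c" using sep_trans[OF pq(3) xpq False] .
      have "\<not> sep p q x a" using False sep_sym(1) by blast
      then show ?thesis
        by (intro that[of x c "[]"]) (use 3 ac pq ns ed[OF 3(3)] s in auto)
    qed
  qed
qed

text \<open>
  An end of a chord that is not an outer vertex has outer neighbours on the closed walk, so a second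
  chord still has outer vertices on this side.
\<close>

lemma outer_on_side:
  assumes C: "cyc C" and i: "i < length C" "j < length C" "l < length C" "j \<noteq> l" "i \<notin> {j, l}" "a < length C" "C ! a \<in> U"
    and ia: "i = a \<or> C ! i \<notin> U \<and> \<not> sep b d i a \<and> a \<notin> {b, d} \<and> i \<notin> {b, d}"
    and jl: "j = b \<or> C ! j \<notin> U" "l = d \<or> C ! l \<notin> U" and bd: "b < length C" "d < length C"
  shows "\<exists>p<length C. C ! p \<in> U \<and> p \<notin> {j, l} \<and> \<not> sep j l p i"
proof (cases "C ! i \<in> U")
  case True
  then show ?thesis using i unfolding sep_def by blast
next
  case False
  then have ia': "i \<noteq> a" "\<not> sep b d i a" "a \<notin> {b, d}" "i \<notin> {b, d}" using ia i(7) by auto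
  define N where "N = length C"
  have N3: "3 \<le> N" using C unfolding cyc_def N_def by blast
  define nx where "nx = (if Suc i < N then Suc i else 0)"
  define pv where "pv = (if i = 0 then N - 1 else i - 1)"
  have edges: "{C ! x, C ! Suc x} \<in> F" if "Suc x < N" for x
    using path_edges_nth[of x C] that C unfolding cyc_def vpath_def N_def by blast
  have close: "{C ! (N - 1), C ! 0} \<in> F"
  proof -
    have "C \<noteq> []" using N3 unfolding N_def by auto
    then show ?thesis using C unfolding cyc_def N_def by (simp add: last_conv_nth hd_conv_nth)
  qed
  have lt: "nx < N" "pv < N" "i < N" using i N3 unfolding nx_def pv_def N_def by auto
  have "{C ! i, C ! nx} \<in> F"
  proof (cases "Suc i < N")
    case False
    then have "i = N - 1" using lt by simp
    then show ?thesis using close False unfolding nx_def by (simp add: insert_commute)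
  qed (use edges[of i] in \<open>simp add: nx_def\<close>)
  then have nxU: "C ! nx \<in> U" using indep False by blast
  have "{C ! pv, C ! i} \<in> F"
    using edges[of pv] close lt N3 unfolding pv_def by (cases i) auto
  then have pvU: "C ! pv \<in> U" using indep False by blast
  show ?thesis
  proof (rule ccontr)
    assume n: "\<not> ?thesis"
    have nx: "nx \<in> {j, l} \<or> sep j l nx i" and pv: "pv \<in> {j, l} \<or> sep j l pv i"
      using n nxU pvU lt unfolding N_def by blast+
    have "\<not> sep j l nx i" if "nx \<notin> {j, l}"
      using that i lt N3 unfolding sep_def nx_def min_def max_def N_def by (auto split: if_splits)
    then have nx': "nx \<in> {j, l}" using nx by blast
    have "\<not> sep j l pv i" if "pv \<notin> {j, l}"
      using that i lt N3 unfolding sep_def pv_def min_def max_def N_def by (auto split: if_splits)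
    then have pv': "pv \<in> {j, l}" using pv by blast
    have ne: "nx \<noteq> pv" using lt N3 unfolding nx_def pv_def by (auto split: if_splits)
    have "j = b" "l = d" using jl nx' pv' ne nxU pvU by auto
    then have jl': "{nx, pv} = {b, d}" using nx' pv' ne by auto
    have "a < N" using i N_def by simp
    then show False using ia' jl' lt N3 unfolding sep_def nx_def pv_def min_def max_def
      by (auto simp: doubleton_eq_iff split: if_splits)
  qed
qed

lemma tight_noncrossing:
  assumes tight "4 \<le> card U"
  shows "\<exists>pos. inj_on pos U \<and> noncrossing F U pos"
proof -
  obtain C where C: "cyc C" "U \<subseteq> set C" using cycle_through_outer[OF assms] .
  have inj: "inj_on (nth C) {..<length C}"
    using C unfolding cyc_def vpath_def by (simp add: inj_on_nth)
  define pos where "pos = the_inv_into {..<length C} (nth C)"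
  have pos: "pos x < length C \<and> C ! pos x = x" if "x \<in> U" for x
  proof -
    have "x \<in> nth C ` {..<length C}" using that C by (metis (no_types, lifting) in_set_conv_nth image_iff lessThan_iff subsetD)
    then show ?thesis unfolding pos_def using f_the_inv_into_f[OF inj] the_inv_into_into[OF inj] by blast
  qed
  have "inj_on pos U" by (rule inj_onI) (metis pos)
  moreover have "noncrossing F U pos"
    unfolding noncrossing_def
  proof (intro allI impI notI)
    fix a b c d Z Z'
    assume ac: "conn F U a c Z" and bd: "conn F U b d Z'" and Z: "Z \<inter> Z' = {}"
      and o: "pos a < pos b \<and> pos b < pos c \<and> pos c < pos d"
    have U: "a \<in> U" "b \<in> U" "c \<in> U" "d \<in> U" "a \<in> Z" "c \<in> Z" "b \<in> Z'" "d \<in> Z'" using ac bd unfolding conn_def by auto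
    note pa = pos[OF U(1)] and pb = pos[OF U(2)] and pc = pos[OF U(3)] and pd = pos[OF U(4)]
    have s: "sep (pos b) (pos d) (pos a) (pos c)" using o unfolding sep_def min_def max_def by auto
    have bZ: "C ! pos b \<notin> Z" "C ! pos d \<notin> Z" using pb pd U Z by auto
    have ac': "conn F U (C ! pos a) (C ! pos c) Z" using ac pa pc by simp
    \<comment> \<open>The connection of \<open>a\<close> and \<open>c\<close> is cut down to a chord
      that is separated by \<open>b, d\<close>, and then the other connection to a chord separated
      by the ends of the first.\<close>
    obtain i k m where ik: "i < length C" "k < length C" "vpath (C ! i # m @ [C ! k])" "set m \<inter> set C = {}"
      "set m \<union> {C ! i, C ! k} \<subseteq> Z" "sep (pos b) (pos d) i k" "i = pos a \<or> C ! i \<notin> U" "k = pos c \<or> C ! k \<notin> U" "i = pos a \<or> k = pos c"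
      "\<not> sep (pos b) (pos d) i (pos a)" "\<not> sep (pos b) (pos d) k (pos c)"
      using conn_chord[OF C(1) ac' _ _ bZ s] pa pc by blast
    have s2: "sep i k (pos b) (pos d)" using sep_swap[OF ik(6)] .
    have iZ: "C ! i \<notin> Z'" "C ! k \<notin> Z'" using ik(5) Z by auto
    have bd': "conn F U (C ! pos b) (C ! pos d) Z'" using bd pb pd by simp
    obtain j l n where jl: "j < length C" "l < length C" "vpath (C ! j # n @ [C ! l])" "set n \<inter> set C = {}"
      "set n \<union> {C ! j, C ! l} \<subseteq> Z'" "sep i k j l" "j = pos b \<or> C ! j \<notin> U" "l = pos d \<or> C ! l \<notin> U"
      using conn_chord[OF C(1) bd' _ _ iZ s2] pb pd by metis
    have s3: "sep j l i k" using sep_swap[OF jl(6)] .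
    have ne: "j \<noteq> l" "i \<notin> {j, l}" "k \<notin> {j, l}" using sep_neq[OF s3] by auto
    have neb: "pos a \<notin> {pos b, pos d}" "pos c \<notin> {pos b, pos d}" "i \<notin> {pos b, pos d}" "k \<notin> {pos b, pos d}"
      using o sep_neq[OF ik(6)] by auto
    obtain p where p: "p < length C" "C ! p \<in> U" "p \<notin> {j, l}" "\<not> sep j l p i"
      using outer_on_side[OF C(1) ik(1) jl(1,2) ne(1,2), of "pos a" "pos b" "pos d"] pa pb pd U ik jl neb by auto
    obtain q where q: "q < length C" "C ! q \<in> U" "q \<notin> {j, l}" "\<not> sep j l q k"
      using outer_on_side[OF C(1) ik(2) jl(1,2) ne(1,3), of "pos c" "pos b" "pos d"] pc pb pd U ik jl neb by auto
    have "sep j l p k" by (rule sep_trans[OF s3 p(3)]) (use p(4) sep_sym(1) in blast)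
    then have "sep j l q p" by (intro sep_trans[OF sep_sym(1) q(3)]) (use q(4) sep_sym(1) in blast)+
    then have 2: "\<exists>p<length C. \<exists>q<length C. C ! p \<in> U \<and> C ! q \<in> U \<and> sep j l p q" using p q by blast
    \<comment> \<open>For the chord \<open>ik\<close> the outer vertices on its two sides are
      \<open>b\<close> and \<open>d\<close> themselves; for \<open>jl\<close> they had to be found
      by \<open>outer_on_side\<close>.\<close>
    have 1: "\<exists>p<length C. \<exists>q<length C. C ! p \<in> U \<and> C ! q \<in> U \<and> sep i k p q" 
    proof -
      have "C ! pos b \<in> U" "C ! pos d \<in> U" using pb pd U by simp_all
      then show ?thesis using s2 pb pd by blast
    qed
    have "set m \<inter> set n = {}" using ik(5) jl(5) Z by auto
    then show False using sep_chords_False[OF C(1) ik(1) jl(1) ik(2) jl(2,6) ik(3,4) jl(3,4) _ 1 2] by blast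
  qed
  ultimately show ?thesis by blast
qed

end

section \<open>Cutting at a vertex and gluing the orders\<close>

lemma conn_in: "conn F U a c Z \<Longrightarrow> a \<in> U" "conn F U a c Z \<Longrightarrow> c \<in> U" "conn F U a c Z \<Longrightarrow> a \<noteq> c" "conn F U a c Z \<Longrightarrow> a \<in> Z \<and> c \<in> Z"
  unfolding conn_def by auto

lemma noncrossingD:
  "noncrossing F U pos \<Longrightarrow> conn F U a c Z \<Longrightarrow> conn F U b d Z' \<Longrightarrow> Z \<inter> Z' = {} \<Longrightarrow>
    pos a < pos b \<Longrightarrow> pos b < pos c \<Longrightarrow> pos c < pos d \<Longrightarrow> False"
  unfolding noncrossing_def by blast

text \<open>Interleaving depends only on the cyclic order, so all positions before \<open>z\<close>
  can be moved behind the last one.\<close>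

lemma noncrossing_rotate:
  assumes fin: "finite U" and inj: "inj_on pos U" and nc: "noncrossing F U pos" and z: "z \<in> U"
  obtains pos' :: "complex \<Rightarrow> nat" where "inj_on pos' U" "noncrossing F U pos'" "\<And>x. x \<in> U \<Longrightarrow> x \<noteq> z \<Longrightarrow> pos' z < pos' x"
proof -
  define K where "K = Suc (Max (pos ` U))"
  have K: "pos x < K" if "x \<in> U" for x
    unfolding K_def using fin that by (meson Max_ge finite_imageI imageI le_imp_less_Suc)
  define pos' where "pos' x = (if pos x < pos z then pos x + K else pos x)" for x
  have "inj_on pos' U"
  proof (rule inj_onI)
    fix x y assume xy: "x \<in> U" "y \<in> U" "pos' x = pos' y"
    then have "pos x = pos y" using K[of x] K[of y] unfolding pos'_def by (auto split: if_splits)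
    then show "x = y" using inj xy by (meson inj_onD)
  qed
  moreover have "noncrossing F U pos'"
    unfolding noncrossing_def
  proof (intro allI impI notI)
    fix a b c d Z Z'
    assume ac: "conn F U a c Z" and bd: "conn F U b d Z'" and Z: "Z \<inter> Z' = {}"
      and o: "pos' a < pos' b \<and> pos' b < pos' c \<and> pos' c < pos' d"
    note K' = K[OF conn_in(1)[OF ac]] K[OF conn_in(1)[OF bd]] K[OF conn_in(2)[OF ac]] K[OF conn_in(2)[OF bd]]
    have Z2: "Z' \<inter> Z = {}" using Z by blast
    have "pos a < pos b \<and> pos b < pos c \<and> pos c < pos d \<or> pos d < pos a \<and> pos a < pos b \<and> pos b < pos c \<or>
        pos c < pos d \<and> pos d < pos a \<and> pos a < pos b \<or> pos b < pos c \<and> pos c < pos d \<and> pos d < pos a"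
      using o K' unfolding pos'_def by (auto split: if_splits)
    then show False
      using noncrossingD[OF nc ac bd Z] noncrossingD[OF nc conn_sym[OF bd] ac Z2]
        noncrossingD[OF nc conn_sym[OF ac] conn_sym[OF bd] Z] noncrossingD[OF nc bd conn_sym[OF ac] Z2] by blast
  qed
  moreover have "pos' z < pos' x" if "x \<in> U" "x \<noteq> z" for x
  proof -
    have "pos x \<noteq> pos z" using inj that z unfolding inj_on_def by blast
    then show ?thesis using K[OF z] unfolding pos'_def by auto
  qed
  ultimately show ?thesis using that by blast
qed

context plane_graph
begin

text \<open>The cut vertex is declared outer on each side, even if it is a crossing, so that it
  receives a position by which the two orders can be glued.\<close>

lemma subgraph:
  assumes "W1 \<subseteq> W" "z \<in> W1" "z \<in> U \<or> outer_point (\<Union>(h ` {e \<in> F. e \<subseteq> W1})) z"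
  shows "plane_graph W1 {e \<in> F. e \<subseteq> W1} h ((U \<inter> W1) \<union> {z})"
proof
  show "finite W1" using assms finite_W finite_subset by blast
  show "U \<inter> W1 \<union> {z} \<subseteq> W1" using assms by blast
  show "\<exists>a b. e = {a, b} \<and> a \<in> W1 \<and> b \<in> W1 \<and> joins (h e) a b" if "e \<in> {e \<in> F. e \<subseteq> W1}" for e
    using edge[of e] that by auto
  show "h e \<inter> W1 = e" if "e \<in> {e \<in> F. e \<subseteq> W1}" for e using edge_W[of e] that assms(1) by auto
  show "h e \<inter> h f \<subseteq> e \<inter> f" if "e \<in> {e \<in> F. e \<subseteq> W1}" "f \<in> {e \<in> F. e \<subseteq> W1}" "e \<noteq> f" for e f
    using edge_int[of e f] that by auto
  show "a \<in> U \<inter> W1 \<union> {z} \<or> b \<in> U \<inter> W1 \<union> {z}" if "{a, b} \<in> {e \<in> F. e \<subseteq> W1}" for a b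
    using indep[of a b] that by auto
  show "outer_point (\<Union>(h ` {e \<in> F. e \<subseteq> W1})) x" if "x \<in> U \<inter> W1 \<union> {z}" for x
  proof (cases "x \<in> U")
    case True
    have "\<Union>(h ` {e \<in> F. e \<subseteq> W1}) \<subseteq> \<Union>(h ` F)" by blast
    then show ?thesis using outer[OF True] unfolding outer_point_def by (meson order_trans)
  qed (use assms that in auto)
qed

text \<open>
  A cut vertex is an outer point of each side even if it is a crossing: a closed curve around it
  on one side would enclose its neighbour on the other side.
\<close>

lemma cut_outer:
  assumes z: "z \<notin> U" "z \<in> W1" and y: "y \<notin> W1" "{z, y} \<in> F"
  shows "outer_point (\<Union>(h ` {e \<in> F. e \<subseteq> W1})) z"
  unfolding outer_point_def
proof (intro allI impI notI)
  fix J assume J: "jordan J \<and> J \<subseteq> \<Union>(h ` {e \<in> F. e \<subseteq> W1})" and zi: "z \<in> inside J"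
  have yU: "y \<in> U" using indep[OF y(2)] z by blast
  have jo: "joins (h {z, y}) z y" using edge_joins[OF y(2)] .
  have zJ: "z \<notin> J" using zi inside_no_overlap[of J] by blast
  have "h {z, y} \<inter> h e \<subseteq> {z}" if "e \<in> F" "e \<subseteq> W1" for e
    using edge_int[OF y(2) that(1)] that y by blast
  then have "h {z, y} \<inter> J = {}" using J zJ by blast
  then have "h {z, y} \<subseteq> inside J \<or> h {z, y} \<subseteq> outside J"
    by (rule connected_inside_or_outside[OF joins_connected[OF jo]])
  then have "y \<in> inside J" using zi joins_ends[OF jo] inside_Int_outside[of J] by blast
  moreover have "J \<subseteq> \<Union>(h ` F)" using J by blast
  ultimately show False using outer[OF yU] J unfolding outer_point_def by blast
qed

text \<open>The last conclusion guarantees that \<open>z\<close> is an outer point of both sides: it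
  is outer anyway, or \<open>cut_outer\<close> applies with a neighbour on the opposite
  side.\<close>

lemma cut_exists:
  assumes "\<not> tight" "4 \<le> card U"
  obtains W1 W2 z where "W1 \<union> W2 = W" "W1 \<inter> W2 = {z}" "W1 \<noteq> W" "W2 \<noteq> W" "\<forall>e\<in>F. e \<subseteq> W1 \<or> e \<subseteq> W2"
    "z \<in> U \<or> (\<exists>y\<in>W1 - {z}. {z, y} \<in> F) \<and> (\<exists>y\<in>W2 - {z}. {z, y} \<in> F)"
proof -
  note result = that
  obtain D where D: "D \<subseteq> W" "D \<noteq> {}" "W - D - nb D \<noteq> {}" "\<And>s t. s \<in> nb D \<Longrightarrow> t \<in> nb D \<Longrightarrow> s = t"
    using assms(1) unfolding tight_def by blast
  define R where "R = W - D - nb D"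
  have nbW: "nb D \<subseteq> W - D" unfolding nb_def by blast
  have ed: "e \<subseteq> D \<union> nb D \<or> e \<subseteq> nb D \<union> R" if eF: "e \<in> F" for e
  proof -
    obtain a b where ab: "e = {a, b}" "a \<in> W" "b \<in> W" using edge[OF eF] by blast
    have "{b, a} \<in> F" "{a, b} \<in> F" using eF ab by (simp_all add: insert_commute)
    then show ?thesis using ab unfolding R_def nb_def by blast
  qed
  have W: "W = D \<union> nb D \<union> R" using D(1) nbW unfolding R_def by blast
  have RD: "R \<inter> D = {}" "R \<inter> nb D = {}" "R \<noteq> {}" using D(3) unfolding R_def by auto
  show ?thesis
  proof (cases "nb D = {}")
    case True
    \<comment> \<open>If the graph is disconnected, an outer vertex \<open>z\<close> of
      \<open>A\<close> is added to \<open>B\<close> as an isolated vertex. Two vertices in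
      \<open>A\<close> keep the enlarged side proper, and four outer vertices guarantee that some
      side qualifies.\<close>
    have two: thesis if A: "A \<union> B = W" "A \<inter> B = {}" "B \<noteq> {}" "\<And>e. e \<in> F \<Longrightarrow> e \<subseteq> A \<or> e \<subseteq> B" "z \<in> U \<inter> A" "2 \<le> card A" for A B z
    proof (rule result[of A "insert z B" z])
      have "A \<noteq> {z}" using A(6) by auto
      then show "insert z B \<noteq> W" using A(1,2,5) by blast
    qed (use A in auto)
    have e2: "\<And>e. e \<in> F \<Longrightarrow> e \<subseteq> D \<or> e \<subseteq> R" using ed True by auto
    have fin: "finite D" "finite R" using W finite_W by (metis finite_Un)+
    consider z where "z \<in> U \<inter> D" "2 \<le> card D" | z where "z \<in> U \<inter> R" "2 \<le> card R" | "card (U \<inter> D) \<le> 1" "card (U \<inter> R) \<le> 1"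
    proof -
      have one: "card (U \<inter> A) \<le> 1" if "\<not> (\<exists>z. z \<in> U \<inter> A \<and> 2 \<le> card A)" "finite A" for A
      proof (cases "U \<inter> A = {}")
        case False
        then have "card A \<le> 1" using that by auto
        then show ?thesis using card_mono[OF that(2), of "U \<inter> A"] by simp
      qed simp
      show ?thesis using that one[OF _ fin(1)] one[OF _ fin(2)] by blast
    qed
    then show ?thesis
    proof cases
      case 1
      then show ?thesis using two[of D R] W True RD e2 by blast
    next
      case 2
      then show ?thesis using two[of R D] W True RD e2 D(2) by blast
    next
      case 3
      have "U = (U \<inter> D) \<union> (U \<inter> R)" using U_subset W True by blast
      then have "card U \<le> card (U \<inter> D) + card (U \<inter> R)" by (metis card_Un_le)
      then show ?thesis using 3 assms(2) by simp
    qed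
  next
    case False
    then obtain z where z: "nb D = {z}" using D(4) by blast
    obtain x where x: "x \<in> D" "{x, z} \<in> F" "{z, x} \<in> F" using z unfolding nb_def by (force simp: insert_commute)
    have zD: "z \<notin> D" "z \<in> W" "z \<notin> R" using nbW z RD by auto
    have e2: "\<And>e. e \<in> F \<Longrightarrow> e \<subseteq> insert z D \<or> e \<subseteq> insert z R" using ed z by auto
    have ne1: "insert z D \<noteq> W"
    proof -
      obtain r where "r \<in> R" using RD(3) by blast
      then have "r \<in> W" "r \<notin> insert z D" using W RD zD by auto
      then show ?thesis by blast
    qed
    have ne2: "insert z R \<noteq> W"
    proof -
      have "x \<in> W" "x \<notin> insert z R" using x(1) D(1) RD zD by auto
      then show ?thesis by blast
    qed
    show ?thesis
    proof (cases "z \<in> U \<or> (\<exists>y\<in>R. {z, y} \<in> F)")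
      case True
      show ?thesis
      proof (rule result[of "insert z D" "insert z R" z])
        show "insert z D \<union> insert z R = W" using W z by blast
        show "insert z D \<inter> insert z R = {z}" using RD by blast
        show "insert z D \<noteq> W" "insert z R \<noteq> W" using ne1 ne2 .
        show "z \<in> U \<or> (\<exists>y\<in>insert z D - {z}. {z, y} \<in> F) \<and> (\<exists>y\<in>insert z R - {z}. {z, y} \<in> F)"
          using True x zD by blast
      qed (use e2 in blast)
    next
      \<comment> \<open>If the crossing \<open>z\<close> has no neighbour in \<open>R\<close>, then
        \<open>R\<close> is not connected to the rest at all, and the outer neighbour
        \<open>x\<close> of \<open>z\<close> takes over as an isolated vertex on the side of
        \<open>R\<close>.\<close>
      case n: False
      then have xU: "x \<in> U" using indep[OF x(2)] by blast
      have "e \<subseteq> insert z D \<or> e \<subseteq> insert x R" if e: "e \<in> F" for e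
      proof (cases "z \<in> e \<and> e \<subseteq> insert z R")
        case True
        obtain a b where ab: "e = {a, b}" "a \<noteq> b" using edge[OF e] joins_neq by blast
        then obtain y where "e = {z, y}" "y \<noteq> z" using True by auto
        then have "y \<in> R" "{z, y} \<in> F" using True e by auto
        then show ?thesis using n by blast
      qed (use e2[OF e] in auto)
      note e3 = this
      show ?thesis
      proof (rule result[of "insert z D" "insert x R" x])
        show "insert z D \<union> insert x R = W" using W z x by blast
        show "insert z D \<inter> insert x R = {x}" using RD zD x by blast
        show "insert z D \<noteq> W" using ne1 .
        have "z \<notin> insert x R" using zD x by blast
        then show "insert x R \<noteq> W" using zD by blast
      qed (use e3 xU in blast)+
    qed
  qed
qed

lemma compose:
  assumes W: "W1 \<union> W2 = W" "W1 \<inter> W2 = {z}" and cut: "\<And>e. e \<in> F \<Longrightarrow> e \<subseteq> W1 \<or> e \<subseteq> W2"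
    and n1: "inj_on pos1 ((U \<inter> W1) \<union> {z})" "noncrossing {e \<in> F. e \<subseteq> W1} ((U \<inter> W1) \<union> {z}) pos1"
      "\<And>x. x \<in> (U \<inter> W1) \<union> {z} \<Longrightarrow> x \<noteq> z \<Longrightarrow> pos1 z < pos1 x"
    and n2: "inj_on pos2 ((U \<inter> W2) \<union> {z})" "noncrossing {e \<in> F. e \<subseteq> W2} ((U \<inter> W2) \<union> {z}) pos2"
      "\<And>x. x \<in> (U \<inter> W2) \<union> {z} \<Longrightarrow> x \<noteq> z \<Longrightarrow> pos2 z < pos2 x"
  shows "\<exists>pos. inj_on pos U \<and> noncrossing F U (pos :: complex \<Rightarrow> nat)"
proof -
  define F1 U1 F2 U2 where d: "F1 = {e \<in> F. e \<subseteq> W1}" "U1 = (U \<inter> W1) \<union> {z}" "F2 = {e \<in> F. e \<subseteq> W2}" "U2 = (U \<inter> W2) \<union> {z}"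
  note nc1 = noncrossingD[OF n1(2), folded d] and nc2 = noncrossingD[OF n2(2), folded d]
  have fin: "finite U" using U_subset finite_W finite_subset by blast
  define K where "K = Suc (Max (pos1 ` U1))"
  have K: "pos1 x < K" if "x \<in> U1" for x
    unfolding K_def using fin that d by (meson Max_ge finite_imageI imageI le_imp_less_Suc finite.emptyI finite_UnI finite_insert finite_Int)
  \<comment> \<open>First \<open>z\<close>, then the rest of \<open>W1\<close>, then the rest of
    \<open>W2\<close>. The offset \<open>K\<close> exceeds all positions of the first side.\<close>
  define pos where "pos x = (if x = z then 0 else if x \<in> W1 then Suc (pos1 x) else Suc (K + pos2 x))" for x
  have zW: "z \<in> W1" "z \<in> W2" using W by auto
  have both: "y = z" if "y \<in> W1" "y \<in> W2" for y using W(2) that by blast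
  have UW: "x \<in> W1 \<or> x \<in> W2" if "x \<in> U" for x using that U_subset W by blast
  have p1: "pos1 x < pos1 y" if "x \<in> U" "y \<in> U" "x \<in> W1" "y \<in> W1" "pos x < pos y" for x y
    using that n1(3) unfolding pos_def by (auto split: if_splits)
  have p2: "pos2 x < pos2 y" if "x \<in> U" "y \<in> U" "x \<in> W2" "y \<in> W2" "pos x < pos y" for x y
    using that n2(3) W(2) unfolding pos_def by (auto split: if_splits)
  have p12: "pos y < pos x \<or> x = z" if "x \<notin> W1 \<or> x = z" "y \<in> U" "y \<in> W1" "x \<in> U" for x y
    using that K[of y] unfolding pos_def d by auto
  have z1: "pos1 z < pos1 x" if "x \<in> U" "x \<in> W1" "x \<noteq> z" for x using n1(3)[of x] that by auto
  have z2: "pos2 z < pos2 x" if "x \<in> U" "x \<in> W2" "x \<noteq> z" for x using n2(3)[of x] that by auto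
  have inj: "inj_on pos U"
  proof (rule inj_onI)
    fix x y assume xy: "x \<in> U" "y \<in> U" "pos x = pos y"
    show "x = y"
    proof (cases "x = z \<or> y = z")
      case True
      then show ?thesis using xy(3) unfolding pos_def by (auto split: if_splits)
    next
      case False
      then have "x \<in> W1 \<longleftrightarrow> y \<in> W1" using p12[of x y] p12[of y x] xy by auto
      then show ?thesis
      proof (cases "x \<in> W1")
        case True
        then have "pos1 x = pos1 y" using xy(3) False \<open>x \<in> W1 \<longleftrightarrow> y \<in> W1\<close> unfolding pos_def by auto
        then show ?thesis using n1(1) xy True \<open>x \<in> W1 \<longleftrightarrow> y \<in> W1\<close> by (auto dest: inj_onD)
      next
        case f: False
        then have "pos2 x = pos2 y" using xy(3) False \<open>x \<in> W1 \<longleftrightarrow> y \<in> W1\<close> unfolding pos_def by auto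
        then show ?thesis using n2(1) xy f UW \<open>x \<in> W1 \<longleftrightarrow> y \<in> W1\<close> by (auto dest: inj_onD)
      qed
    qed
  qed
  \<comment> \<open>A connection within one side stays a connection there, unless its middle vertex
    is \<open>z\<close>; as \<open>z\<close> counts as outer on that side, it then falls into two
    connections that start at \<open>z\<close>.\<close>
  have H1: "conn F1 U1 a c Z \<or> z \<notin> U \<and> Z = {a, z, c} \<and> conn F1 U1 z a {z, a} \<and> conn F1 U1 z c {z, c}"
    if co: "conn F U a c Z" and m: "a \<in> W1" "c \<in> W1" for a c Z
  proof -
    have ac: "a \<in> U" "c \<in> U" "a \<noteq> c" using co unfolding conn_def by auto
    consider "Z = {a, c}" "{a, c} \<in> F" | x where "x \<notin> U" "Z = {a, x, c}" "{a, x} \<in> F" "{x, c} \<in> F"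
      using co unfolding conn_def by blast
    then show ?thesis
    proof cases
      case 1
      then show ?thesis using m ac unfolding conn_def d by auto
    next
      case 2
      have xW: "x \<in> W1" using cut[OF 2(3)] cut[OF 2(4)] m ac(3) both by auto
      have F': "{a, x} \<in> F1" "{x, c} \<in> F1" "{x, a} \<in> F1" using 2 m xW unfolding d by (auto simp: insert_commute)
      have U': "a \<in> U1" "c \<in> U1" "z \<in> U1" using ac m unfolding d by auto
      have ne: "x \<noteq> a" "x \<noteq> c" using 2(1) ac by auto
      show ?thesis
      proof (cases "x = z")
        case True
        then have "conn F1 U1 z a {z, a}" "conn F1 U1 z c {z, c}" unfolding conn_def using F' U' ne by auto
        then show ?thesis using True 2 by blast
      next
        case False
        then have "x \<notin> U1" using 2(1) unfolding d by blast
        then have "conn F1 U1 a c Z" unfolding conn_def using F' U' ac(3) 2(2) by blast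
        then show ?thesis by blast
      qed
    qed
  qed
  have H2: "conn F2 U2 a c Z \<or> z \<notin> U \<and> Z = {a, z, c} \<and> conn F2 U2 z a {z, a} \<and> conn F2 U2 z c {z, c}"
    if co: "conn F U a c Z" and m: "a \<in> W2" "c \<in> W2" for a c Z
  proof -
    have ac: "a \<in> U" "c \<in> U" "a \<noteq> c" using co unfolding conn_def by auto
    consider "Z = {a, c}" "{a, c} \<in> F" | x where "x \<notin> U" "Z = {a, x, c}" "{a, x} \<in> F" "{x, c} \<in> F"
      using co unfolding conn_def by blast
    then show ?thesis
    proof cases
      case 1
      then show ?thesis using m ac unfolding conn_def d by auto
    next
      case 2
      have xW: "x \<in> W2" using cut[OF 2(3)] cut[OF 2(4)] m ac(3) both by auto
      have F': "{a, x} \<in> F2" "{x, c} \<in> F2" "{x, a} \<in> F2" using 2 m xW unfolding d by (auto simp: insert_commute)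
      have U': "a \<in> U2" "c \<in> U2" "z \<in> U2" using ac m unfolding d by auto
      have ne: "x \<noteq> a" "x \<noteq> c" using 2(1) ac by auto
      show ?thesis
      proof (cases "x = z")
        case True
        then have "conn F2 U2 z a {z, a}" "conn F2 U2 z c {z, c}" unfolding conn_def using F' U' ne by auto
        then show ?thesis using True 2 by blast
      next
        case False
        then have "x \<notin> U2" using 2(1) unfolding d by blast
        then have "conn F2 U2 a c Z" unfolding conn_def using F' U' ac(3) 2(2) by blast
        then show ?thesis by blast
      qed
    qed
  qed
  \<comment> \<open>A connection between the two sides has to pass through \<open>z\<close>, which
    is then a crossing. Two disjoint connections cannot both do this.\<close>
  have H12: "z \<notin> U \<and> z \<in> Z \<and> conn F1 U1 z a {z, a} \<and> conn F2 U2 z c {z, c}"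
    if co: "conn F U a c Z" and m: "a \<in> W1" "a \<noteq> z" "c \<in> W2" "c \<noteq> z" for a c Z
  proof -
    have ac: "a \<in> U" "c \<in> U" "a \<noteq> c" using co unfolding conn_def by auto
    have out: "a \<notin> W2" "c \<notin> W1" using m W(2) by blast+
    consider "Z = {a, c}" "{a, c} \<in> F" | x where "x \<notin> U" "Z = {a, x, c}" "{a, x} \<in> F" "{x, c} \<in> F"
      using co unfolding conn_def by blast
    then show ?thesis
    proof cases
      case 1
      then show ?thesis using cut[OF 1(2)] out by blast
    next
      case 2
      have "x \<in> W1" "x \<in> W2" using cut[OF 2(3)] cut[OF 2(4)] out by auto
      then have "x = z" using both by blast
      then show ?thesis using 2 m ac zW unfolding conn_def d by (auto simp: insert_commute)
    qed
  qed
  have "noncrossing F U pos"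
    unfolding noncrossing_def
  proof (intro allI impI notI)
    fix a b c d' Z Z'
    assume ac: "conn F U a c Z" and bd: "conn F U b d' Z'" and Z: "Z \<inter> Z' = {}"
      and o: "pos a < pos b \<and> pos b < pos c \<and> pos c < pos d'"
    have U: "a \<in> U" "b \<in> U" "c \<in> U" "d' \<in> U" using ac bd conn_in by blast+
    have Zm: "a \<in> Z" "c \<in> Z" "b \<in> Z'" "d' \<in> Z'" using ac bd conn_in(4) by blast+
    have nz: "b \<noteq> z" "c \<noteq> z" "d' \<noteq> z" using o unfolding pos_def by auto
    have o': "pos a < pos b" "pos b < pos c" "pos c < pos d'" "pos a < pos c" "pos b < pos d'" using o by auto
    have mono: "x \<in> W1" if "pos x < pos y" "y \<in> W1" "x \<in> U" "y \<in> U" for x y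
      using p12[of x y] that zW by fastforce
    have all1: False if dW: "d' \<in> W1"
    proof -
      have m: "a \<in> W1" "b \<in> W1" "c \<in> W1" using mono o' dW U by blast+
      note q = p1[OF U(1,2) m(1,2) o'(1)] p1[OF U(2,3) m(2,3) o'(2)] p1[OF U(3,4) m(3) dW o'(3)]
      show False
      proof (cases "conn F1 U1 a c Z \<and> conn F1 U1 b d' Z'")
        case True
        then show False using nc1[of a c Z b d' Z'] Z q by blast
      next
        case False
        then consider "z \<notin> U" "Z = {a, z, c}" "conn F1 U1 z c {z, c}" "conn F1 U1 b d' Z'"
          | "z \<notin> U" "Z' = {b, z, d'}" "conn F1 U1 z b {z, b}" "conn F1 U1 a c Z"
          using H1[OF ac m(1,3)] H1[OF bd m(2) dW] Z by blast
        then show False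
        proof cases
          case 1
          show False using nc1[OF 1(3,4)] Z 1(2) z1[OF U(2) m(2) nz(1)] q by blast
        next
          case 2
          have "a \<noteq> z" using 2(1) U by blast
          then show False using nc1[OF 2(3,4)] Z 2(2) z1[OF U(1) m(1)] q by blast
        qed
      qed
    qed
    have W2: "x \<in> W2" if "x \<in> U" "x \<notin> W1" for x using UW that by blast
    \<comment> \<open>The vertices of \<open>W1\<close> form an initial segment of the order, so the
      cases distinguish how many of \<open>a, b, c, d'\<close> belong to it.\<close>
    consider "d' \<in> W1" | "c \<in> W1" "d' \<notin> W1" | "b \<in> W1" "c \<notin> W1" | "a \<in> W1" "b \<notin> W1" | "a \<notin> W1" by blast
    then show False
    proof cases
      case 1
      then show False using all1 by blast
    next
      case 2
      have m: "a \<in> W1" "b \<in> W1" using mono o' 2 U by blast+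
      have h: "z \<notin> U" "z \<in> Z'" "conn F1 U1 z b {z, b}" using H12[OF bd m(2) nz(1) W2[OF U(4) 2(2)] nz(3)] by auto
      have "conn F1 U1 a c Z" using H1[OF ac m(1) 2(1)] h(2) Z by blast
      moreover have "a \<noteq> z" using h(1) U by blast
      ultimately show False
        using nc1[OF h(3), of a c Z] Z h(2) Zm z1[OF U(1) m(1)] p1[OF U(1,2) m o'(1)] p1[OF U(2,3) m(2) 2(1) o'(2)] by blast
    next
      case 3
      have m: "a \<in> W1" "d' \<notin> W1" using mono[OF o'(1) 3(1)] mono[OF o'(3)] 3 U by blast+
      have h: "z \<notin> U" "z \<in> Z'" using H12[OF bd 3(1) nz(1) W2[OF U(4) m(2)] nz(3)] by auto
      have "a \<noteq> z" using h(1) U by blast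
      then have "z \<in> Z" using H12[OF ac m(1) _ W2[OF U(3) 3(2)] nz(2)] by blast
      then show False using h(2) Z by blast
    next
      case 4
      have m: "c \<notin> W1" "d' \<notin> W1" using mono[OF o'(2)] mono[OF o'(5)] 4 U by blast+
      note w = W2[OF U(2) 4(2)] W2[OF U(3) m(1)] W2[OF U(4) m(2)]
      note q = z2[OF U(2) w(1) nz(1)] p2[OF U(2,3) w(1,2) o'(2)] p2[OF U(3,4) w(2,3) o'(3)]
      show False
      proof (cases "a = z")
        case True
        have "conn F2 U2 a c Z" "conn F2 U2 b d' Z'" using H2[OF ac _ w(2)] H2[OF bd w(1,3)] True U zW by blast+
        then show False using nc2[of a c Z b d' Z'] Z q True by blast
      next
        case False
        have h: "z \<in> Z" "conn F2 U2 z c {z, c}" using H12[OF ac 4(1) False w(2) nz(2)] by auto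
        have "conn F2 U2 b d' Z'" using H2[OF bd w(1,3)] h(1) Z by blast
        then show False using nc2[OF h(2), of b d' Z'] Z h(1) Zm q by blast
      qed
    next
      case 5
      have m: "b \<notin> W1" "c \<notin> W1" "d' \<notin> W1" using mono[OF o'(1)] mono[OF o'(4)] mono[of a d'] o 5 U by auto
      note w = W2[OF U(1) 5] W2[OF U(2) m(1)] W2[OF U(3) m(2)] W2[OF U(4) m(3)]
      have az: "a \<noteq> z" using 5 zW by blast
      note q = p2[OF U(1,2) w(1,2) o'(1)] p2[OF U(2,3) w(2,3) o'(2)] p2[OF U(3,4) w(3,4) o'(3)]
      show False
      proof (cases "conn F2 U2 a c Z \<and> conn F2 U2 b d' Z'")
        case True
        then show False using nc2[of a c Z b d' Z'] Z q by blast
      next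
        case False
        then consider "z \<notin> U" "Z = {a, z, c}" "conn F2 U2 z c {z, c}" "conn F2 U2 b d' Z'"
          | "z \<notin> U" "Z' = {b, z, d'}" "conn F2 U2 z b {z, b}" "conn F2 U2 a c Z"
          using H2[OF ac w(1,3)] H2[OF bd w(2,4)] Z by blast
        then show False
        proof cases
          case 1
          show False using nc2[OF 1(3,4)] Z 1(2) z2[OF U(2) w(2) nz(1)] q by blast
        next
          case 2
          show False using nc2[OF 2(3,4)] Z 2(2) z2[OF U(1) w(1) az] q by blast
        qed
      qed
    qed
  qed
  then show ?thesis using inj by blast
qed

end

text \<open>With fewer than four outer vertices nothing interleaves, and a tight graph is ordered
  along its cycle. Otherwise both sides of a cut are ordered by induction and rotated so that the
  cut vertex comes first.\<close>

theorem outer_order: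
  assumes "plane_graph W F h U"
  shows "\<exists>pos :: complex \<Rightarrow> nat. inj_on pos U \<and> noncrossing F U pos"
  using assms
proof (induction "card W" arbitrary: W F U rule: less_induct)
  case less
  then interpret plane_graph W F h U by blast
  have fin: "finite U" using U_subset finite_W finite_subset by blast
  show ?case
  proof (cases "4 \<le> card U")
    case False
    obtain pos :: "complex \<Rightarrow> nat" where inj: "inj_on pos U" using finite_imp_inj_to_nat_seg[OF fin] by blast
    have "noncrossing F U pos"
      unfolding noncrossing_def
    proof (intro allI impI notI)
      fix a b c d Z Z' assume ac: "conn F U a c Z" "conn F U b d Z'" and o: "pos a < pos b \<and> pos b < pos c \<and> pos c < pos d"
      have "{a, b, c, d} \<subseteq> U" using ac conn_in by blast
      moreover have "a \<noteq> b" "a \<noteq> c" "a \<noteq> d" "b \<noteq> c" "b \<noteq> d" "c \<noteq> d" using o by auto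
      ultimately have "4 \<le> card U" using card_mono[OF fin, of "{a, b, c, d}"] by simp
      then show False using False by blast
    qed
    then show ?thesis using inj by blast
  next
    case U4: True
    show ?thesis
    proof (cases tight)
      case True
      then show ?thesis using tight_noncrossing U4 by blast
    next
      case False
      obtain W1 W2 z where c: "W1 \<union> W2 = W" "W1 \<inter> W2 = {z}" "W1 \<noteq> W" "W2 \<noteq> W" "\<forall>e\<in>F. e \<subseteq> W1 \<or> e \<subseteq> W2"
        "z \<in> U \<or> (\<exists>y\<in>W1 - {z}. {z, y} \<in> F) \<and> (\<exists>y\<in>W2 - {z}. {z, y} \<in> F)"
        by (rule cut_exists[OF False U4])
      have IH: "\<exists>pos :: complex \<Rightarrow> nat. inj_on pos ((U \<inter> A) \<union> {z}) \<and> noncrossing {e \<in> F. e \<subseteq> A} ((U \<inter> A) \<union> {z}) pos \<and>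
          (\<forall>x\<in>(U \<inter> A) \<union> {z}. x \<noteq> z \<longrightarrow> pos z < pos x)"
        if A: "A \<subset> W" "z \<in> A" "z \<in> U \<or> (\<exists>y. y \<notin> A \<and> {z, y} \<in> F)" for A
      proof -
        have "z \<in> U \<or> outer_point (\<Union>(h ` {e \<in> F. e \<subseteq> A})) z" using A cut_outer[of z A] by blast
        then have pg: "plane_graph A {e \<in> F. e \<subseteq> A} h ((U \<inter> A) \<union> {z})" using subgraph[of A z] A by blast
        have "card A < card W" using A(1) finite_W psubset_card_mono by blast
        then obtain pos :: "complex \<Rightarrow> nat" where p: "inj_on pos ((U \<inter> A) \<union> {z})" "noncrossing {e \<in> F. e \<subseteq> A} ((U \<inter> A) \<union> {z}) pos"
          using less.hyps[OF _ pg] by blast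
        have f: "finite ((U \<inter> A) \<union> {z})" "z \<in> (U \<inter> A) \<union> {z}" using fin by auto
        show ?thesis by (rule noncrossing_rotate[OF f(1) p f(2)]) blast
      qed
      have "W1 \<subset> W" "W2 \<subset> W" "z \<in> W1" "z \<in> W2" using c by auto
      moreover have "z \<in> U \<or> (\<exists>y. y \<notin> W1 \<and> {z, y} \<in> F)" "z \<in> U \<or> (\<exists>y. y \<notin> W2 \<and> {z, y} \<in> F)" using c(2,6) by blast+
      ultimately obtain pos1 pos2 :: "complex \<Rightarrow> nat" where q:
        "inj_on pos1 ((U \<inter> W1) \<union> {z})" "noncrossing {e \<in> F. e \<subseteq> W1} ((U \<inter> W1) \<union> {z}) pos1"
        "\<forall>x\<in>(U \<inter> W1) \<union> {z}. x \<noteq> z \<longrightarrow> pos1 z < pos1 x"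
        "inj_on pos2 ((U \<inter> W2) \<union> {z})" "noncrossing {e \<in> F. e \<subseteq> W2} ((U \<inter> W2) \<union> {z}) pos2"
        "\<forall>x\<in>(U \<inter> W2) \<union> {z}. x \<noteq> z \<longrightarrow> pos2 z < pos2 x"
        using IH[of W1] IH[of W2] by blast
      show ?thesis by (rule compose[OF c(1,2) c(5)[rule_format] q(1,2) q(3)[rule_format] q(4,5) q(6)[rule_format]])
    qed
  qed
qed

section \<open>Drawings\<close>

lemma joins_split:
  assumes "joins A a b" "x \<in> A - {a, b}"
  shows "\<exists>P Q. joins P a x \<and> joins Q b x \<and> P \<union> Q = A \<and> P \<inter> Q = {x}"
proof -
  obtain g where g: "arc g" "pathstart g = a" "pathfinish g = b" "path_image g = A"
    using assms(1) unfolding joins_def by blast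
  obtain t where t: "t \<in> {0..1}" "g t = x" using assms(2) g(4) unfolding path_image_def by blast
  have t01: "0 < t" "t < 1" using t assms(2) g(2,3) unfolding pathstart_def pathfinish_def
    by (metis DiffD2 atLeastAtMost_iff insertI1 insertI2 order_le_less)+
  have P: "joins (g ` {0..t}) a x"
    unfolding joins_def using arc_subpath_arc[OF g(1), of 0 t] t t01 g(2)
    by (intro exI[of _ "subpath 0 t g"]) (auto simp: path_image_subpath pathstart_def[of g])
  have Q: "joins (g ` {t..1}) x b"
    unfolding joins_def using arc_subpath_arc[OF g(1), of t 1] t t01 g(3)
    by (intro exI[of _ "subpath t 1 g"]) (auto simp: path_image_subpath pathfinish_def[of g])
  have "{0..t} \<union> {t..1} = {0..1}" using t01 by auto
  then have "g ` {0..t} \<union> g ` {t..1} = A" using g(4) unfolding path_image_def by (metis image_Un)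
  moreover have "g ` {0..t} \<inter> g ` {t..1} = {x}"
  proof -
    have "inj_on g {0..1}" using g(1) unfolding arc_def by blast
    then have "g ` {0..t} \<inter> g ` {t..1} = g ` ({0..t} \<inter> {t..1})"
      by (rule inj_on_image_Int[symmetric]) (use t01 in auto)
    moreover have "{0..t} \<inter> {t..1} = {t}" using t01 by auto
    ultimately show ?thesis using t by simp
  qed
  ultimately show ?thesis using P joins_sym[OF Q] by blast
qed

lemma drawing_order:
  fixes V :: "'a set"
  assumes G: "finite_simple_graph V E" and D: "outer_1_plane V E p g"
  obtains ord :: "'a \<Rightarrow> nat" where "inj_on ord V"
    "\<And>a b c d. {a, c} \<in> E \<Longrightarrow> {b, d} \<in> E \<Longrightarrow> ord a < ord b \<Longrightarrow> ord b < ord c \<Longrightarrow> ord c < ord d \<Longrightarrow>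
      \<exists>x. (x, {{a, c}, {b, d}}) \<in> crossings V E p g"
proof -
  have finV: "finite V" and E2: "\<And>e. e \<in> E \<Longrightarrow> e \<subseteq> V \<and> card e = 2" using G unfolding finite_simple_graph_def by auto
  have finE: "finite E" using E2 finV by (meson Pow_iff finite_Pow_iff finite_subset subsetI)
  have inj: "inj_on p V" and dr: "\<And>e. e \<in> E \<Longrightarrow> arc (g e) \<and> {pathstart (g e), pathfinish (g e)} = p ` e \<and> path_image (g e) \<inter> p ` V = p ` e"
    using D unfolding outer_1_plane_def is_drawing_def by auto
  have fr: "\<And>v. v \<in> V \<Longrightarrow> p v \<in> frontier (outside (drawing_image V E p g))"
    using D unfolding outer_1_plane_def by blast
  have once: "\<And>e c c'. e \<in> E \<Longrightarrow> c \<in> crossings V E p g \<Longrightarrow> c' \<in> crossings V E p g \<Longrightarrow> e \<in> snd c \<Longrightarrow> e \<in> snd c' \<Longrightarrow> c = c'"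
    using D unfolding outer_1_plane_def by blast
  \<comment> \<open>The crossing points on \<open>e\<close>; there is at most one, since
    \<open>e\<close> belongs to at most one crossing.\<close>
  define xs where "xs e = {x. \<exists>f\<in>E. f \<noteq> e \<and> x \<in> path_image (g e) \<inter> path_image (g f) - p ` V}" for e
  have xs_cross: "\<exists>f. f \<in> E \<and> f \<noteq> e \<and> x \<in> path_image (g f) \<and> (x, {e, f}) \<in> crossings V E p g" if "e \<in> E" "x \<in> xs e" for e x
    using that unfolding xs_def crossings_def by blast
  have xs1: "x = y" if exy: "e \<in> E" "x \<in> xs e" "y \<in> xs e" for e x y
  proof -
    obtain f f' where "(x, {e, f}) \<in> crossings V E p g" "(y, {e, f'}) \<in> crossings V E p g"
      using xs_cross[OF exy(1,2)] xs_cross[OF exy(1,3)] by blast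
    then show ?thesis using once[OF exy(1), of "(x, {e, f})" "(y, {e, f'})"] by simp
  qed
  have xsV: "x \<notin> p ` V" "x \<in> path_image (g e)" if "x \<in> xs e" for x e using that unfolding xs_def by auto
  have xsI: "z \<in> xs e" if "e \<in> E" "f \<in> E" "e \<noteq> f" "z \<in> path_image (g e)" "z \<in> path_image (g f)" "z \<notin> p ` V" for z e f
    using that unfolding xs_def by blast
  define W where "W = p ` V \<union> (\<Union>e\<in>E. xs e)"
  have finxs: "finite (xs e)" if "e \<in> E" for e
  proof (cases "xs e = {}")
    case False
    then obtain x where "x \<in> xs e" by blast
    then have "xs e \<subseteq> {x}" using xs1[OF that] by blast
    then show ?thesis using finite_subset by blast
  qed simp
  have finW: "finite W" unfolding W_def using finV finE finxs by blast
  have onW: "z \<in> p ` e \<or> z \<in> xs e" if ez: "e \<in> E" "z \<in> path_image (g e)" "z \<in> W" for e z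
  proof (cases "z \<in> p ` V")
    case True
    then show ?thesis using dr[OF that(1)] that by blast
  next
    case False
    then obtain f where f: "f \<in> E" "z \<in> xs f" using ez(3) unfolding W_def by blast
    then show ?thesis using xsI[OF that(1) f(1) _ that(2) xsV(2)[OF f(2)] False] by blast
  qed
  have jo: "joins (path_image (g {a, b})) (p a) (p b)" if "{a, b} \<in> E" for a b
  proof -
    have "{pathstart (g {a, b}), pathfinish (g {a, b})} = {p a, p b}" "arc (g {a, b})" using dr[OF that] by auto
    then have "joins (path_image (g {a, b})) (p a) (p b) \<or> joins (path_image (g {a, b})) (p b) (p a)"
      unfolding joins_def by (metis doubleton_eq_iff)
    then show ?thesis using joins_sym by blast
  qed
  have ab: "\<exists>a b. e = {a, b} \<and> a \<noteq> b \<and> a \<in> V \<and> b \<in> V" if "e \<in> E" for e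
    using E2[OF that] by (auto simp: card_2_iff)
  define halves where "halves e x H \<longleftrightarrow> (\<forall>v\<in>e. joins (H v) (p v) x \<and> H v \<subseteq> path_image (g e)) \<and>
      (\<forall>v\<in>e. \<forall>w\<in>e. v \<noteq> w \<longrightarrow> H v \<inter> H w = {x})" for e x and H :: "'a \<Rightarrow> complex set"
  have ex: "\<exists>H. (\<forall>v\<in>e. joins (H v) (p v) x \<and> H v \<subseteq> path_image (g e)) \<and> (\<forall>v\<in>e. \<forall>w\<in>e. v \<noteq> w \<longrightarrow> H v \<inter> H w = {x})"
    if eE: "e \<in> E" and x: "x \<in> xs e" for e x
  proof -
    obtain a b where e: "e = {a, b}" "a \<noteq> b" "a \<in> V" "b \<in> V" using ab[OF eE] by blast
    have "x \<in> path_image (g e) - {p a, p b}" using xsV[OF x] e by auto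
    then obtain P Q where PQ: "joins P (p a) x" "joins Q (p b) x" "P \<union> Q = path_image (g e)" "P \<inter> Q = {x}"
      using joins_split[OF jo, of a b x] eE e by auto
    show ?thesis using PQ e by (intro exI[of _ "\<lambda>v. if v = a then P else Q"]) auto
  qed
  define H where "H e x = (SOME K. halves e x K)" for e x
  have "halves e x (H e x)" if "e \<in> E" "x \<in> xs e" for e x
  proof -
    have "\<exists>K. halves e x K" using ex[OF that] unfolding halves_def .
    then show ?thesis unfolding H_def by (rule someI_ex)
  qed
  then have H: "\<And>e x v. e \<in> E \<Longrightarrow> x \<in> xs e \<Longrightarrow> v \<in> e \<Longrightarrow> joins (H e x v) (p v) x \<and> H e x v \<subseteq> path_image (g e)"
      "\<And>e x v w. e \<in> E \<Longrightarrow> x \<in> xs e \<Longrightarrow> v \<in> e \<Longrightarrow> w \<in> e \<Longrightarrow> v \<noteq> w \<Longrightarrow> H e x v \<inter> H e x w = {x}"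
    unfolding halves_def by blast+
  \<comment> \<open>The edges of the plane graph: an uncrossed edge as a whole, a crossed one as two
    halves that end in the crossing point. \<open>k\<close> is the pair of ends and \<open>A\<close>
    the arc.\<close>
  define part where "part e k A \<longleftrightarrow> e \<in> E \<and> (xs e = {} \<and> k = p ` e \<and> A = path_image (g e) \<or>
      (\<exists>v\<in>e. \<exists>x\<in>xs e. k = {p v, x} \<and> A = H e x v))" for e k A
  define F where "F = {k. \<exists>e A. part e k A}"
  define h where "h k = (SOME A. \<exists>e. part e k A)" for k
  have hF: "\<exists>e. part e k (h k)" if "k \<in> F" for k
  proof -
    have "\<exists>A. \<exists>e. part e k A" using that unfolding F_def by blast
    then show ?thesis unfolding h_def by (rule someI_ex)
  qed
  have part_sub: "A \<subseteq> path_image (g e)" if "part e k A" for e k A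
    using that H(1) unfolding part_def by blast
  have part_joins: "\<exists>a b. k = {a, b} \<and> a \<in> p ` V \<and> b \<in> W \<and> joins A a b" if pt: "part e k A" for e k A
  proof -
    have eE: "e \<in> E" using pt unfolding part_def by blast
    obtain a b where e: "e = {a, b}" "a \<in> V" "b \<in> V" using ab[OF eE] by blast
    consider "k = p ` e" "A = path_image (g e)" | v x where "v \<in> e" "x \<in> xs e" "k = {p v, x}" "A = H e x v"
      using pt unfolding part_def by blast
    then show ?thesis
    proof cases
      case 1
      then show ?thesis using jo[of a b] e eE unfolding W_def by auto
    next
      case 2
      have "v \<in> V" using 2(1) e by auto
      then show ?thesis using H(1)[OF eE 2(2,1)] 2 eE unfolding W_def by blast
    qed
  qed
  have part_W: "A \<inter> W = k" if pt: "part e k A" for e k A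
  proof -
    have eE: "e \<in> E" using pt unfolding part_def by blast
    obtain a b where jk: "k = {a, b}" "a \<in> p ` V" "b \<in> W" "joins A a b" using part_joins[OF pt] by blast
    have "k \<subseteq> A \<inter> W" using jk joins_ends[OF jk(4)] unfolding W_def by auto
    moreover have "A \<inter> W \<subseteq> k"
    proof
      fix z assume z: "z \<in> A \<inter> W"
      then have ze: "z \<in> p ` e \<or> z \<in> xs e" using onW[OF eE] part_sub[OF pt] by blast
      consider "xs e = {}" "k = p ` e" | v x where "v \<in> e" "x \<in> xs e" "k = {p v, x}" "A = H e x v"
        using pt unfolding part_def by blast
      then show "z \<in> k"
      proof cases
        case 1
        then show ?thesis using ze by blast
      next
        case 2
        show ?thesis
        proof (cases "z \<in> xs e")
          case True
          then show ?thesis using xs1[OF eE True 2(2)] 2 by blast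
        next
          case False
          then obtain w where w: "w \<in> e" "z = p w" using ze by blast
          show ?thesis
          proof (cases "w = v")
            case False
            have "z \<in> H e x w" using H(1)[OF eE 2(2) w(1)] joins_ends w by blast
            then have "z \<in> {x}" using H(2)[OF eE 2(2) 2(1) w(1)] False z 2(4) by blast
            then show ?thesis using 2 by blast
          qed (use w 2 in blast)
        qed
      qed
    qed
    ultimately show ?thesis by blast
  qed
  have part_int: "A \<inter> B \<subseteq> k \<inter> l" if pk: "part e k A" and pl: "part f l B" and kl: "k \<noteq> l" for e f k l A B
  proof (cases "e = f")
    case True
    have eE: "e \<in> E" using pk unfolding part_def by blast
    obtain v x w y where vx: "v \<in> e" "x \<in> xs e" "k = {p v, x}" "A = H e x v" "w \<in> e" "y \<in> xs e" "l = {p w, y}" "B = H e y w"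
      using pk pl kl True unfolding part_def by blast
    have "x = y" using xs1[OF eE vx(2,6)] .
    then have "v \<noteq> w" using kl vx by auto
    then show ?thesis using H(2)[OF eE vx(2,1,5)] vx \<open>x = y\<close> by auto
  next
    case False
    have eE: "e \<in> E" "f \<in> E" using pk pl unfolding part_def by blast+
    show ?thesis
    proof
      fix z assume z: "z \<in> A \<inter> B"
      then have zz: "z \<in> path_image (g e)" "z \<in> path_image (g f)" using part_sub[OF pk] part_sub[OF pl] by blast+
      have "z \<in> W"
      proof (cases "z \<in> p ` V")
        case False
        then have "z \<in> xs e" using xsI[OF eE \<open>e \<noteq> f\<close> zz] by blast
        then show ?thesis unfolding W_def using eE by blast
      qed (simp add: W_def)
      then show "z \<in> k \<inter> l" using part_W[OF pk] part_W[OF pl] z by blast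
    qed
  qed
  \<comment> \<open>The inside of a closed curve in the drawing is open and disjoint from the outer
    face, so it contains no boundary point of that face.\<close>
  have outer: "outer_point (\<Union>(h ` F)) z" if z: "z \<in> p ` V" for z
    unfolding outer_point_def
  proof (intro allI impI notI)
    fix J assume J: "jordan J \<and> J \<subseteq> \<Union>(h ` F)" and zi: "z \<in> inside J"
    have "h k \<subseteq> drawing_image V E p g" if k: "k \<in> F" for k
    proof -
      obtain e where e: "part e k (h k)" using hF[OF k] by blast
      then have "e \<in> E" unfolding part_def by blast
      then show ?thesis using part_sub[OF e] unfolding drawing_image_def by blast
    qed
    then have "J \<subseteq> drawing_image V E p g" using J by blast
    then have "outside (drawing_image V E p g) \<subseteq> outside J" by (rule outside_mono)
    moreover have "z \<in> closure (outside (drawing_image V E p g))" using fr z by (auto simp: frontier_def)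
    ultimately have "z \<in> closure (outside J)" using closure_mono by blast
    then have "inside J \<inter> outside J \<noteq> {}"
      using jordanD(3)[of J] J zi by (metis closure_iff_nhds_not_empty disjoint_iff open_Int_closure_eq_empty)
    then show False by simp
  qed
  have "plane_graph W F h (p ` V)"
  proof
    show "finite W" by (rule finW)
    show "p ` V \<subseteq> W" unfolding W_def by blast
    show "\<exists>a b. k = {a, b} \<and> a \<in> W \<and> b \<in> W \<and> joins (h k) a b" if k: "k \<in> F" for k
    proof -
      obtain e where e: "part e k (h k)" using hF[OF k] by blast
      obtain a b where ab: "k = {a, b}" "a \<in> p ` V" "b \<in> W" "joins (h k) a b" using part_joins[OF e] by blast
      then have "a \<in> W" unfolding W_def by blast
      then show ?thesis using ab by blast
    qed
    show "h k \<inter> W = k" if k: "k \<in> F" for k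
    proof -
      obtain e where e: "part e k (h k)" using hF[OF k] by blast
      show ?thesis by (rule part_W[OF e])
    qed
    show "h k \<inter> h l \<subseteq> k \<inter> l" if k: "k \<in> F" "l \<in> F" "k \<noteq> l" for k l
    proof -
      obtain e where e: "part e k (h k)" using hF[OF k(1)] by blast
      obtain f where f: "part f l (h l)" using hF[OF k(2)] by blast
      show ?thesis by (rule part_int[OF e f k(3)])
    qed
    show "a \<in> p ` V \<or> b \<in> p ` V" if ab: "{a, b} \<in> F" for a b
    proof -
      obtain e where e: "part e {a, b} (h {a, b})" using hF[OF ab] by blast
      obtain a' b' where "{a, b} = {a', b'}" "a' \<in> p ` V" using part_joins[OF e] by blast
      then show ?thesis by (metis doubleton_eq_iff)
    qed
  qed (rule outer)
  then obtain pos :: "complex \<Rightarrow> nat" where pos: "inj_on pos (p ` V)" "noncrossing F (p ` V) pos"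
    using outer_order by blast
  have co: "conn F (p ` V) (p a) (p b) (p ` {a, b} \<union> xs {a, b})" if e: "{a, b} \<in> E" for a b
  proof -
    have V: "a \<in> V" "b \<in> V" "a \<noteq> b" using E2[OF e] by (auto simp: card_insert_if split: if_splits)
    then have ne: "p a \<noteq> p b" using inj by (meson inj_onD)
    show ?thesis
    proof (cases "xs {a, b} = {}")
      case True
      then have "part {a, b} {p a, p b} (path_image (g {a, b}))" unfolding part_def using e by auto
      then have "{p a, p b} \<in> F" unfolding F_def by blast
      then show ?thesis unfolding conn_def using V ne True by auto
    next
      case False
      then obtain x where x: "x \<in> xs {a, b}" by blast
      then have xx: "xs {a, b} = {x}" using xs1[OF e] by blast
      have "part {a, b} {p v, x} (H {a, b} x v)" if "v \<in> {a, b}" for v unfolding part_def using e x that by blast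
      then have "{p a, x} \<in> F" "{p b, x} \<in> F" unfolding F_def by blast+
      moreover have "x \<notin> p ` V" using xsV x by blast
      ultimately show ?thesis unfolding conn_def xx using V ne
        by (intro conjI disjI2 exI[of _ x]) (auto simp: insert_commute)
    qed
  qed
  show ?thesis
  proof (rule that[of "\<lambda>v. pos (p v)"])
    show "inj_on (\<lambda>v. pos (p v)) V" using comp_inj_on[OF inj pos(1)] unfolding comp_def .
    fix a b c d assume e: "{a, c} \<in> E" "{b, d} \<in> E" and o: "pos (p a) < pos (p b)" "pos (p b) < pos (p c)" "pos (p c) < pos (p d)"
    \<comment> \<open>Interleaving connections share a vertex of the plane graph. The four ends are
      different points, so the shared vertex is a crossing point of both edges.\<close>
    have "(p ` {a, c} \<union> xs {a, c}) \<inter> (p ` {b, d} \<union> xs {b, d}) \<noteq> {}"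
      using noncrossingD[OF pos(2) co[OF e(1)] co[OF e(2)] _ o] by blast
    then obtain z where z: "z \<in> p ` {a, c} \<union> xs {a, c}" "z \<in> p ` {b, d} \<union> xs {b, d}" by blast
    have V: "{a, c} \<subseteq> V" "{b, d} \<subseteq> V" using E2 e by blast+
    have ne: "{a, c} \<noteq> {b, d}" using o by (auto simp: doubleton_eq_iff)
    have pd: "p ` {a, c} \<inter> p ` {b, d} = {}" using o by auto
    have pV: "p ` {a, c} \<subseteq> p ` V" "p ` {b, d} \<subseteq> p ` V" by (rule image_mono[OF V(1)], rule image_mono[OF V(2)])
    have zx1: "z \<in> xs {a, c}"
    proof (rule ccontr)
      assume "z \<notin> xs {a, c}"
      then have 1: "z \<in> p ` {a, c}" using z(1) by (simp only: Un_iff simp_thms)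
      then have "z \<notin> p ` {b, d}" using pd by (meson disjoint_iff)
      then have "z \<in> xs {b, d}" using z(2) by (simp only: Un_iff simp_thms)
      then show False using xsV(1) subsetD[OF pV(1) 1] by simp
    qed
    then have "z \<notin> p ` {b, d}" using xsV(1) subsetD[OF pV(2)] by metis
    then have zx2: "z \<in> xs {b, d}" using z(2) by (simp only: Un_iff simp_thms)
    note zx = zx1 zx2
    have "(z, {{a, c}, {b, d}}) \<in> crossings V E p g"
      unfolding crossings_def mem_Collect_eq
      by (rule exI[of _ z], rule exI[of _ "{a, c}"], rule exI[of _ "{b, d}"]) (use e ne xsV[OF zx(1)] xsV[OF zx(2)] in simp)
    then show "\<exists>x. (x, {{a, c}, {b, d}}) \<in> crossings V E p g" ..
  qed
qed

section \<open>From the vertex order to the colouring\<close>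

lemma vertex_degree_mono:
  assumes "finite E" "E' \<subseteq> E"
  shows "vertex_degree E' v \<le> vertex_degree E v"
  unfolding vertex_degree_def using assms by (intro card_mono) auto

text \<open>Deleting edges cannot bring crossings closer, raise degrees or create interleaving
  pairs. All hypotheses therefore pass to subgraphs, and a minimal counterexample is a
  \<open>convex_critical\<close> graph.\<close>

theorem convex_list_colorable:
  fixes E :: "'a::linorder set set"
  assumes "finite E" "\<And>e. e \<in> E \<Longrightarrow> card e = 2" "\<And>v. vertex_degree E v \<le> 4"
    and "\<And>e. e \<in> E \<Longrightarrow> finite (L e) \<and> 4 \<le> card (L e)"
    and "\<And>e f g. \<lbrakk>e \<in> E; f \<in> E; g \<in> E; interleaved e f; interleaved e g\<rbrakk> \<Longrightarrow> f = g"
    and "\<And>e f e' f' x y. \<lbrakk>e \<in> E; f \<in> E; interleaved e f; e' \<in> E; f' \<in> E; interleaved e' f'; x \<in> e \<union> f; y \<in> e' \<union> f';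
        x = y \<or> {x, y} \<in> E \<or> (\<exists>z. {x, z} \<in> E \<and> {z, y} \<in> E)\<rbrakk> \<Longrightarrow> {e, f} = {e', f'}"
  shows "list_colorable E L"
  using assms
proof (induction E rule: finite_psubset_induct)
  case (psubset E)
  show ?case
  proof (rule ccontr)
    assume n: "\<not> list_colorable E L"
    have crit: "list_colorable E' L" if E': "E' \<subset> E" for E'
    proof (rule psubset.IH[OF E'])
      have sub: "\<And>e. e \<in> E' \<Longrightarrow> e \<in> E" using E' by blast
      show "card e = 2" if "e \<in> E'" for e using psubset.prems(1) sub[OF that] .
      show "vertex_degree E' v \<le> 4" for v
        using vertex_degree_mono[OF psubset.hyps, OF psubset_imp_subset[OF E'], of v] psubset.prems(2)[of v] by (rule order_trans)
      show "finite (L e) \<and> 4 \<le> card (L e)" if "e \<in> E'" for e using psubset.prems(3) sub[OF that] .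
      show "f = g" if "e \<in> E'" "f \<in> E'" "g \<in> E'" "interleaved e f" "interleaved e g" for e f g
        using psubset.prems(4)[OF sub[OF that(1)] sub[OF that(2)] sub[OF that(3)] that(4,5)] .
      show "{e, f} = {e', f'}" if "e \<in> E'" "f \<in> E'" "interleaved e f" "e' \<in> E'" "f' \<in> E'" "interleaved e' f'"
        "x \<in> e \<union> f" "y \<in> e' \<union> f'" "x = y \<or> {x, y} \<in> E' \<or> (\<exists>z. {x, z} \<in> E' \<and> {z, y} \<in> E')" for e f e' f' x y
      proof -
        have "x = y \<or> {x, y} \<in> E \<or> (\<exists>z. {x, z} \<in> E \<and> {z, y} \<in> E)" using that(9) sub by blast
        then show ?thesis
          using psubset.prems(5)[OF sub[OF that(1)] sub[OF that(2)] that(3) sub[OF that(4)] sub[OF that(5)] that(6-8)] by blast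
      qed
    qed
    interpret convex_critical E L
      by unfold_locales
        (fact psubset.hyps psubset.prems(1) psubset.prems(2) psubset.prems(3) crit n interleaved_sym psubset.prems(5) psubset.prems(4))+
    show False by (rule contradiction)
  qed
qed

lemma graph_dist_le:
  assumes "is_walk V E xs" "hd xs = u" "last xs = v"
  shows "graph_dist V E u v \<le> enat (length xs - 1)"
  unfolding graph_dist_def using assms by (intro Inf_lower) blast

lemma near_dist:
  assumes E: "\<And>e. e \<in> E \<Longrightarrow> e \<subseteq> V" and xy: "x \<in> V" "y \<in> V" "x = y \<or> {x, y} \<in> E \<or> (\<exists>z. {x, z} \<in> E \<and> {z, y} \<in> E)"
  shows "graph_dist V E x y \<le> 2"
proof -
  consider "x = y" | "{x, y} \<in> E" | z where "{x, z} \<in> E" "{z, y} \<in> E" using xy(3) by blast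
  then show ?thesis
  proof cases
    case 1
    have "graph_dist V E x y \<le> enat (length [x] - 1)"
      by (rule graph_dist_le) (use 1 xy in \<open>auto simp: is_walk_def\<close>)
    then show ?thesis by (simp add: zero_enat_def[symmetric])
  next
    case 2
    have "graph_dist V E x y \<le> enat (length [x, y] - 1)"
      by (rule graph_dist_le) (use 2 xy in \<open>auto simp: is_walk_def\<close>)
    also have "\<dots> \<le> enat 2" by simp
    finally show ?thesis by (simp add: numeral_eq_enat)
  next
    case 3
    have "z \<in> V" using E[OF 3(1)] by simp
    have "graph_dist V E x y \<le> enat (length [x, z, y] - 1)"
    proof (rule graph_dist_le)
      show "is_walk V E [x, z, y]" using 3 xy \<open>z \<in> V\<close> by (auto simp: is_walk_def less_Suc_eq)
    qed auto
    then show ?thesis by (simp add: numeral_eq_enat numeral_2_eq_2)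
  qed
qed

lemma crossings_apart:
  assumes G: "finite_simple_graph V E" and D: "good_drawing V E p g" and dist: "3 \<le> crossing_distance V E"
    and c: "(a, {e, f}) \<in> crossings V E p g" "(b, {e', f'}) \<in> crossings V E p g" "e \<in> E" "f \<in> E" "e' \<in> E" "f' \<in> E"
    and xy: "x \<in> e \<union> f" "y \<in> e' \<union> f'" "x = y \<or> {x, y} \<in> E \<or> (\<exists>z. {x, z} \<in> E \<and> {z, y} \<in> E)"
  shows "{e, f} = {e', f'}"
proof (rule ccontr)
  assume "{e, f} \<noteq> {e', f'}"
  then have ne: "(a, {e, f}) \<noteq> (b, {e', f'})" by blast
  have E: "\<And>e. e \<in> E \<Longrightarrow> e \<subseteq> V" using G unfolding finite_simple_graph_def by blast
  have V: "x \<in> V" "y \<in> V" using xy(1,2) E[OF c(3)] E[OF c(4)] E[OF c(5)] E[OF c(6)] by auto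
  have "graph_dist V E x y \<le> 2" using near_dist[OF _ V xy(3)] E by blast
  moreover have "dist_of_crossings V E (a, {e, f}) (b, {e', f'}) \<le> graph_dist V E x y"
    unfolding dist_of_crossings_def crossing_ends_def using xy by (intro Inf_lower) auto
  moreover have "crossing_distance V E \<le> dist_of_crossings V E (a, {e, f}) (b, {e', f'})"
    unfolding crossing_distance_def using D c ne by (intro Inf_lower) blast
  ultimately have "(3::enat) \<le> 2" using dist by (meson order_trans)
  then show False by simp
qed

text \<open>Interleaving needs linearly ordered vertices; this brings a colouring of the image of
  the graph under the order function back to the original vertices.\<close>

lemma list_colorable_transfer:
  assumes E: "\<And>e. e \<in> E \<Longrightarrow> e \<subseteq> V" and inj: "inj_on f V"
    and col: "list_colorable ((`) f ` E) (\<lambda>e. L (the_inv_into E ((`) f) e))"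
  shows "list_colorable E L"
proof -
  have injE: "inj_on ((`) f) E" using inj_on_image_Pow[OF inj] E by (meson PowI inj_on_subset subsetI)
  obtain c where c: "proper_edge_coloring ((`) f ` E) c" "\<forall>e\<in>(`) f ` E. c e \<in> L (the_inv_into E ((`) f) e)"
    using col unfolding list_colorable_def by blast
  have "proper_edge_coloring E (\<lambda>e. c (f ` e))"
    unfolding proper_edge_coloring_def
  proof (intro ballI impI)
    fix e e' assume e: "e \<in> E" "e' \<in> E" "e \<noteq> e' \<and> e \<inter> e' \<noteq> {}"
    then obtain v where "v \<in> e" "v \<in> e'" by blast
    then have "f ` e \<inter> f ` e' \<noteq> {}" by blast
    moreover have "f ` e \<noteq> f ` e'" using inj_onD[OF injE] e by metis
    ultimately have "f ` e \<noteq> f ` e' \<and> f ` e \<inter> f ` e' \<noteq> {}" by simp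
    then show "c (f ` e) \<noteq> c (f ` e')" using c(1) e(1,2) unfolding proper_edge_coloring_def by simp
  qed
  moreover have "c (f ` e) \<in> L e" if "e \<in> E" for e
    using bspec[OF c(2) imageI[OF that]] the_inv_into_f_f[OF injE that] by simp
  ultimately show ?thesis unfolding list_colorable_def by blast
qed

lemma vertex_degree_inj_image:
  assumes fin: "finite E" and E: "\<And>e. e \<in> E \<Longrightarrow> e \<subseteq> V" and inj: "inj_on f V" and deg: "\<And>v. vertex_degree E v \<le> k"
  shows "vertex_degree ((`) f ` E) w \<le> k"
proof (cases "w \<in> f ` V")
  case True
  then obtain v where v: "v \<in> V" "w = f v" by blast
  have "{e \<in> (`) f ` E. w \<in> e} \<subseteq> (`) f ` {e \<in> E. v \<in> e}"
  proof
    fix e' assume "e' \<in> {e \<in> (`) f ` E. w \<in> e}"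
    then have e': "e' \<in> (`) f ` E" "w \<in> e'" by simp_all
    from e'(1) obtain e where e: "e' = f ` e" "e \<in> E" by (rule imageE)
    from e'(2) obtain u where u: "f v = f u" "u \<in> e" unfolding e(1) v(2) by (rule imageE)
    have "u \<in> V" using E[OF e(2)] u(2) by (rule subsetD)
    then have "v = u" using inj_onD[OF inj u(1) v(1)] by simp
    then have "e \<in> {e \<in> E. v \<in> e}" using e u by simp
    then show "e' \<in> (`) f ` {e \<in> E. v \<in> e}" unfolding e(1) by (rule imageI)
  qed
  then have "vertex_degree ((`) f ` E) w \<le> card ((`) f ` {e \<in> E. v \<in> e})"
    unfolding vertex_degree_def using fin by (intro card_mono) simp_all
  also have "\<dots> \<le> vertex_degree E v" unfolding vertex_degree_def by (rule card_image_le) (use fin in simp)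
  also have "\<dots> \<le> k" by (rule deg)
  finally show ?thesis .
next
  case False
  have "w \<notin> f ` e" if "e \<in> E" for e using False image_mono[OF E[OF that], of f] by (rule contra_subsetD[rotated])
  then have none: "{e \<in> (`) f ` E. w \<in> e} = {}" by blast
  show ?thesis unfolding vertex_degree_def none by simp
qed

lemma interleaved_crossing:
  assumes E2: "\<And>e. e \<in> E \<Longrightarrow> card e = 2" and ef: "e \<in> E" "f \<in> E" and il: "interleaved (ord ` e) (ord ` f)"
    and cr: "\<And>a b c d. \<lbrakk>{a, c} \<in> E; {b, d} \<in> E; ord a < ord b; ord b < ord c; ord c < ord d\<rbrakk>
       \<Longrightarrow> \<exists>x. (x, {{a, c}, {b, d}}) \<in> C"
  shows "\<exists>x. (x, {e, f}) \<in> C"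
proof -
  have ends: "\<exists>x y. h = {x, y} \<and> ord x = a \<and> ord y = c" if h: "ord ` h = {a, c}" "a < c" "h \<in> E" for a c h
  proof -
    have "a \<in> ord ` h" "c \<in> ord ` h" using h(1) by simp_all
    then obtain x y where xy: "x \<in> h" "y \<in> h" "a = ord x" "c = ord y" by blast
    obtain p q where pq: "h = {p, q}" using E2[OF h(3)] by (auto simp: card_2_iff)
    have "x \<noteq> y" using h(2) xy by auto
    then have "h = {x, y}" using xy(1,2) pq by auto
    then show ?thesis using xy(3,4) by blast
  qed
  obtain a b c d where lt: "a < b" "b < c" "c < d"
    and "ord ` e = {a, c} \<and> ord ` f = {b, d} \<or> ord ` e = {b, d} \<and> ord ` f = {a, c}"
    using il unfolding interleaved_def by blast
  then obtain e' f' where ef': "{e, f} = {e', f'}" "e' \<in> E" "f' \<in> E" "ord ` e' = {a, c}" "ord ` f' = {b, d}"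
    using ef insert_commute[of e f "{}"] by metis
  obtain x y where 1: "e' = {x, y}" "ord x = a" "ord y = c" using ends[OF ef'(4) _ ef'(2)] lt by force
  obtain u w where 2: "f' = {u, w}" "ord u = b" "ord w = d" using ends[OF ef'(5) _ ef'(3)] lt by force
  show ?thesis using cr[of x y u w] ef'(1-3) 1 2 lt by simp
qed

theorem list_colorable_outer_1_planar:
  assumes G: "finite_simple_graph V E" and P: "outer_1_planar V E" and deg: "\<And>v. vertex_degree E v \<le> 4"
    and dist: "crossing_distance V E \<ge> 3" and L: "\<And>e. e \<in> E \<Longrightarrow> finite (L e) \<and> 4 \<le> card (L e)"
  shows "list_colorable E L"
proof -
  have V: "finite V" and EV: "\<And>e. e \<in> E \<Longrightarrow> e \<subseteq> V" and E2: "\<And>e. e \<in> E \<Longrightarrow> card e = 2"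
    using G unfolding finite_simple_graph_def by blast+
  have fE: "finite E" by (rule finite_subset[of E "Pow V"]) (use EV V in auto)
  let ?D = "\<lambda>d. outer_1_plane V E (fst d) (snd d)"
  \<comment> \<open>The crossing distance only concerns drawings with the fewest crossings, so the
    vertex order has to be taken from such a drawing.\<close>
  obtain d where d: "?D d" "\<And>d'. ?D d' \<Longrightarrow> card (crossings V E (fst d) (snd d)) \<le> card (crossings V E (fst d') (snd d'))"
  proof -
    obtain p g where "?D (p, g)" using P unfolding outer_1_planar_def by auto
    from ex_has_least_nat[of ?D, OF this, of "\<lambda>d. card (crossings V E (fst d) (snd d))"] show ?thesis using that by blast
  qed
  define p g where "p = fst d" and "g = snd d"
  have out: "outer_1_plane V E p g" using d(1) by (simp add: p_def g_def)
  have good: "good_drawing V E p g"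
    unfolding good_drawing_def
  proof (intro conjI allI impI out)
    fix p' g' assume "outer_1_plane V E p' g'"
    then show "card (crossings V E p g) \<le> card (crossings V E p' g')" using d(2)[of "(p', g')"] by (simp add: p_def g_def)
  qed
  obtain ord :: "'a \<Rightarrow> nat" where inj: "inj_on ord V"
    and cr: "\<And>a b c d. \<lbrakk>{a, c} \<in> E; {b, d} \<in> E; ord a < ord b; ord b < ord c; ord c < ord d\<rbrakk>
       \<Longrightarrow> \<exists>x. (x, {{a, c}, {b, d}}) \<in> crossings V E p g"
    using drawing_order[OF G out] by blast
  have il: "\<exists>x. (x, {e, f}) \<in> crossings V E p g" if "e \<in> E" "f \<in> E" "interleaved (ord ` e) (ord ` f)" for e f
    by (rule interleaved_crossing[where E = E and ord = ord]) (fact E2 that cr)+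
  have injE: "e = f" if "ord ` e = ord ` f" "e \<in> E" "f \<in> E" for e f
    using inj_on_image_eq_iff[OF inj EV[OF that(2)] EV[OF that(3)]] that(1) by simp
  have once: "f = f'" if e: "e \<in> E" and f: "f \<in> E" "interleaved (ord ` e) (ord ` f)"
    and f': "f' \<in> E" "interleaved (ord ` e) (ord ` f')" for e f f'
  proof -
    obtain x y where xy: "(x, {e, f}) \<in> crossings V E p g" "(y, {e, f'}) \<in> crossings V E p g"
      using il[OF e f] il[OF e f'] by blast
    have "(x, {e, f}) = (y, {e, f'})" using out e xy unfolding outer_1_plane_def
      by (metis insertI1 snd_conv)
    then show ?thesis by (auto simp: doubleton_eq_iff)
  qed
  have edge: "{x, y} \<in> E" if xy: "{ord x, ord y} \<in> (`) ord ` E" "x \<in> V" "y \<in> V" for x y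
  proof -
    obtain e where e: "e \<in> E" "ord ` {x, y} = ord ` e" using xy(1) by auto
    have "{x, y} = e" using inj_on_image_eq_iff[OF inj _ EV[OF e(1)], of "{x, y}"] e(2) xy(2,3) by simp
    then show ?thesis using e(1) by simp
  qed
  have vert: "\<exists>z\<in>V. w = ord z" if uw: "{u, w} \<in> (`) ord ` E" for u w
  proof -
    obtain e where e: "e \<in> E" "{u, w} = ord ` e" using uw by blast
    have "w \<in> ord ` e" using e(2) by (metis insertI1 insertI2)
    then show ?thesis using EV[OF e(1)] by blast
  qed
  have "list_colorable ((`) ord ` E) (\<lambda>e. L (the_inv_into E ((`) ord) e))"
  proof (rule convex_list_colorable)
    show "finite ((`) ord ` E)" using fE by simp
    show "card e = 2" if e: "e \<in> (`) ord ` E" for e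
    proof -
      obtain f where "f \<in> E" "e = ord ` f" using e by blast
      then show ?thesis using card_image[OF inj_on_subset[OF inj EV]] E2 by metis
    qed
    show "vertex_degree ((`) ord ` E) v \<le> 4" for v by (rule vertex_degree_inj_image[OF fE _ inj deg]) (fact EV)
    show "finite (L (the_inv_into E ((`) ord) e)) \<and> 4 \<le> card (L (the_inv_into E ((`) ord) e))" if "e \<in> (`) ord ` E" for e
    proof (rule L, rule the_inv_into_into[OF _ that order_refl])
      show "inj_on ((`) ord) E" using injE by (rule inj_onI)
    qed
    show "f = h" if il': "e \<in> (`) ord ` E" "f \<in> (`) ord ` E" "h \<in> (`) ord ` E" "interleaved e f" "interleaved e h" for e f h
    proof -
      obtain e0 f0 h0 where 0: "e0 \<in> E" "e = ord ` e0" "f0 \<in> E" "f = ord ` f0" "h0 \<in> E" "h = ord ` h0" using il'(1-3) by blast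
      then show ?thesis using once[of e0 f0 h0] il'(4,5) by simp
    qed
    show "{e, f} = {e', f'}"
      if il': "e \<in> (`) ord ` E" "f \<in> (`) ord ` E" "interleaved e f" "e' \<in> (`) ord ` E" "f' \<in> (`) ord ` E" "interleaved e' f'"
        and xy: "x \<in> e \<union> f" "y \<in> e' \<union> f'"
          "x = y \<or> {x, y} \<in> (`) ord ` E \<or> (\<exists>z. {x, z} \<in> (`) ord ` E \<and> {z, y} \<in> (`) ord ` E)" for e f e' f' x y
    proof -
      obtain e0 f0 where 0: "e0 \<in> E" "e = ord ` e0" "f0 \<in> E" "f = ord ` f0" using il'(1,2) by blast
      obtain e1 f1 where 1: "e1 \<in> E" "e' = ord ` e1" "f1 \<in> E" "f' = ord ` f1" using il'(4,5) by blast
      obtain x0 where x0: "x0 \<in> e0 \<union> f0" "x = ord x0" using xy(1) 0 by blast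
      obtain y0 where y0: "y0 \<in> e1 \<union> f1" "y = ord y0" using xy(2) 1 by blast
      have xV: "x0 \<in> V" using x0(1) EV[OF 0(1)] EV[OF 0(3)] by blast
      have yV: "y0 \<in> V" using y0(1) EV[OF 1(1)] EV[OF 1(3)] by blast
      have near: "x0 = y0 \<or> {x0, y0} \<in> E \<or> (\<exists>z. {x0, z} \<in> E \<and> {z, y0} \<in> E)"
        using xy(3)
      proof (elim disjE exE conjE)
        assume "x = y"
        then have "x0 = y0" using inj_onD[OF inj _ xV yV] x0 y0 by simp
        then show ?thesis ..
      next
        assume "{x, y} \<in> (`) ord ` E"
        then have "{x0, y0} \<in> E" using edge[OF _ xV yV] x0 y0 by simp
        then show ?thesis by simp
      next
        fix z assume z: "{x, z} \<in> (`) ord ` E" "{z, y} \<in> (`) ord ` E"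
        obtain z0 where z0: "z0 \<in> V" "z = ord z0" using vert[OF z(1)] by blast
        have "{x0, z0} \<in> E" using edge[OF _ xV z0(1)] z(1) x0(2) z0(2) by simp
        moreover have "{z0, y0} \<in> E" using edge[OF _ z0(1) yV] z(2) y0(2) z0(2) by simp
        ultimately show ?thesis by blast
      qed
      obtain a where a: "(a, {e0, f0}) \<in> crossings V E p g" using il[OF 0(1,3)] il'(3) 0(2,4) by blast
      obtain b where b: "(b, {e1, f1}) \<in> crossings V E p g" using il[OF 1(1,3)] il'(6) 1(2,4) by blast
      have "{e0, f0} = {e1, f1}" by (rule crossings_apart[OF G good dist a b 0(1,3) 1(1,3) x0(1) y0(1) near])
      then have "(`) ord ` {e0, f0} = (`) ord ` {e1, f1}" by (rule arg_cong)
      then show ?thesis using 0 1 by simp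
    qed
  qed
  then show ?thesis by (rule list_colorable_transfer[OF _ inj, rotated]) (fact EV)
qed

lemma proper_edge_coloring_degree_le:
  assumes "finite E" "proper_edge_coloring E c" "c ` E \<subseteq> {..<k}"
  shows "vertex_degree E v \<le> k"
proof -
  have "inj_on c {e \<in> E. v \<in> e}" using assms(2) unfolding proper_edge_coloring_def inj_on_def by blast
  then have "card {e \<in> E. v \<in> e} \<le> card {..<k}" by (rule card_inj_on_le) (use assms(3) in auto)
  then show ?thesis by (simp add: vertex_degree_def)
qed

theorem theorem1p1:
  fixes V :: "'a set" and E :: "'a set set"
  assumes "finite_simple_graph V E"
    and "outer_1_planar V E"
    and "max_degree V E = 4"
    and "crossing_distance V E \<ge> 3"
  shows "list_edge_chromatic_number E = edge_chromatic_number E \<and> edge_chromatic_number E = 4"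
proof -
  have V: "finite V" and EV: "\<And>e. e \<in> E \<Longrightarrow> e \<subseteq> V"
    using assms(1) unfolding finite_simple_graph_def by blast+
  have fE: "finite E" by (rule finite_subset[of E "Pow V"]) (use EV V in auto)
  have fD: "finite (insert 0 (vertex_degree E ` V))" using V by simp
  have deg: "vertex_degree E v \<le> 4" for v
  proof (cases "v \<in> V")
    case True
    then show ?thesis using Max_ge[OF fD, of "vertex_degree E v"] assms(3) by (simp add: max_degree_def)
  next
    case False
    then have none: "{e \<in> E. v \<in> e} = {}" using EV by blast
    show ?thesis unfolding vertex_degree_def none by simp
  qed
  have "4 \<in> insert 0 (vertex_degree E ` V)" using Max_in[OF fD] assms(3) by (simp add: max_degree_def)
  then obtain v where v: "vertex_degree E v = 4" by auto
  note colorable = list_colorable_outer_1_planar[OF assms(1,2) deg assms(4), unfolded list_colorable_def]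
  have "list_edge_chromatic_number E = 4"
    unfolding list_edge_chromatic_number_def
  proof (rule Least_equality)
    show "\<forall>L :: 'a set \<Rightarrow> nat set. (\<forall>e\<in>E. finite (L e) \<and> card (L e) = 4) \<longrightarrow>
        (\<exists>c. proper_edge_coloring E c \<and> (\<forall>e\<in>E. c e \<in> L e))"
    proof (intro allI impI)
      fix L :: "'a set \<Rightarrow> nat set" assume "\<forall>e\<in>E. finite (L e) \<and> card (L e) = 4"
      then show "\<exists>c. proper_edge_coloring E c \<and> (\<forall>e\<in>E. c e \<in> L e)" by (intro colorable) simp
    qed
    fix k assume "\<forall>L :: 'a set \<Rightarrow> nat set. (\<forall>e\<in>E. finite (L e) \<and> card (L e) = k) \<longrightarrow>
        (\<exists>c. proper_edge_coloring E c \<and> (\<forall>e\<in>E. c e \<in> L e))"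
    \<comment> \<open>Constant lists turn the list colouring into one with \<open>k\<close> colours,
      and the four edges at \<open>v\<close> need different colours.\<close>
    from spec[OF this, of "\<lambda>_. {..<k}"] obtain c where "proper_edge_coloring E c" "\<forall>e\<in>E. c e \<in> {..<k}" by auto
    then show "4 \<le> k" using proper_edge_coloring_degree_le[OF fE, of c k v] v by auto
  qed
  moreover have "edge_chromatic_number E = 4"
    unfolding edge_chromatic_number_def
  proof (rule Least_equality)
    show "\<exists>c. proper_edge_coloring E c \<and> c ` E \<subseteq> {..<4}" using colorable[of "\<lambda>_. {..<4}"] by auto
    show "4 \<le> k" if "\<exists>c. proper_edge_coloring E c \<and> c ` E \<subseteq> {..<k}" for k
      using that proper_edge_coloring_degree_le[OF fE, of _ k v] v by auto
  qed
  ultimately show ?thesis by simp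
qed

end
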